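(* Let $k\le m$ and let $A(x)$ be a $k\times m$ matrix function on $[a,b]$. Consider on $L^2_k(a,b)$ the operator $$Sf=L(x)f(x)+\mathrm{P.V.}\int_a^b\frac{D(x,t)}{x-t}f(t)\,dt,$$ where the $k\times k$ matrix functions $L(x)$, $D(x,t)$ satisfy $L(x)=L^{*}(x)$, $D(x,t)=-D^{*}(t,x)$, and suppose that the kernel $D$ is degenerate of the form $D(x,t)=iA(x)A^{*}(t)$. If the operator $S$ is invertible, then the operator $T=S^{-1}$ has the form $$Tf=M(x)f(x)+\mathrm{P.V.}\int_a^b\frac{E(x,t)}{x-t}f(t)\,dt,$$ where $M(x)=M^{*}(x)$ and the kernel $E(x,t)$ is also degenerate and has the form $E(x,t)=-iB(x)B^{*}(t)$ with $B(x)$ a $k\times m$ matrix function.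
   Context: $L^2_k(a,b)$ is the Hilbert space of square-integrable $\mathbb{C}^k$-valued (column-vector) functions on the finite interval $(a,b)$. $\mathrm{P.V.}$ indicates that the integral is understood as a Cauchy principal value. ${}^{*}$ is the conjugate transpose of a matrix. The operator $S$ is understood to be a bounded operator on $L^2_k(a,b)$. It satisfies the operator identity $(QS-SQ)f=\int_a^b D(x,t)f(t)\,dt$, where $Qf=xf(x)$. *)

theory Defs
  imports "HOL-Analysis.Analysis"
begin

definition adjoint_matrix :: "complex ^ 'n ^ 'm \<Rightarrow> complex ^ 'm ^ 'n"
  where "adjoint_matrix A = (\<chi> i j. cnj (A $ j $ i))"

text \<open>
  Elements of \<open>L\<^sup>2\<^sub>k(a,b)\<close> are represented by functions on the real line whose values outside
  \<open>(a,b)\<close> are irrelevant; two functions represent the same element iff they agree almost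
  everywhere on \<open>(a,b)\<close>. Operators act on representatives.
\<close>

definition L2_functions :: "real \<Rightarrow> real \<Rightarrow> (real \<Rightarrow> complex ^ 'k) set"
  where "L2_functions a b =
    {f. f \<in> borel_measurable (lebesgue_on {a<..<b}) \<and>
        integrable (lebesgue_on {a<..<b}) (\<lambda>x. (norm (f x))\<^sup>2)}"

definition L2_norm :: "real \<Rightarrow> real \<Rightarrow> (real \<Rightarrow> complex ^ 'k) \<Rightarrow> real"
  where "L2_norm a b f = sqrt (integral\<^sup>L (lebesgue_on {a<..<b}) (\<lambda>x. (norm (f x))\<^sup>2))"

definition L2_eq :: "real \<Rightarrow> real \<Rightarrow> (real \<Rightarrow> complex ^ 'k) \<Rightarrow> (real \<Rightarrow> complex ^ 'k) \<Rightarrow> bool"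
  where "L2_eq a b f g \<longleftrightarrow> (AE x in lebesgue_on {a<..<b}. f x = g x)"

definition bounded_L2_operator ::
    "real \<Rightarrow> real \<Rightarrow> ((real \<Rightarrow> complex ^ 'k) \<Rightarrow> (real \<Rightarrow> complex ^ 'k)) \<Rightarrow> bool"
  where "bounded_L2_operator a b S \<longleftrightarrow>
    (\<forall>f \<in> L2_functions a b. S f \<in> L2_functions a b) \<and>
    (\<forall>f \<in> L2_functions a b. \<forall>g \<in> L2_functions a b. L2_eq a b f g \<longrightarrow> L2_eq a b (S f) (S g)) \<and>
    (\<forall>f \<in> L2_functions a b. \<forall>g \<in> L2_functions a b.
        L2_eq a b (S (\<lambda>x. f x + g x)) (\<lambda>x. S f x + S g x)) \<and>
    (\<forall>c. \<forall>f \<in> L2_functions a b. L2_eq a b (S (\<lambda>x. c *s f x)) (\<lambda>x. c *s S f x)) \<and>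
    (\<exists>C. \<forall>f \<in> L2_functions a b. L2_norm a b (S f) \<le> C * L2_norm a b f)"

definition is_L2_inverse ::
    "real \<Rightarrow> real \<Rightarrow> ((real \<Rightarrow> complex ^ 'k) \<Rightarrow> (real \<Rightarrow> complex ^ 'k))
      \<Rightarrow> ((real \<Rightarrow> complex ^ 'k) \<Rightarrow> (real \<Rightarrow> complex ^ 'k)) \<Rightarrow> bool"
  where "is_L2_inverse a b S T \<longleftrightarrow>
    bounded_L2_operator a b T \<and>
    (\<forall>f \<in> L2_functions a b. L2_eq a b (T (S f)) f \<and> L2_eq a b (S (T f)) f)"

definition has_pv_integral ::
    "real \<Rightarrow> real \<Rightarrow> real \<Rightarrow> (real \<Rightarrow> complex ^ 'k) \<Rightarrow> complex ^ 'k \<Rightarrow> bool"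
  where "has_pv_integral a b x g I \<longleftrightarrow>
    (\<forall>\<epsilon>>0. set_integrable lebesgue {t \<in> {a<..<b}. \<epsilon> < \<bar>x - t\<bar>} g) \<and>
    ((\<lambda>\<epsilon>. set_lebesgue_integral lebesgue {t \<in> {a<..<b}. \<epsilon> < \<bar>x - t\<bar>} g) \<longlongrightarrow> I) (at_right 0)"

text \<open>
  The principal value is required to exist for almost every \<open>x\<close>; the exceptional null set may
  depend on \<open>f\<close>.
\<close>

definition has_pv_form ::
    "real \<Rightarrow> real \<Rightarrow> ((real \<Rightarrow> complex ^ 'k) \<Rightarrow> (real \<Rightarrow> complex ^ 'k))
      \<Rightarrow> (real \<Rightarrow> complex ^ 'k ^ 'k) \<Rightarrow> (real \<Rightarrow> real \<Rightarrow> complex ^ 'k ^ 'k) \<Rightarrow> bool"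
  where "has_pv_form a b S L D \<longleftrightarrow>
    (\<forall>f \<in> L2_functions a b. AE x in lebesgue_on {a<..<b}.
       \<exists>I. has_pv_integral a b x (\<lambda>t. (1 / (x - t)) *\<^sub>R (D x t *v f t)) I \<and>
           S f x = L x *v f x + I)"

definition Q_op :: "(real \<Rightarrow> complex ^ 'k) \<Rightarrow> (real \<Rightarrow> complex ^ 'k)"
  where "Q_op f = (\<lambda>x. x *\<^sub>R f x)"

definition satisfies_operator_identity ::
    "real \<Rightarrow> real \<Rightarrow> ((real \<Rightarrow> complex ^ 'k) \<Rightarrow> (real \<Rightarrow> complex ^ 'k))
      \<Rightarrow> (real \<Rightarrow> real \<Rightarrow> complex ^ 'k ^ 'k) \<Rightarrow> bool"
  where "satisfies_operator_identity a b S D \<longleftrightarrow>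
    (\<forall>f \<in> L2_functions a b. AE x in lebesgue_on {a<..<b}.
       integrable (lebesgue_on {a<..<b}) (\<lambda>t. D x t *v f t) \<and>
       Q_op (S f) x - S (Q_op f) x =
         integral\<^sup>L (lebesgue_on {a<..<b}) (\<lambda>t. D x t *v f t))"

end

theory Submission
  imports Defs
begin

text \<open>
  The operator identity says that \<open>[Q, S]\<close> is the finite rank operator \<open>i A \<integral> A\<^sup>* \<dots>\<close>, and it forces the columns
  of \<open>A\<close> to lie in \<open>L\<^sup>2\<close>. Since \<open>L\<close> is hermitian and the principal value kernel is hermitian, \<open>S\<close> and hence \<open>T\<close>
  are symmetric, and with \<open>B = T A\<close> one gets \<open>[Q, T] = - i B \<integral> B\<^sup>* \<dots>\<close>. The operator
  \<open>f \<mapsto> T f + i B H(B\<^sup>* f)\<close>, where \<open>H\<close> is the principal value integral with kernel \<open>1 / (x - t)\<close>, then commutes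
  with \<open>Q\<close> and is therefore multiplication by a matrix function \<open>M\<close>; symmetry of \<open>T\<close> makes \<open>M\<close> hermitian.

  Only \<open>B\<^sup>* f \<in> L\<^sup>1\<close> is available, so \<open>H\<close> is needed on \<open>L\<^sup>1\<close>. Following Loomis, Boole's identity for
  \<open>\<Sum> p\<^sub>i / (y - x\<^sub>i)\<close> and the monotonicity of \<open>1 / (y - t)\<close> between poles give the weak type \<open>(1, 1)\<close> estimate for the
  maximal truncated transform of point masses; it passes to densities by discretization and yields almost everywhere
  existence of the principal value. The antisymmetry of \<open>H\<close> on bounded functions, which decides when the operators
  above are symmetric, follows from uniform integrability of the truncated transforms.
\<close>

section \<open>Boole's identity and the maximal inequality for point masses\<close>

text \<open>Two arguments run over the same class of functions, and this fixes the shape of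
  \<open>measurable_approx_induct\<close>: constants, sums, multiplication by the variable,
  dominated limits. Constants have an explicit transform, and multiplication by the variable changes
  both the transform and \<open>R\<close> by a known term, because t / (x - t) = x / (x - t) - 1 is
  the commutator identity of the kernel itself.

  The obstacle to symmetry is that the transform of an integrable function need not be integrable,
  so the pairing of \<open>adjoint_apply B g\<close> with the transform of
  \<open>adjoint_apply B f\<close> may make no sense. It is therefore formed only for bounded
  functions that vanish where \<open>B\<close> or \<open>M\<close> is large, and boundedness of the
  operator extends the result. No square-integrable theory of the transform enters: the uniform
  integrability behind antisymmetry comes from playing the weak type estimate off against its own
  dual form, with constants that do not depend on the truncation \<epsilon>.\<close>

lemma prod_linear_factors:
  fixes R :: "real set"
  assumes "finite R"
  shows "degree (\<Prod>r\<in>R. [:-r, 1:]) = card R"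
    and "coeff (\<Prod>r\<in>R. [:-r, 1:]) (card R) = 1"
    and "R \<noteq> {} \<Longrightarrow> coeff (\<Prod>r\<in>R. [:-r, 1:]) (card R - 1) = - \<Sum>R"
proof -
  have *: "degree (\<Prod>r\<in>R. [:-r, 1:]) = card R \<and> coeff (\<Prod>r\<in>R. [:-r, 1:]) (card R) = 1 \<and>
      (R \<noteq> {} \<longrightarrow> coeff (\<Prod>r\<in>R. [:-r, 1:]) (card R - 1) = - \<Sum>R)"
    using assms
  proof (induction R rule: finite_induct)
    case empty
    then show ?case by simp
  next
    case (insert x F)
    define q where "q = (\<Prod>r\<in>F. [:-r, 1:])"
    have q: "degree q = card F" "coeff q (card F) = 1"
      "F \<noteq> {} \<Longrightarrow> coeff q (card F - 1) = - \<Sum>F"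
      using insert.IH by (auto simp: q_def)
    have eq: "(\<Prod>r\<in>insert x F. [:-r, 1:]) = [:-x, 1:] * q"
      using insert.hyps by (simp add: q_def)
    have "q \<noteq> 0" using q(2) by auto
    then have "degree ([:-x, 1:] * q) = Suc (card F)"
      using q(1) by (subst degree_mult_eq) auto
    moreover have "coeff ([:-x, 1:] * q) (Suc (card F)) = 1"
      using q(1,2) by (simp add: coeff_eq_0)
    moreover have "coeff ([:-x, 1:] * q) (card F) = - \<Sum>(insert x F)"
    proof (cases "F = {}")
      case True
      then show ?thesis using q by (simp add: q_def)
    next
      case False
      then have "card F \<noteq> 0" using insert.hyps by auto
      then obtain m where "card F = Suc m" using not0_implies_Suc by blast
      then show ?thesis using q False insert.hyps by simp
    qed
    ultimately show ?case using insert.hyps eq by simp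
  qed
  show "degree (\<Prod>r\<in>R. [:-r, 1:]) = card R"
    and "coeff (\<Prod>r\<in>R. [:-r, 1:]) (card R) = 1"
    and "R \<noteq> {} \<Longrightarrow> coeff (\<Prod>r\<in>R. [:-r, 1:]) (card R - 1) = - \<Sum>R"
    using * by auto
qed

text \<open>Clearing denominators turns the equation into a monic polynomial of degree
  \<open>card X\<close>. Sign changes place one root after each pole, so these are all the roots,
  and Vieta's formula for their sum gives the total length of the intervals
  \<open>{x..r x}\<close>.\<close>

lemma boole_roots:
  fixes X :: "real set" and p :: "real \<Rightarrow> real"
  assumes "finite X" "\<And>x. x \<in> X \<Longrightarrow> 0 < p x" "0 < \<alpha>"
  obtains r where "\<And>x. x \<in> X \<Longrightarrow> x < r x"
    "\<And>x. x \<in> X \<Longrightarrow> X \<inter> {x<..r x} = {}"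
    "\<And>x. x \<in> X \<Longrightarrow> (\<Sum>t\<in>X. p t / (r x - t)) = \<alpha>"
    "(\<Sum>x\<in>X. r x - x) = (\<Sum>x\<in>X. p x) / \<alpha>"
proof (cases "X = {}")
  case True
  then show ?thesis using that by simp
next
  case False
  note fin = assms(1) and pos = assms(2) and lam = assms(3)
  define P where "P = (\<lambda>X. \<Prod>x\<in>X. [:-x, 1:] :: real poly)"
  \<comment> \<open>Off the poles \<open>q\<close> is \<open>P X\<close> times
    \<open>1 - (\<Sum>x\<in>X. p x / (y - x)) / \<alpha>\<close>, see \<open>pq'\<close>; dividing
    by \<alpha> rather than clearing it keeps \<open>q\<close> monic.\<close>
  define q where "q = P X - smult (1/\<alpha>) (\<Sum>x\<in>X. smult (p x) (P (X - {x})))"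
  define n where "n = card X"
  have n: "n > 0" using fin False by (simp add: n_def card_gt_0_iff)
  have cP: "coeff (P (X - {x})) n = 0" "coeff (P (X - {x})) (n - 1) = 1"
    "degree (P (X-{x})) \<le> n" if "x \<in> X" for x
    using prod_linear_factors[of "X - {x}"] fin that n
    by (auto simp: P_def n_def coeff_eq_0)
  have PX: "degree (P X) = n" "coeff (P X) n = 1" "coeff (P X) (n-1) = - \<Sum>X"
    using prod_linear_factors[of X] fin False by (auto simp: P_def n_def)
  have cq: "coeff q n = 1" "coeff q (n - 1) = - \<Sum>X - (\<Sum>x\<in>X. p x) / \<alpha>"
    using cP PX by (simp_all add: q_def coeff_sum)
  have "degree (\<Sum>x\<in>X. smult (p x) (P (X - {x}))) \<le> n"
    by (rule degree_sum_le[OF fin]) (use cP(3) degree_smult_le order_trans in blast)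
  then have dq: "degree q \<le> n"
    unfolding q_def using PX(1)
    by (intro degree_diff_le) (auto intro: order_trans[OF degree_smult_le])
  have pP: "poly (P X) y = (\<Prod>x\<in>X. y - x)" for X y
    by (simp add: P_def poly_prod)
  have pq: "poly q y = (\<Prod>x\<in>X. y - x) - (\<Sum>x\<in>X. p x * (\<Prod>j\<in>X-{x}. y - j)) / \<alpha>" for y
    by (simp add: q_def pP poly_sum)
  have pq': "poly q y = (\<Prod>x\<in>X. y - x) * (1 - (\<Sum>x\<in>X. p x / (y - x)) / \<alpha>)" if "y \<notin> X" for y
  proof -
    have "p x * (\<Prod>j\<in>X-{x}. y - j) = (\<Prod>x\<in>X. y - x) * (p x / (y - x))" if "x \<in> X" for x
    proof -
      have "y - x \<noteq> 0" using that \<open>y \<notin> X\<close> by auto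
      then show ?thesis by (simp add: prod.remove[OF fin that, of "\<lambda>j. y - j"])
    qed
    then show ?thesis
      by (simp add: pq sum_distrib_left right_diff_distrib)
  qed
  have pqx: "poly q x = - p x * (\<Prod>j\<in>X-{x}. x - j) / \<alpha>" if "x \<in> X" for x
  proof -
    have z: "(\<Prod>i\<in>X. x - i) = 0" using fin that by auto
    have "(\<Sum>i\<in>X. p i * (\<Prod>j\<in>X-{i}. x - j)) = (\<Sum>i\<in>X. if i = x then p x * (\<Prod>j\<in>X-{x}. x - j) else 0)"
      by (rule sum.cong) (use fin that in auto)
    also have "\<dots> = p x * (\<Prod>j\<in>X-{x}. x - j)" using fin that by simp
    finally show ?thesis by (simp add: pq z)
  qed
  have ex: "\<exists>r>x. X \<inter> {x<..r} = {} \<and> poly q r = 0" if x: "x \<in> X" for x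
  proof (cases "\<exists>s\<in>X. x < s")
    case True
    define s where "s = Min {s\<in>X. x < s}"
    have s: "s \<in> X" "x < s" and smin: "\<And>j. j \<in> X \<Longrightarrow> x < j \<Longrightarrow> s \<le> j"
    proof -
      have "Min {s\<in>X. x < s} \<in> {s\<in>X. x < s}" by (rule Min_in) (use True fin in auto)
      then show "s \<in> X" "x < s" by (auto simp: s_def)
      show "\<And>j. j \<in> X \<Longrightarrow> x < j \<Longrightarrow> s \<le> j"
        unfolding s_def by (rule Min_le) (use fin in auto)
    qed
    have e1: "(\<Prod>j\<in>X-{x}. x - j) = (x - s) * (\<Prod>j\<in>X-{x}-{s}. x - j)"
      by (rule prod.remove) (use s fin in auto)
    have e2: "(\<Prod>j\<in>X-{s}. s - j) = (s - x) * (\<Prod>j\<in>X-{s}-{x}. s - j)"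
      by (rule prod.remove) (use s fin x in auto)
    have e3: "X-{s}-{x} = X-{x}-{s}" by auto
    \<comment> \<open>Neighbouring poles \<open>x\<close> and \<open>s\<close> lie on the same side
      of every other pole, so only the factors \<open>x - s\<close> and \<open>s - x\<close> differ
      in sign and \<open>q\<close> changes sign between them.\<close>
    have "0 < (\<Prod>j\<in>X-{x}-{s}. (x - j) * (s - j))"
    proof (rule prod_pos)
      fix j assume j: "j \<in> X-{x}-{s}"
      then have "j < x \<or> s < j" using smin[of j] by force
      then show "0 < (x - j) * (s - j)" using s(2) by (auto intro: mult_neg_neg)
    qed
    moreover have "poly q x * poly q s = - (p x * p s * (s - x) * (s - x) / (\<alpha> * \<alpha>) *
        (\<Prod>j\<in>X-{x}-{s}. (x - j) * (s - j)))"
    proof -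
      have "- u * (- d * P1) / \<alpha> * (- v * (d * P2) / \<alpha>) = - (u * v * d * d / (\<alpha> * \<alpha>) * (P1 * P2))"
        for u v d P1 P2 :: real by (simp add: mult_ac)
      from this[of "p x" "s - x" _ "p s"] show ?thesis
        unfolding pqx[OF x] pqx[OF s(1)] e1 e2 e3 prod.distrib by simp
    qed
    ultimately have "poly q x * poly q s < 0"
      using pos[OF x] pos[OF s(1)] s(2) lam by simp
    from poly_IVT[OF s(2) this] obtain r where r: "x < r" "r < s" "poly q r = 0" by auto
    then have "X \<inter> {x<..r} = {}" using smin by force
    with r show ?thesis by blast
  next
    case False
    then have mx: "j \<le> x" if "j \<in> X" for j using that by force
    have "0 < (\<Prod>j\<in>X-{x}. x - j)"
      by (rule prod_pos) (use mx in \<open>force simp: less_le\<close>)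
    then have neg: "poly q x < 0" using pqx[OF x] pos[OF x] lam by simp
    \<comment> \<open>Right of the last pole, at a distance exceeding the total mass divided by
      \<alpha>, the sum has dropped below \<alpha>, so \<open>q\<close> is positive there.\<close>
    define y where "y = x + (\<Sum>x\<in>X. p x) / \<alpha> + 1"
    have sp: "0 \<le> (\<Sum>x\<in>X. p x)" by (rule sum_nonneg) (use pos less_imp_le in auto)
    have xy: "x < y" using sp lam by (simp add: y_def add_nonneg_pos)
    then have yX: "y \<notin> X" using mx by force
    have "(\<Sum>j\<in>X. p j / (y - j)) \<le> (\<Sum>j\<in>X. p j / (y - x))"
    proof (rule sum_mono)
      fix j assume j: "j \<in> X"
      then have "y - x \<le> y - j" "0 < y - x" "0 < p j" using mx[OF j] xy pos by auto
      then show "p j / (y - j) \<le> p j / (y - x)" by (intro divide_left_mono) auto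
    qed
    also have "\<dots> = (\<Sum>j\<in>X. p j) / (y - x)" by (simp add: sum_divide_distrib)
    also have "\<dots> < \<alpha>"
    proof -
      have "(\<Sum>j\<in>X. p j) < \<alpha> * (y - x)" using lam by (simp add: y_def field_simps)
      then show ?thesis using xy by (simp add: divide_less_eq)
    qed
    finally have "(\<Sum>j\<in>X. p j / (y - j)) / \<alpha> < 1" using lam by simp
    moreover have "0 < (\<Prod>j\<in>X. y - j)" by (rule prod_pos) (use mx xy in force)
    ultimately have "0 < poly q y" by (simp add: pq'[OF yX])
    from poly_IVT_pos[OF xy neg this] obtain r where r: "x < r" "poly q r = 0" by auto
    moreover have "X \<inter> {x<..r} = {}" using mx by force
    ultimately show ?thesis by blast
  qed
  then obtain r where r: "\<And>x. x \<in> X \<Longrightarrow> x < r x" "\<And>x. x \<in> X \<Longrightarrow> X \<inter> {x<..r x} = {}"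
    "\<And>x. x \<in> X \<Longrightarrow> poly q (r x) = 0" by metis
  have inj: "inj_on r X"
  proof (rule inj_onI)
    fix x y assume "x \<in> X" "y \<in> X" "r x = r y"
    then show "x = y"
      using r(1)[of x] r(2)[of x] r(1)[of y] r(2)[of y] by (cases x y rule: linorder_cases) auto
  qed
  have rX: "r x \<notin> X" if "x \<in> X" for x using r(1,2)[OF that] by auto
  have root: "(\<Sum>t\<in>X. p t / (r x - t)) = \<alpha>" if x: "x \<in> X" for x
  proof -
    have "(\<Prod>t\<in>X. r x - t) \<noteq> 0" using rX[OF x] fin by auto
    then show ?thesis using r(3)[OF x] pq'[OF rX[OF x]] lam by simp
  qed
  have cR: "card (r ` X) = n" using inj by (simp add: card_image n_def)
  \<comment> \<open>Both sides are monic of degree \<open>n\<close> and vanish at the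
    \<open>n\<close> distinct points \<open>r x\<close>, so comparing their next coefficients yields
    the sum of the roots.\<close>
  have "q = P (r ` X)"
  proof (rule poly_eqI_degree_lead_coeff[where n = n and A = "r ` X"])
    have "degree (P (r`X)) = n" "coeff (P (r`X)) n = 1"
      using prod_linear_factors(1,2)[of "r ` X"] fin cR by (auto simp: P_def)
    then show "degree (P (r ` X)) \<le> n" "coeff q n = coeff (P (r ` X)) n" using cq by auto
    show "card (r ` X) \<ge> n" using cR by simp
    fix z assume "z \<in> r ` X"
    then show "poly q z = poly (P (r ` X)) z" using r(3) fin by (auto simp: pP)
  qed (use dq in auto)
  then have "coeff q (n - 1) = - \<Sum>(r ` X)"
    using prod_linear_factors(3)[of "r ` X"] fin cR False by (auto simp: P_def)
  then have "\<Sum>(r ` X) = \<Sum>X + (\<Sum>x\<in>X. p x) / \<alpha>" using cq by simp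
  then have "(\<Sum>x\<in>X. r x - x) = (\<Sum>x\<in>X. p x) / \<alpha>"
    by (simp add: sum.reindex[OF inj] sum_subtractf)
  then show ?thesis using that[OF r(1,2) root] by blast
qed

text \<open>Boole's identity asserts equality of the two measures; only this half is needed.\<close>

lemma boole_bound:
  fixes X :: "real set" and p :: "real \<Rightarrow> real"
  assumes "finite X" "\<And>x. x \<in> X \<Longrightarrow> 0 \<le> p x" "0 < \<alpha>"
  obtains U where "U \<in> lmeasurable" "measure lebesgue U \<le> (\<Sum>x\<in>X. p x) / \<alpha>"
    "\<And>y. y \<notin> X \<Longrightarrow> (\<Sum>x\<in>X. p x / (y - x)) > \<alpha> \<Longrightarrow> y \<in> U"
proof -
  define Z where "Z = {x\<in>X. 0 < p x}"
  have Z: "finite Z" "\<And>x. x \<in> Z \<Longrightarrow> 0 < p x" "Z \<subseteq> X" using assms(1) by (auto simp: Z_def)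
  have p0: "p x = 0" if "x \<in> X - Z" for x using that assms(2)[of x] by (auto simp: Z_def)
  have sZ: "(\<Sum>x\<in>X. p x * h x) = (\<Sum>x\<in>Z. p x * h x)" for h
    by (rule sum.mono_neutral_right) (use assms(1) Z p0 in auto)
  obtain r where r: "\<And>x. x \<in> Z \<Longrightarrow> x < r x"
    "\<And>x. x \<in> Z \<Longrightarrow> Z \<inter> {x<..r x} = {}"
    "\<And>x. x \<in> Z \<Longrightarrow> (\<Sum>t\<in>Z. p t / (r x - t)) = \<alpha>"
    "(\<Sum>x\<in>Z. r x - x) = (\<Sum>x\<in>Z. p x) / \<alpha>"
    by (rule boole_roots[where X=Z and p=p, OF Z(1,2) assms(3)]; (assumption | (rule that; assumption)))
  define U where "U = (\<Union>x\<in>Z. {x..r x})"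
  show thesis
  proof (rule that)
    show "U \<in> lmeasurable" using Z by (auto simp: U_def intro!: fmeasurable.finite_UN)
    have "measure lebesgue U \<le> (\<Sum>x\<in>Z. measure lebesgue {x..r x})"
      unfolding U_def by (rule measure_UNION_le) (use Z in auto)
    also have "\<dots> = (\<Sum>x\<in>Z. r x - x)" by (rule sum.cong) (use r(1) less_imp_le in auto)
    finally show "measure lebesgue U \<le> (\<Sum>x\<in>X. p x) / \<alpha>"
      using r(4) sZ[of "\<lambda>_. 1"] by simp
  next
    fix y assume y: "y \<notin> X" and gt: "(\<Sum>x\<in>X. p x / (y - x)) > \<alpha>"
    have gtZ: "(\<Sum>x\<in>Z. p x / (y - x)) > \<alpha>"
      using gt sZ[of "\<lambda>x. 1 / (y - x)"] by simp
    have ne: "{x\<in>Z. x < y} \<noteq> {}"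
    proof
      assume "{x\<in>Z. x < y} = {}"
      then have "(\<Sum>x\<in>Z. p x / (y - x)) \<le> 0"
        using Z(2) by (intro sum_nonpos divide_nonneg_nonpos) (auto simp: not_less less_imp_le)
      then show False using gtZ assms(3) by simp
    qed
    define x where "x = Max {x\<in>Z. x < y}"
    have x: "x \<in> Z" "x < y" 
    proof -
      have "Max {x\<in>Z. x < y} \<in> {x\<in>Z. x < y}" by (rule Max_in[OF _ ne]) (use Z in auto)
      then show "x \<in> Z" "x < y" by (auto simp: x_def)
    qed
    have xmax: "t \<le> x" if "t \<in> Z" "t < y" for t
      using that Z by (auto simp: x_def)
    \<comment> \<open>No pole separates \<open>r x\<close> from \<open>y\<close>, and every term
      decreases away from its pole. If \<open>y\<close> lay beyond \<open>r x\<close>, the sum at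
      \<open>y\<close> would be at most its value \<alpha> at \<open>r x\<close>.\<close>
    have "y < r x"
    proof (rule ccontr)
      assume "\<not> y < r x"
      then have ry: "r x \<le> y" by simp
      have "(\<Sum>t\<in>Z. p t / (y - t)) \<le> (\<Sum>t\<in>Z. p t / (r x - t))"
      proof (rule sum_mono)
        fix t assume t: "t \<in> Z"
        show "p t / (y - t) \<le> p t / (r x - t)"
        proof (cases "t < y")
          case True
          then have "t < r x" using xmax[OF t] r(1)[OF x(1)] by simp
          then show ?thesis using Z(2)[OF t] ry by (intro divide_left_mono) auto
        next
          case False
          then have "y < t" using y t Z(3) by (cases "y = t") auto
          then show ?thesis using Z(2)[OF t] ry by (intro divide_left_mono) (auto intro: mult_neg_neg)
        qed
      qed
      then show False using r(3)[OF x(1)] gtZ by simp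
    qed
    then show "y \<in> U" using x by (auto simp: U_def intro!: bexI[of _ x])
  qed
qed

section \<open>Reflected bounds and the maximal operator of point masses\<close>

lemma lmeasurable_reflect:
  fixes U :: "real set"
  assumes "U \<in> lmeasurable"
  shows "uminus ` U \<in> lmeasurable" "measure lebesgue (uminus ` U) = measure lebesgue U"
proof -
  have eq: "uminus ` U = (\<lambda>x. (-1) *\<^sub>R x + 0) ` U" by simp
  have pre: "uminus ` U = (\<lambda>x. (-1) *\<^sub>R x) -` U \<inter> space lebesgue" by force
  have "uminus ` U \<in> sets lebesgue"
    unfolding pre by (rule measurable_sets[OF lebesgue_measurable_scaling]) (use assms in auto)
  moreover have "emeasure lebesgue (uminus ` U) = emeasure lebesgue U"
    unfolding eq emeasure_lebesgue_affine by simp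
  ultimately show "uminus ` U \<in> lmeasurable" "measure lebesgue (uminus ` U) = measure lebesgue U"
    using assms by (auto simp: fmeasurable_def measure_def)
qed

lemma boole_bound_neg:
  fixes X :: "real set" and p :: "real \<Rightarrow> real"
  assumes "finite X" "\<And>x. x \<in> X \<Longrightarrow> 0 \<le> p x" "0 < \<alpha>"
  obtains U where "U \<in> lmeasurable" "measure lebesgue U \<le> (\<Sum>x\<in>X. p x) / \<alpha>"
    "\<And>y. y \<notin> X \<Longrightarrow> (\<Sum>x\<in>X. p x / (y - x)) < - \<alpha> \<Longrightarrow> y \<in> U"
proof -
  have inj: "inj_on uminus X" for X :: "real set" by auto
  obtain U where U: "U \<in> lmeasurable"
      "measure lebesgue U \<le> (\<Sum>x\<in>uminus ` X. p (- x)) / \<alpha>"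
      "\<And>y. y \<notin> uminus ` X \<Longrightarrow> (\<Sum>x\<in>uminus ` X. p (- x) / (y - x)) > \<alpha> \<Longrightarrow> y \<in> U"
  proof (rule boole_bound[of "uminus ` X" "\<lambda>x. p (- x)" \<alpha>])
    show "finite (uminus ` X)" "0 < \<alpha>" using assms by auto
    show "0 \<le> p (- x)" if "x \<in> uminus ` X" for x using that assms(2) by auto
  qed (rule that)
  show thesis
  proof (rule that)
    show "uminus ` U \<in> lmeasurable" "measure lebesgue (uminus ` U) \<le> (\<Sum>x\<in>X. p x) / \<alpha>"
      using lmeasurable_reflect[OF U(1)] U(2) by (simp_all add: sum.reindex)
    fix y assume y: "y \<notin> X" "(\<Sum>x\<in>X. p x / (y - x)) < - \<alpha>"
    have "(\<Sum>x\<in>uminus ` X. p (- x) / (- y - x)) = (\<Sum>x\<in>X. p x / (- y + x))"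
      by (simp add: sum.reindex)
    also have "\<dots> = - (\<Sum>x\<in>X. p x / (y - x))"
      unfolding sum_negf[symmetric] by (rule sum.cong) (auto simp: minus_divide_right)
    finally have "- y \<in> U" using y by (intro U(3)) auto
    then show "y \<in> uminus ` U" by force
  qed
qed

text \<open>On \<open>(x - \<epsilon>, x)\<close> the contribution of the far points is decreasing, hence still exceeds \<open>\<alpha>\<close> there; so the full
  sum exceeds \<open>\<alpha> / 2\<close> unless the near points contribute less than \<open>- \<alpha> / 2\<close>, and Boole's bound limits the latter.\<close>

lemma discrete_maximal_covering:
  fixes X :: "real set" and p :: "real \<Rightarrow> real"
  assumes X: "finite X" and p: "\<And>x. x \<in> X \<Longrightarrow> 0 \<le> p x" and \<alpha>: "0 < \<alpha>"
    and U: "U \<in> lmeasurable" "\<And>y. y \<notin> X \<Longrightarrow> (\<Sum>t\<in>X. p t / (y - t)) > \<alpha> / 2 \<Longrightarrow> y \<in> U"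
    and \<epsilon>: "0 < \<epsilon>" and far: "(\<Sum>t\<in>{t\<in>X. \<epsilon> < \<bar>x - t\<bar>}. p t / (x - t)) > \<alpha>"
  shows "\<epsilon> \<le> measure lebesgue (U \<inter> cball x \<epsilon>) + 2 / \<alpha> * (\<Sum>t\<in>X \<inter> cball x \<epsilon>. p t)"
proof -
  define N where "N = X \<inter> cball x \<epsilon>"
  define F where "F = {t\<in>X. \<epsilon> < \<bar>x - t\<bar>}"
  have NF: "X = F \<union> N" "F \<inter> N = {}" "finite F" "finite N"
    using X by (auto simp: N_def F_def dist_real_def)
  obtain V where V: "V \<in> lmeasurable" "measure lebesgue V \<le> (\<Sum>t\<in>N. p t) / (\<alpha> / 2)"
    "\<And>y. y \<notin> N \<Longrightarrow> (\<Sum>t\<in>N. p t / (y - t)) < - (\<alpha> / 2) \<Longrightarrow> y \<in> V"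
  proof (rule boole_bound_neg[of N p "\<alpha> / 2"])
    show "\<And>t. t \<in> N \<Longrightarrow> 0 \<le> p t" using p by (auto simp: N_def)
    show "finite N" "0 < \<alpha> / 2" using NF \<alpha> by auto
  qed (rule that)
  have sub: "{x - \<epsilon><..<x} \<subseteq> X \<union> (U \<inter> cball x \<epsilon>) \<union> V"
  proof
    fix y assume y: "y \<in> {x - \<epsilon><..<x}"
    show "y \<in> X \<union> (U \<inter> cball x \<epsilon>) \<union> V"
    proof (cases "y \<in> X")
      case False
      have "(\<Sum>t\<in>F. p t / (x - t)) \<le> (\<Sum>t\<in>F. p t / (y - t))"
      proof (rule sum_mono)
        fix t assume t: "t \<in> F"
        then have "0 < (x - t) * (y - t)"
          using y by (cases "t < x") (auto simp: F_def intro: mult_pos_pos mult_neg_neg)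
        then show "p t / (x - t) \<le> p t / (y - t)"
          using p[of t] t y by (intro divide_left_mono) (auto simp: F_def)
      qed
      then have "\<alpha> < (\<Sum>t\<in>F. p t / (y - t))" using far by (simp add: F_def)
      moreover have "(\<Sum>t\<in>X. p t / (y - t)) = (\<Sum>t\<in>F. p t / (y - t)) + (\<Sum>t\<in>N. p t / (y - t))"
        unfolding NF(1) using NF by (intro sum.union_disjoint) auto
      ultimately consider "(\<Sum>t\<in>X. p t / (y - t)) > \<alpha> / 2" | "(\<Sum>t\<in>N. p t / (y - t)) < - (\<alpha> / 2)"
        by linarith
      then show ?thesis
        using U(2)[OF False] V(3)[of y] False y by cases (auto simp: N_def dist_real_def)
    qed auto
  qed
  have U': "U \<inter> cball x \<epsilon> \<in> lmeasurable" using U(1) by (intro fmeasurable.Int) auto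
  have Xn: "X \<in> null_sets lebesgue" using X by (simp add: finite_imp_null_set_lborel null_sets_completionI)
  have Xl: "X \<in> lmeasurable" "measure lebesgue X = 0"
    using Xn by (auto simp: fmeasurable_def null_sets_def measure_def)
  have "\<epsilon> = measure lebesgue {x - \<epsilon><..<x}"
    using \<epsilon> by simp
  also have "\<dots> \<le> measure lebesgue (X \<union> (U \<inter> cball x \<epsilon>) \<union> V)"
    by (rule measure_mono_fmeasurable[OF sub]) (use Xl U' V in \<open>auto intro!: fmeasurable.Un\<close>)
  also have "\<dots> \<le> measure lebesgue (X \<union> (U \<inter> cball x \<epsilon>)) + measure lebesgue V"
    by (rule measure_Un_le) (use Xl U' V in auto)
  also have "measure lebesgue (X \<union> (U \<inter> cball x \<epsilon>)) \<le> measure lebesgue X + measure lebesgue (U \<inter> cball x \<epsilon>)"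
    by (rule measure_Un_le) (use Xl U' V in auto)
  finally show ?thesis using V(2) Xl by (simp add: N_def mult.commute)
qed

text \<open>By \<open>discrete_maximal_covering\<close> a bad interval of radius \<epsilon> carries
  charge at least \<epsilon>, while the total charge is at most 4 P / \<alpha>. So the radii of
  disjoint bad intervals add up to at most 4 P / \<alpha>. The enlargements from Vitali's lemma have
  length 10 times the radius and cover all bad points, hence the constant 40.\<close>

lemma discrete_maximal_pos:
  fixes X :: "real set" and p :: "real \<Rightarrow> real"
  assumes X: "finite X" and p: "\<And>x. x \<in> X \<Longrightarrow> 0 \<le> p x" and \<alpha>: "0 < \<alpha>"
  obtains U where "U \<in> lmeasurable" "measure lebesgue U \<le> 40 * (\<Sum>x\<in>X. p x) / \<alpha>"
    "\<And>x \<epsilon>. 0 < \<epsilon> \<Longrightarrow> (\<Sum>t\<in>{t\<in>X. \<epsilon> < \<bar>x - t\<bar>}. p t / (x - t)) > \<alpha> \<Longrightarrow> x \<in> U"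
proof -
  obtain U where U: "U \<in> lmeasurable" "measure lebesgue U \<le> (\<Sum>x\<in>X. p x) / (\<alpha> / 2)"
    "\<And>y. y \<notin> X \<Longrightarrow> (\<Sum>x\<in>X. p x / (y - x)) > \<alpha> / 2 \<Longrightarrow> y \<in> U"
  proof (rule boole_bound[where X = X and p = p and \<alpha> = "\<alpha> / 2"])
    show "finite X" "\<And>t. t \<in> X \<Longrightarrow> 0 \<le> p t" "0 < \<alpha> / 2" using X p \<alpha> by auto
  qed (rule that)
  define P where "P = (\<Sum>x\<in>X. p x)"
  \<comment> \<open>This charge is additive in \<open>J\<close>, so it can be summed over disjoint
    intervals. The part from \<open>U\<close> and the part from the point masses are each at most 2
    P / \<alpha>.\<close>
  define \<nu> where "\<nu> = (\<lambda>J. measure lebesgue (U \<inter> J) + 2 / \<alpha> * (\<Sum>t\<in>X \<inter> J. p t))"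
  have \<nu>: "\<nu> J \<le> 4 * P / \<alpha>" if J: "J \<in> sets lebesgue" for J
  proof -
    have "measure lebesgue (U \<inter> J) \<le> measure lebesgue U"
      by (rule measure_mono_fmeasurable) (use U(1) J in auto)
    moreover have "(\<Sum>t\<in>X \<inter> J. p t) \<le> P"
      unfolding P_def by (rule sum_mono2) (use X p in auto)
    then have "2 / \<alpha> * (\<Sum>t\<in>X \<inter> J. p t) \<le> 2 / \<alpha> * P" using \<alpha> by (intro mult_left_mono) auto
    ultimately show ?thesis using U(2) by (simp add: \<nu>_def P_def)
  qed
  \<comment> \<open>A bad point can have many bad radii, so the covering lemma is indexed by pairs
    of a centre and a radius.\<close>
  define K where "K = {i. 0 < snd i \<and> (\<Sum>t\<in>{t\<in>X. snd i < \<bar>fst i - t\<bar>}. p t / (fst i - t)) > \<alpha>}"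
  have K: "snd i \<le> \<nu> (cball (fst i) (snd i))" if "i \<in> K" for i
    using discrete_maximal_covering[where \<epsilon> = "snd i" and x = "fst i" and p = p, OF X p \<alpha> U(1,3)] that
    by (auto simp: K_def \<nu>_def)
  have Kr: "0 < snd i \<and> snd i \<le> 4 * P / \<alpha>" if "i \<in> K" for i
    using K[OF that] \<nu>[of "cball (fst i) (snd i)"] that by (auto simp: K_def)
  obtain C where C: "countable C" "C \<subseteq> K"
    "pairwise (\<lambda>i j. disjnt (cball (fst i) (snd i)) (cball (fst j) (snd j))) C"
    "(\<Union>i\<in>K. cball (fst i) (snd i)) \<subseteq> (\<Union>i\<in>C. cball (fst i) (5 * snd i))"
    by (rule Vitali_covering_lemma_cballs[where S = "\<Union>i\<in>K. cball (fst i) (snd i)" and K = K and a = fst and r = snd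
          and B = "4 * P / \<alpha>", OF _ Kr];
        (assumption | rule order_refl | (rule that; assumption)))
  have bound: "measure lebesgue (\<Union>i\<in>I. cball (fst i) (5 * snd i)) \<le> 40 * P / \<alpha>"
    if I: "I \<subseteq> C" "finite I" for I
  proof -
    define J where "J = (\<lambda>i. cball (fst i) (snd i) :: real set)"
    have disj: "disjoint_family_on J I"
      using C(3) I(1) unfolding disjoint_family_on_def pairwise_def disjnt_def J_def by blast
    have m: "measure lebesgue (U \<inter> (\<Union>i\<in>I. J i)) = (\<Sum>i\<in>I. measure lebesgue (U \<inter> J i))"
    proof -
      have "measure lebesgue (\<Union>i\<in>I. U \<inter> J i) = (\<Sum>i\<in>I. measure lebesgue (U \<inter> J i))"
      proof (rule measure_finite_Union[OF I(2)])
        show "(\<lambda>i. U \<inter> J i) ` I \<subseteq> sets lebesgue" using U(1) by (auto simp: J_def)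
        show "disjoint_family_on (\<lambda>i. U \<inter> J i) I" using disj unfolding disjoint_family_on_def by blast
        show "emeasure lebesgue (U \<inter> J i) \<noteq> \<infinity>" for i
        proof -
          have "U \<inter> J i \<in> lmeasurable" using U(1) by (intro fmeasurable.Int) (auto simp: J_def)
          then show ?thesis by (auto simp: fmeasurable_def)
        qed
      qed
      then show ?thesis by simp
    qed
    have s: "(\<Sum>t\<in>X \<inter> (\<Union>i\<in>I. J i). p t) = (\<Sum>i\<in>I. \<Sum>t\<in>X \<inter> J i. p t)"
    proof -
      have "(\<Sum>t\<in>(\<Union>i\<in>I. X \<inter> J i). p t) = (\<Sum>i\<in>I. \<Sum>t\<in>X \<inter> J i. p t)"
        by (rule sum.UNION_disjoint) (use disj I(2) X in \<open>simp_all add: disjoint_family_on_def, blast\<close>)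
      then show ?thesis by simp
    qed
    have "(\<Sum>i\<in>I. snd i) \<le> (\<Sum>i\<in>I. \<nu> (J i))"
      by (rule sum_mono) (use K I(1) C(2) in \<open>auto simp: J_def\<close>)
    also have "\<dots> = \<nu> (\<Union>i\<in>I. J i)"
      by (simp only: \<nu>_def m s sum.distrib sum_distrib_left[symmetric])
    also have "\<dots> \<le> 4 * P / \<alpha>"
      by (rule \<nu>) (use I(2) in \<open>auto simp: J_def\<close>)
    finally have sI: "(\<Sum>i\<in>I. snd i) \<le> 4 * P / \<alpha>" .
    have "measure lebesgue (\<Union>i\<in>I. cball (fst i) (5 * snd i)) \<le> (\<Sum>i\<in>I. measure lebesgue (cball (fst i) (5 * snd i)))"
      by (rule measure_UNION_le) (use I in auto)
    also have "\<dots> = (\<Sum>i\<in>I. 10 * snd i)"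
      by (rule sum.cong) (use I(1) C(2) Kr in \<open>auto simp: cball_eq_atLeastAtMost less_imp_le\<close>)
    also have "\<dots> \<le> 40 * P / \<alpha>" using sI by (simp add: sum_distrib_left[symmetric])
    finally show ?thesis .
  qed
  show thesis
  proof (rule that)
    show "(\<Union>i\<in>C. cball (fst i) (5 * snd i)) \<in> lmeasurable"
      by (rule fmeasurable_UN_bound[OF C(1) _ bound]) auto
    show "measure lebesgue (\<Union>i\<in>C. cball (fst i) (5 * snd i)) \<le> 40 * (\<Sum>x\<in>X. p x) / \<alpha>"
      unfolding P_def[symmetric] by (rule measure_UN_bound[OF C(1) _ bound]) auto
    fix x \<epsilon> :: real assume "0 < \<epsilon>" "(\<Sum>t\<in>{t\<in>X. \<epsilon> < \<bar>x - t\<bar>}. p t / (x - t)) > \<alpha>"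
    then have "(x, \<epsilon>) \<in> K" by (simp add: K_def)
    then have "x \<in> (\<Union>i\<in>K. cball (fst i) (snd i))" using \<open>0 < \<epsilon>\<close> by (force intro!: bexI[of _ "(x, \<epsilon>)"])
    then show "x \<in> (\<Union>i\<in>C. cball (fst i) (5 * snd i))" using C(4) by blast
  qed
qed

text \<open>Reflecting the points exchanges the two signs of the sum, so the constant
  doubles.\<close>

lemma discrete_maximal:
  fixes X :: "real set" and p :: "real \<Rightarrow> real"
  assumes X: "finite X" and p: "\<And>x. x \<in> X \<Longrightarrow> 0 \<le> p x" and \<alpha>: "0 < \<alpha>"
  obtains U where "U \<in> lmeasurable" "measure lebesgue U \<le> 80 * (\<Sum>x\<in>X. p x) / \<alpha>"
    "\<And>x \<epsilon>. 0 < \<epsilon> \<Longrightarrow> \<bar>\<Sum>t\<in>{t\<in>X. \<epsilon> < \<bar>x - t\<bar>}. p t / (x - t)\<bar> > \<alpha> \<Longrightarrow> x \<in> U"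
proof -
  obtain U where U: "U \<in> lmeasurable" "measure lebesgue U \<le> 40 * (\<Sum>x\<in>X. p x) / \<alpha>"
    "\<And>x \<epsilon>. 0 < \<epsilon> \<Longrightarrow> (\<Sum>t\<in>{t\<in>X. \<epsilon> < \<bar>x - t\<bar>}. p t / (x - t)) > \<alpha> \<Longrightarrow> x \<in> U"
    by (rule discrete_maximal_pos[where X = X and p = p and \<alpha> = \<alpha>, OF X p \<alpha>];
        (assumption | (rule that; assumption)))
  obtain V where V: "V \<in> lmeasurable" "measure lebesgue V \<le> 40 * (\<Sum>x\<in>uminus ` X. p (- x)) / \<alpha>"
    "\<And>x \<epsilon>. 0 < \<epsilon> \<Longrightarrow> (\<Sum>t\<in>{t\<in>uminus ` X. \<epsilon> < \<bar>x - t\<bar>}. p (- t) / (x - t)) > \<alpha> \<Longrightarrow> x \<in> V"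
  proof (rule discrete_maximal_pos[where X = "uminus ` X" and p = "\<lambda>x. p (- x)" and \<alpha> = \<alpha>])
    show "finite (uminus ` X)" "\<And>t. t \<in> uminus ` X \<Longrightarrow> 0 \<le> p (- t)" "0 < \<alpha>" using X p \<alpha> by auto
  qed (rule that)
  have W: "U \<union> uminus ` V \<in> lmeasurable" using U(1) lmeasurable_reflect(1)[OF V(1)] by auto
  show thesis
  proof (rule that[OF W])
    have "measure lebesgue (U \<union> uminus ` V) \<le> measure lebesgue U + measure lebesgue (uminus ` V)"
      by (rule measure_Un_le) (use U(1) lmeasurable_reflect(1)[OF V(1)] in auto)
    also have "\<dots> \<le> 80 * (\<Sum>x\<in>X. p x) / \<alpha>"
      using U(2) V(2) lmeasurable_reflect(2)[OF V(1)] by (simp add: sum.reindex)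
    finally show "measure lebesgue (U \<union> uminus ` V) \<le> 80 * (\<Sum>x\<in>X. p x) / \<alpha>" .
    fix x \<epsilon> :: real
    assume \<epsilon>: "0 < \<epsilon>" and gt: "\<bar>\<Sum>t\<in>{t\<in>X. \<epsilon> < \<bar>x - t\<bar>}. p t / (x - t)\<bar> > \<alpha>"
    have e: "{t\<in>uminus ` X. \<epsilon> < \<bar>- x - t\<bar>} = uminus ` {t\<in>X. \<epsilon> < \<bar>x - t\<bar>}" by auto
    have "(\<Sum>t\<in>{t\<in>uminus ` X. \<epsilon> < \<bar>- x - t\<bar>}. p (- t) / (- x - t)) = - (\<Sum>t\<in>{t\<in>X. \<epsilon> < \<bar>x - t\<bar>}. p t / (x - t))"
      unfolding e by (subst sum.reindex) (auto simp: sum_negf[symmetric] minus_divide_right intro!: sum.cong)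
    then have "x \<in> U \<or> - x \<in> V"
      using gt U(3)[OF \<epsilon>, of x] V(3)[OF \<epsilon>, of "- x"] by (auto simp: abs_if split: if_splits)
    then show "x \<in> U \<union> uminus ` V" by force
  qed
qed

section \<open>The truncated Hilbert transform\<close>

text \<open>The strict inequality matches the truncation in \<open>has_pv_integral\<close>. For
  fixed \<open>x\<close> the truncated kernel jumps only at t = x - \<epsilon> and t = x +
  \<epsilon>.\<close>

definition hilbert_kernel :: "real \<Rightarrow> real \<Rightarrow> real"
  where "hilbert_kernel \<epsilon> s = (if \<epsilon> < \<bar>s\<bar> then 1 / s else 0)"

definition trunc_hilbert :: "real \<Rightarrow> real \<Rightarrow> real \<Rightarrow> (real \<Rightarrow> 'a::euclidean_space) \<Rightarrow> real \<Rightarrow> 'a"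
  where "trunc_hilbert a b \<epsilon> g x = (\<integral>t. hilbert_kernel \<epsilon> (x - t) *\<^sub>R g t \<partial>lebesgue_on {a<..<b})"

lemma borel_measurable_hilbert_kernel [measurable]: "hilbert_kernel \<epsilon> \<in> borel_measurable borel"
  unfolding hilbert_kernel_def by measurable

lemma abs_hilbert_kernel_le: "0 < \<epsilon> \<Longrightarrow> \<bar>hilbert_kernel \<epsilon> s\<bar> \<le> 1 / \<epsilon>"
  by (auto simp: hilbert_kernel_def intro!: divide_left_mono mult_pos_pos)

lemma hilbert_kernel_minus: "hilbert_kernel \<epsilon> (- s) = - hilbert_kernel \<epsilon> s"
  by (auto simp: hilbert_kernel_def)

lemma ident_borel_measurable_lebesgue_on: "(\<lambda>x::real. x) \<in> borel_measurable (lebesgue_on S)"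
  using id_borel_measurable_lebesgue_on by (simp add: id_def)

lemma integrable_bounded_scaleR:
  fixes g :: "'b \<Rightarrow> 'a::euclidean_space"
  assumes "integrable M g" "k \<in> borel_measurable M" "\<And>t. \<bar>k t\<bar> \<le> C"
  shows "integrable M (\<lambda>t. k t *\<^sub>R g t)"
proof (rule Bochner_Integration.integrable_bound)
  show "integrable M (\<lambda>t. C *\<^sub>R g t)" using assms(1) by simp
  show "(\<lambda>t. k t *\<^sub>R g t) \<in> borel_measurable M" using assms by auto
  have "\<bar>k t\<bar> \<le> \<bar>C\<bar>" for t using assms(3)[of t] by simp
  then show "AE t in M. norm (k t *\<^sub>R g t) \<le> norm (C *\<^sub>R g t)"
    by (auto intro!: mult_right_mono)
qed

lemma integrable_trunc_hilbert:
  fixes g :: "real \<Rightarrow> 'a::euclidean_space"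
  assumes "integrable (lebesgue_on {a<..<b}) g" "0 < \<epsilon>"
  shows "integrable (lebesgue_on {a<..<b}) (\<lambda>t. hilbert_kernel \<epsilon> (x - t) *\<^sub>R g t)"
proof (rule integrable_bounded_scaleR[OF assms(1) _ abs_hilbert_kernel_le[OF assms(2)]])
  note ident_borel_measurable_lebesgue_on[measurable]
  show "(\<lambda>t. hilbert_kernel \<epsilon> (x - t)) \<in> borel_measurable (lebesgue_on {a<..<b})" by measurable
qed

lemma isCont_hilbert_kernel:
  assumes "0 < \<epsilon>" "\<bar>s\<bar> \<noteq> \<epsilon>"
  shows "isCont (hilbert_kernel \<epsilon>) s"
proof (cases "\<epsilon> < \<bar>s\<bar>")
  case True
  have "open {s::real. \<epsilon> < \<bar>s\<bar>}" by (intro open_Collect_less continuous_intros)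
  then have "\<forall>\<^sub>F u in nhds s. u \<in> {s. \<epsilon> < \<bar>s\<bar>}" using True by (intro eventually_nhds_in_open) auto
  then have "\<forall>\<^sub>F u in nhds s. hilbert_kernel \<epsilon> u = 1 / u"
    by eventually_elim (simp add: hilbert_kernel_def)
  moreover have "isCont (\<lambda>u. 1 / u) s" using True assms by (intro continuous_intros) auto
  ultimately show ?thesis by (simp add: isCont_cong)
next
  case False
  have "open {s::real. \<bar>s\<bar> < \<epsilon>}" by (intro open_Collect_less continuous_intros)
  then have "\<forall>\<^sub>F u in nhds s. u \<in> {s. \<bar>s\<bar> < \<epsilon>}" using False assms by (intro eventually_nhds_in_open) auto
  then have "\<forall>\<^sub>F u in nhds s. hilbert_kernel \<epsilon> u = 0"
    by eventually_elim (simp add: hilbert_kernel_def)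
  then show ?thesis by (simp add: isCont_cong)
qed

lemma AE_lebesgue_on_neq: "AE t in lebesgue_on S. t \<noteq> (c::real)" if "S \<in> sets lebesgue"
proof -
  have "AE t in lebesgue. t \<noteq> c"
    by (rule AE_I'[of "{c}"]) (auto simp: null_sets_completionI)
  then show ?thesis using that by (subst AE_restrict_space_iff) auto
qed

text \<open>The weights \<open>p s\<close> are the point masses of the image of the measure with
  density \<open>g\<close> under \<pi>, which has finite range; the identity is the change of
  variables for this image.\<close>

lemma discretized_trunc_hilbert:
  fixes g :: "real \<Rightarrow> real" and \<pi> :: "real \<Rightarrow> real"
  assumes g: "integrable (lebesgue_on {a<..<b}) g"
    and \<pi>: "\<pi> \<in> borel_measurable borel" and fin: "finite (\<pi> ` {a<..<b})"
  defines "p \<equiv> \<lambda>s. \<integral>t. indicator {s} (\<pi> t) * g t \<partial>lebesgue_on {a<..<b}"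
  shows "(\<Sum>s\<in>\<pi> ` {a<..<b}. p s * \<phi> s) = (\<integral>t. \<phi> (\<pi> t) * g t \<partial>lebesgue_on {a<..<b})"
proof -
  have i: "integrable (lebesgue_on {a<..<b}) (\<lambda>t. indicator {s} (\<pi> t) * g t)" for s
  proof -
    have "(\<lambda>t. indicator {s} (\<pi> t)) \<in> borel_measurable (lebesgue_on {a<..<b})"
      by (rule measurable_compose[OF measurable_compose[OF ident_borel_measurable_lebesgue_on \<pi>]]) simp
    from integrable_bounded_scaleR[OF g this, of 1] show ?thesis by (simp add: indicator_def)
  qed
  have "(\<Sum>s\<in>\<pi> ` {a<..<b}. p s * \<phi> s) = (\<Sum>s\<in>\<pi> ` {a<..<b}. \<integral>t. \<phi> s * (indicator {s} (\<pi> t) * g t) \<partial>lebesgue_on {a<..<b})"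
    by (simp add: p_def mult.commute)
  also have "\<dots> = (\<integral>t. (\<Sum>s\<in>\<pi> ` {a<..<b}. \<phi> s * (indicator {s} (\<pi> t) * g t)) \<partial>lebesgue_on {a<..<b})"
    by (rule Bochner_Integration.integral_sum[symmetric]) (use i in auto)
  also have "\<dots> = (\<integral>t. \<phi> (\<pi> t) * g t \<partial>lebesgue_on {a<..<b})"
  proof (rule Bochner_Integration.integral_cong[OF refl])
    fix t assume "t \<in> space (lebesgue_on {a<..<b})"
    then have t: "\<pi> t \<in> \<pi> ` {a<..<b}" by auto
    have "(\<Sum>s\<in>\<pi> ` {a<..<b}. \<phi> s * (indicator {s} (\<pi> t) * g t))
        = (\<Sum>s\<in>\<pi> ` {a<..<b}. if s = \<pi> t then \<phi> (\<pi> t) * g t else 0)"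
      by (rule sum.cong) (auto simp: indicator_def)
    also have "\<dots> = \<phi> (\<pi> t) * g t" using fin t by simp
    finally show "(\<Sum>s\<in>\<pi> ` {a<..<b}. \<phi> s * (indicator {s} (\<pi> t) * g t)) = \<phi> (\<pi> t) * g t" .
  qed
  finally show ?thesis .
qed

text \<open>Discretizing the density turns the estimate for point masses into one for \<open>L\<^sup>1\<close> functions.\<close>

lemma trunc_hilbert_weak_type_nonneg:
  fixes g :: "real \<Rightarrow> real"
  assumes g: "integrable (lebesgue_on {a<..<b}) g" and pos: "\<And>t. 0 \<le> g t" and \<alpha>: "0 < \<alpha>"
  obtains U where "U \<in> lmeasurable"
    "measure lebesgue U \<le> 80 * (\<integral>t. g t \<partial>lebesgue_on {a<..<b}) / \<alpha>"
    "\<And>x \<epsilon>. 0 < \<epsilon> \<Longrightarrow> \<bar>trunc_hilbert a b \<epsilon> g x\<bar> > \<alpha> \<Longrightarrow> x \<in> U"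
proof -
  define \<mu> where "\<mu> = lebesgue_on {a<..<b}"
  \<comment> \<open>Rounding up to the grid of mesh 1 / (n + 1) moves every point by at most the
    mesh.\<close>
  define \<pi> where "\<pi> = (\<lambda>n t. of_int \<lceil>t * real (Suc n)\<rceil> / real (Suc n))"
  define X where "X = (\<lambda>n. \<pi> n ` {a<..<b})"
  define p where "p = (\<lambda>n s. \<integral>t. indicator {s} (\<pi> n t) * g t \<partial>\<mu>)"
  have \<pi>m: "\<pi> n \<in> borel_measurable borel" for n unfolding \<pi>_def by measurable
  have fin: "finite (X n)" for n
  proof -
    have "X n \<subseteq> (\<lambda>i. of_int i / real (Suc n)) ` {\<lceil>a * real (Suc n)\<rceil>..\<lceil>b * real (Suc n)\<rceil>}"
    proof
      fix s assume "s \<in> X n"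
      then obtain t where t: "a < t" "t < b" "s = \<pi> n t" by (auto simp: X_def)
      then have "\<lceil>t * real (Suc n)\<rceil> \<in> {\<lceil>a * real (Suc n)\<rceil>..\<lceil>b * real (Suc n)\<rceil>}"
        by (auto intro!: ceiling_mono mult_right_mono)
      then show "s \<in> (\<lambda>i. of_int i / real (Suc n)) ` {\<lceil>a * real (Suc n)\<rceil>..\<lceil>b * real (Suc n)\<rceil>}"
        unfolding t(3) \<pi>_def by (rule imageI)
    qed
    then show ?thesis by (rule finite_subset) simp
  qed
  have p0: "0 \<le> p n s" for n s
    unfolding p_def by (rule Bochner_Integration.integral_nonneg) (simp add: pos)
  have sum_p: "(\<Sum>s\<in>X n. p n s * \<phi> s) = (\<integral>t. \<phi> (\<pi> n t) * g t \<partial>\<mu>)" for n \<phi>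
    using discretized_trunc_hilbert[OF g \<pi>m, of n \<phi>] fin by (simp add: X_def p_def \<mu>_def)
  define I where "I = (\<integral>t. g t \<partial>\<mu>)"
  have "\<exists>U. U \<in> lmeasurable \<and> measure lebesgue U \<le> 80 * I / \<alpha> \<and>
    (\<forall>x \<epsilon>. 0 < \<epsilon> \<longrightarrow> \<bar>\<integral>t. hilbert_kernel \<epsilon> (x - \<pi> n t) * g t \<partial>\<mu>\<bar> > \<alpha> \<longrightarrow> x \<in> U)" for n
  proof -
    obtain U where U: "U \<in> lmeasurable" "measure lebesgue U \<le> 80 * (\<Sum>s\<in>X n. p n s) / \<alpha>"
      "\<And>x \<epsilon>. 0 < \<epsilon> \<Longrightarrow> \<bar>\<Sum>t\<in>{t\<in>X n. \<epsilon> < \<bar>x - t\<bar>}. p n t / (x - t)\<bar> > \<alpha> \<Longrightarrow> x \<in> U"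
      by (rule discrete_maximal[where X = "X n" and p = "p n", OF fin p0 \<alpha>];
          (assumption | (rule that; assumption)))
    have "(\<Sum>t\<in>{t\<in>X n. \<epsilon> < \<bar>x - t\<bar>}. p n t / (x - t)) = (\<Sum>t\<in>X n. p n t * hilbert_kernel \<epsilon> (x - t))" for x \<epsilon>
      by (rule sum.mono_neutral_cong_left) (use fin in \<open>auto simp: hilbert_kernel_def\<close>)
    then show ?thesis using U sum_p[of n "\<lambda>_. 1"] by (intro exI[of _ U]) (simp add: sum_p I_def)
  qed
  then obtain U where U: "\<And>n. U n \<in> lmeasurable" "\<And>n. measure lebesgue (U n) \<le> 80 * I / \<alpha>"
    "\<And>n x \<epsilon>. 0 < \<epsilon> \<Longrightarrow> \<bar>\<integral>t. hilbert_kernel \<epsilon> (x - \<pi> n t) * g t \<partial>\<mu>\<bar> > \<alpha> \<Longrightarrow> x \<in> U n"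
    by metis
  have lim: "(\<lambda>n. \<integral>t. hilbert_kernel \<epsilon> (x - \<pi> n t) * g t \<partial>\<mu>) \<longlonglongrightarrow> trunc_hilbert a b \<epsilon> g x"
    if \<epsilon>: "0 < \<epsilon>" for x \<epsilon>
    unfolding trunc_hilbert_def \<mu>_def[symmetric] real_scaleR_def
  proof (rule integral_dominated_convergence)
    show "integrable \<mu> (\<lambda>t. 1 / \<epsilon> * \<bar>g t\<bar>)" using g by (simp add: \<mu>_def)
    have [measurable]: "g \<in> borel_measurable \<mu>" "(\<lambda>t. t) \<in> borel_measurable \<mu>" "\<And>n. \<pi> n \<in> borel_measurable \<mu>"
      using borel_measurable_integrable[OF g] ident_borel_measurable_lebesgue_on
        measurable_compose[OF ident_borel_measurable_lebesgue_on \<pi>m] by (auto simp: \<mu>_def)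
    show "(\<lambda>t. hilbert_kernel \<epsilon> (x - t) * g t) \<in> borel_measurable \<mu>"
      "\<And>n. (\<lambda>t. hilbert_kernel \<epsilon> (x - \<pi> n t) * g t) \<in> borel_measurable \<mu>"
      by measurable
    show "\<And>n. AE t in \<mu>. norm (hilbert_kernel \<epsilon> (x - \<pi> n t) * g t) \<le> 1 / \<epsilon> * \<bar>g t\<bar>"
      unfolding real_norm_def abs_mult by (intro AE_I2 mult_right_mono abs_hilbert_kernel_le[OF \<epsilon>]) auto
    \<comment> \<open>These are the only \<open>t\<close> at which the kernel is discontinuous, so
      elsewhere its values at the rounded points converge.\<close>
    have "AE t in \<mu>. t \<noteq> x - \<epsilon> \<and> t \<noteq> x + \<epsilon>"
      unfolding \<mu>_def AE_conj_iff by (intro conjI AE_lebesgue_on_neq) simp_all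
    then show "AE t in \<mu>. (\<lambda>n. hilbert_kernel \<epsilon> (x - \<pi> n t) * g t) \<longlonglongrightarrow> hilbert_kernel \<epsilon> (x - t) * g t"
    proof eventually_elim
      case (elim t)
      have "(\<lambda>n. \<pi> n t - t) \<longlonglongrightarrow> 0"
      proof (rule Lim_null_comparison[OF _ LIMSEQ_inverse_real_of_nat], intro always_eventually allI)
        fix n
        have "\<pi> n t - t = (of_int \<lceil>t * real (Suc n)\<rceil> - t * real (Suc n)) / real (Suc n)"
          by (simp add: \<pi>_def field_simps)
        moreover have "\<bar>of_int \<lceil>t * real (Suc n)\<rceil> - t * real (Suc n)\<bar> \<le> 1" by linarith
        then have "\<bar>of_int \<lceil>t * real (Suc n)\<rceil> - t * real (Suc n)\<bar> / real (Suc n) \<le> 1 / real (Suc n)"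
          by (intro divide_right_mono) auto
        ultimately show "norm (\<pi> n t - t) \<le> inverse (real (Suc n))"
          by (simp only: real_norm_def abs_divide abs_of_nat inverse_eq_divide)
      qed
      then have "(\<lambda>n. x - \<pi> n t) \<longlonglongrightarrow> x - t"
        using tendsto_diff[OF tendsto_const[of "x - t"]] by force
      moreover have "isCont (hilbert_kernel \<epsilon>) (x - t)" using elim by (intro isCont_hilbert_kernel \<epsilon>) auto
      ultimately show ?case by (intro tendsto_mult_right isCont_tendsto_compose[of _ "hilbert_kernel \<epsilon>"])
    qed
  qed
  \<comment> \<open>The exceptional set depends on \<open>n\<close>, so the points that lie in
    \<open>U n\<close> from some index on are collected. The sets \<open>V N\<close> increase and
    \<open>V N\<close> lies in \<open>U n\<close> for n \<ge> N, so the uniform measure bound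
    survives the union.\<close>
  define V where "V = (\<lambda>N. \<Inter>n\<in>{N..}. U n)"
  have V: "V N \<in> lmeasurable" for N
  proof (rule fmeasurableI2[OF U(1)[of N]])
    show "V N \<subseteq> U N" by (auto simp: V_def)
    show "V N \<in> sets lebesgue" unfolding V_def by (intro sets.countable_INT) (use U(1) in auto)
  qed
  have bd: "measure lebesgue (\<Union>i\<le>n. V i) \<le> 80 * I / \<alpha>" for n
  proof -
    have "measure lebesgue (\<Union>i\<le>n. V i) \<le> measure lebesgue (U n)"
      by (rule measure_mono_fmeasurable) (use V U(1) in \<open>auto simp: V_def[of] fmeasurableD\<close>)
    then show ?thesis using U(2)[of n] by simp
  qed
  show thesis
  proof (rule that)
    show "(\<Union>N. V N) \<in> lmeasurable" using fmeasurable_countable_Union[OF V bd] .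
    show "measure lebesgue (\<Union>N. V N) \<le> 80 * (\<integral>t. g t \<partial>lebesgue_on {a<..<b}) / \<alpha>"
      using measure_countable_Union_le[OF V bd] by (simp add: I_def \<mu>_def)
    fix x \<epsilon> :: real assume \<epsilon>: "0 < \<epsilon>" and gt: "\<bar>trunc_hilbert a b \<epsilon> g x\<bar> > \<alpha>"
    have "\<forall>\<^sub>F n in sequentially. \<bar>\<integral>t. hilbert_kernel \<epsilon> (x - \<pi> n t) * g t \<partial>\<mu>\<bar> > \<alpha>"
      using order_tendstoD(1)[OF tendsto_rabs[OF lim[OF \<epsilon>]] gt] .
    then obtain N where "\<And>n. n \<ge> N \<Longrightarrow> \<bar>\<integral>t. hilbert_kernel \<epsilon> (x - \<pi> n t) * g t \<partial>\<mu>\<bar> > \<alpha>"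
      by (auto simp: eventually_sequentially)
    then have "x \<in> V N" using U(3)[OF \<epsilon>] by (auto simp: V_def)
    then show "x \<in> (\<Union>N. V N)" by blast
  qed
qed

lemma trunc_hilbert_linear:
  fixes g :: "real \<Rightarrow> 'a::euclidean_space" and T :: "'a \<Rightarrow> 'b::euclidean_space"
  assumes "bounded_linear T" "integrable (lebesgue_on {a<..<b}) g" "0 < \<epsilon>"
  shows "trunc_hilbert a b \<epsilon> (\<lambda>t. T (g t)) x = T (trunc_hilbert a b \<epsilon> g x)"
proof -
  interpret bounded_linear T by fact
  show ?thesis
    unfolding trunc_hilbert_def
    using integral_bounded_linear[OF assms(1) integrable_trunc_hilbert[OF assms(2,3)]]
    by (simp add: scaleR)
qed

lemma trunc_hilbert_diff:
  fixes g :: "real \<Rightarrow> 'a::euclidean_space"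
  assumes "integrable (lebesgue_on {a<..<b}) g" "integrable (lebesgue_on {a<..<b}) h" "0 < \<epsilon>"
  shows "trunc_hilbert a b \<epsilon> (\<lambda>t. g t - h t) x = trunc_hilbert a b \<epsilon> g x - trunc_hilbert a b \<epsilon> h x"
  unfolding trunc_hilbert_def using assms
  by (simp add: scaleR_diff_right integrable_trunc_hilbert Bochner_Integration.integral_diff)

text \<open>The 2 D positive and negative parts of the coordinates are treated separately, each at
  height \<alpha> / (2 D). Each exceptional set costs 80 * 2 D / \<alpha> times the integral of the
  norm, and there are 2 D of them: 320 D^2 in total.\<close>

lemma trunc_hilbert_weak_type:
  fixes g :: "real \<Rightarrow> 'a::euclidean_space"
  assumes g: "integrable (lebesgue_on {a<..<b}) g" and \<alpha>: "0 < \<alpha>"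
  obtains U where "U \<in> lmeasurable"
    "measure lebesgue U \<le> 320 * real DIM('a) ^ 2 * (\<integral>t. norm (g t) \<partial>lebesgue_on {a<..<b}) / \<alpha>"
    "\<And>x \<epsilon>. 0 < \<epsilon> \<Longrightarrow> norm (trunc_hilbert a b \<epsilon> g x) > \<alpha> \<Longrightarrow> x \<in> U"
proof -
  define \<mu> where "\<mu> = lebesgue_on {a<..<b}"
  define D where "D = real DIM('a)"
  have D: "0 < D" by (simp add: D_def)
  define h where "h = (\<lambda>i t. max 0 (snd i * (g t \<bullet> fst i)))"
  define I where "I = (Basis :: 'a set) \<times> {1, -1::real}"
  have I: "finite I" "card I = 2 * DIM('a)" by (auto simp: I_def card_cartesian_product)
  define G where "G = (\<integral>t. norm (g t) \<partial>\<mu>)"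
  have g\<mu>: "integrable \<mu> g" using g by (simp add: \<mu>_def)
  have hi: "integrable \<mu> (h i)" for i
    unfolding h_def using g\<mu> by (intro Bochner_Integration.integrable_max) auto
  have hle: "h i t \<le> norm (g t)" if "i \<in> I" for i t
    using that Basis_le_norm[of "fst i" "g t"] by (auto simp: h_def I_def)
  have hG: "(\<integral>t. h i t \<partial>\<mu>) \<le> G" if "i \<in> I" for i
    unfolding G_def by (rule integral_mono) (use hi g\<mu> hle[OF that] in auto)
  have \<alpha>': "0 < \<alpha> / (2 * D)" using \<alpha> D by simp
  have "\<exists>U. U \<in> lmeasurable \<and> measure lebesgue U \<le> 80 * (\<integral>t. h i t \<partial>\<mu>) / (\<alpha> / (2 * D)) \<and>
    (\<forall>x \<epsilon>. 0 < \<epsilon> \<longrightarrow> \<bar>trunc_hilbert a b \<epsilon> (h i) x\<bar> > \<alpha> / (2 * D) \<longrightarrow> x \<in> U)" for i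
    by (rule trunc_hilbert_weak_type_nonneg[OF hi[unfolded \<mu>_def] _ \<alpha>', of i])
       (auto simp: h_def \<mu>_def)
  then obtain U where U: "\<And>i. U i \<in> lmeasurable"
    "\<And>i. measure lebesgue (U i) \<le> 80 * (\<integral>t. h i t \<partial>\<mu>) / (\<alpha> / (2 * D))"
    "\<And>i x \<epsilon>. 0 < \<epsilon> \<Longrightarrow> \<bar>trunc_hilbert a b \<epsilon> (h i) x\<bar> > \<alpha> / (2 * D) \<Longrightarrow> x \<in> U i"
    by metis
  show thesis
  proof (rule that)
    show "(\<Union>i\<in>I. U i) \<in> lmeasurable" using I U(1) by (intro fmeasurable.finite_UN) auto
    have "measure lebesgue (\<Union>i\<in>I. U i) \<le> (\<Sum>i\<in>I. measure lebesgue (U i))"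
      by (rule measure_UNION_le) (use I U(1) in auto)
    also have "\<dots> \<le> (\<Sum>i\<in>I. 80 * G / (\<alpha> / (2 * D)))"
    proof (rule sum_mono)
      fix i assume "i \<in> I"
      then show "measure lebesgue (U i) \<le> 80 * G / (\<alpha> / (2 * D))"
        using U(2)[of i] hG[of i] \<alpha>'
        by (meson divide_right_mono less_imp_le mult_left_mono order_trans zero_le_numeral)
    qed
    also have "\<dots> = 320 * real DIM('a) ^ 2 * (\<integral>t. norm (g t) \<partial>lebesgue_on {a<..<b}) / \<alpha>"
      using I by (simp add: D_def G_def \<mu>_def power2_eq_square)
    finally show "measure lebesgue (\<Union>i\<in>I. U i) \<le> \<dots>" .
    fix x \<epsilon> :: real assume \<epsilon>: "0 < \<epsilon>" and gt: "norm (trunc_hilbert a b \<epsilon> g x) > \<alpha>"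
    show "x \<in> (\<Union>i\<in>I. U i)"
    proof (rule ccontr)
      assume "x \<notin> (\<Union>i\<in>I. U i)"
      then have le: "\<bar>trunc_hilbert a b \<epsilon> (h i) x\<bar> \<le> \<alpha> / (2 * D)" if "i \<in> I" for i
        using U(3)[OF \<epsilon>] that by (meson UN_I not_le)
      have "\<bar>trunc_hilbert a b \<epsilon> g x \<bullet> e\<bar> \<le> \<alpha> / D" if e: "e \<in> Basis" for e
      proof -
        have "trunc_hilbert a b \<epsilon> g x \<bullet> e = trunc_hilbert a b \<epsilon> (\<lambda>t. g t \<bullet> e) x"
          by (rule trunc_hilbert_linear[OF bounded_linear_inner_left g \<epsilon>, symmetric])
        also have "(\<lambda>t. g t \<bullet> e) = (\<lambda>t. h (e, 1) t - h (e, -1) t)" by (auto simp: h_def)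
        also have "trunc_hilbert a b \<epsilon> \<dots> x = trunc_hilbert a b \<epsilon> (h (e, 1)) x - trunc_hilbert a b \<epsilon> (h (e, -1)) x"
          by (rule trunc_hilbert_diff) (use hi \<epsilon> in \<open>auto simp: \<mu>_def\<close>)
        finally show ?thesis
          using le[of "(e, 1)"] le[of "(e, -1)"] e by (auto simp: I_def)
      qed
      then have "(\<Sum>e\<in>Basis. \<bar>trunc_hilbert a b \<epsilon> g x \<bullet> e\<bar>) \<le> (\<Sum>e\<in>(Basis::'a set). \<alpha> / D)"
        by (rule sum_mono)
      also have "\<dots> = \<alpha>" by (simp add: D_def)
      finally show False using gt norm_le_l1[of "trunc_hilbert a b \<epsilon> g x"] by simp
    qed
  qed
qed

text \<open>Constants, sums and multiplication by the variable generate the polynomials; two uses of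
  \<open>lim\<close> reach first bounded and then arbitrary measurable functions. The majorant
  \<open>c + norm (f x)\<close> serves both, with c = B + 1 and c = 0, and it inherits integrability
  or square-integrability from \<open>f\<close>. Continuity is handed to \<open>add\<close> and
  \<open>mult\<close> so that those cases have integrable functions.\<close>

lemma measurable_approx_induct [consumes 1, case_names const add mult lim]:
  fixes f :: "real \<Rightarrow> 'a::euclidean_space"
  assumes f: "f \<in> borel_measurable (lebesgue_on {a<..<b})"
    and const: "\<And>v. P (\<lambda>_. v)"
    and add: "\<And>f g. continuous_on UNIV f \<Longrightarrow> continuous_on UNIV g \<Longrightarrow> P f \<Longrightarrow> P g \<Longrightarrow> P (\<lambda>x. f x + g x)"
    and mult: "\<And>f. continuous_on UNIV f \<Longrightarrow> P f \<Longrightarrow> P (\<lambda>x. x *\<^sub>R f x)"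
    and lim: "\<And>f F c. f \<in> borel_measurable (lebesgue_on {a<..<b}) \<Longrightarrow>
        (\<And>n. F n \<in> borel_measurable (lebesgue_on {a<..<b})) \<Longrightarrow> (\<And>n. P (F n)) \<Longrightarrow>
        (AE x in lebesgue_on {a<..<b}. (\<lambda>n. F n x) \<longlonglongrightarrow> f x) \<Longrightarrow>
        (\<And>n. AE x in lebesgue_on {a<..<b}. norm (F n x) \<le> c + norm (f x)) \<Longrightarrow> P f"
  shows "P f"
proof -
  have monom: "P (\<lambda>x. x ^ n *\<^sub>R v)" for n v
  proof (induction n)
    case 0
    then show ?case using const by simp
  next
    case (Suc n)
    have "continuous_on UNIV (\<lambda>x::real. x ^ n *\<^sub>R v)" by (intro continuous_intros)
    from mult[OF this Suc] show ?case by simp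
  qed
  have sum: "P (\<lambda>x. \<Sum>j\<in>J. F j x)"
    if "finite J" "\<And>j. j \<in> J \<Longrightarrow> P (F j)" "\<And>j. j \<in> J \<Longrightarrow> continuous_on UNIV (F j)"
    for F :: "'i \<Rightarrow> real \<Rightarrow> 'a" and J
    using that
  proof (induction J rule: finite_induct)
    case empty
    then show ?case using const[of 0] by simp
  next
    case (insert j J)
    have "P (\<lambda>x. F j x + (\<Sum>j\<in>J. F j x))"
      by (rule add) (use insert in \<open>auto intro!: continuous_on_sum\<close>)
    then show ?case using insert by simp
  qed
  have poly: "P p" if p: "polynomial_function p" for p
  proof -
    have "\<exists>a n. (\<lambda>x. p x \<bullet> e) = (\<lambda>x. \<Sum>i\<le>n. a i * x ^ i)" for e
      using p polynomial_function_inner[OF p, of e] real_polynomial_function_iff_sum real_polynomial_function_eq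
      by (metis (no_types, lifting) ext)
    then obtain c n where c: "\<And>e. (\<lambda>x. p x \<bullet> e) = (\<lambda>x. \<Sum>i\<le>n e. c e i * x ^ i)" by metis
    have "p = (\<lambda>x. \<Sum>e\<in>Basis. (p x \<bullet> e) *\<^sub>R e)" by (simp add: euclidean_representation)
    also have "\<dots> = (\<lambda>x. \<Sum>e\<in>Basis. \<Sum>i\<le>n e. x ^ i *\<^sub>R (c e i *\<^sub>R e))"
    proof
      fix x
      have "p x \<bullet> e = (\<Sum>i\<le>n e. c e i * x ^ i)" for e using fun_cong[OF c] .
      then show "(\<Sum>e\<in>Basis. (p x \<bullet> e) *\<^sub>R e) = (\<Sum>e\<in>Basis. \<Sum>i\<le>n e. x ^ i *\<^sub>R (c e i *\<^sub>R e))"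
        by (simp add: scaleR_sum_left mult.commute)
    qed
    finally show ?thesis
      by (simp only:) (intro sum finite_Basis finite_atMost monom continuous_intros)
  qed
  have bdd: "P f" if f: "f \<in> borel_measurable (lebesgue_on {a<..<b})" and B: "\<And>x. norm (f x) \<le> B" for f B
  proof -
    have B0: "0 \<le> B" using B[of 0] norm_ge_zero order_trans by blast
    have "f measurable_on {a<..<b}" using f by (simp add: measurable_on_iff_borel_measurable)
    then obtain N g where N: "negligible N" and g: "\<And>n. continuous_on UNIV (g n)"
      and gl: "\<And>x. x \<notin> N \<Longrightarrow> (\<lambda>n. g n x) \<longlonglongrightarrow> (if x \<in> {a<..<b} then f x else 0)"
      unfolding measurable_on_def by blast
    \<comment> \<open>Projecting onto the ball bounds the continuous approximants without changing
      their limit, since the values of \<open>f\<close> already lie in the ball.\<close>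
    define C where "C = (cball 0 B :: 'a set)"
    have C: "convex C" "closed C" "C \<noteq> {}" using B0 by (auto simp: C_def)
    define h where "h = (\<lambda>n x. closest_point C (g n x))"
    have hc: "continuous_on UNIV (h n)" for n
      unfolding h_def by (rule continuous_on_compose2[OF continuous_on_closest_point[OF C, of UNIV] g]) simp
    have "\<exists>p. polynomial_function p \<and> (\<forall>x\<in>{a..b}. norm (h n x - p x) < inverse (real (Suc n)))" for n
      by (rule Stone_Weierstrass_polynomial_function) (use continuous_on_subset[OF hc] in auto)
    then obtain p where p: "\<And>n. polynomial_function (p n)"
      "\<And>n x. x \<in> {a..b} \<Longrightarrow> norm (h n x - p n x) < inverse (real (Suc n))" by metis
    show ?thesis
    proof (rule lim[OF f, of p "B + 1"])
      show "p n \<in> borel_measurable (lebesgue_on {a<..<b})" for n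
        by (rule continuous_imp_measurable_on_sets_lebesgue) (use continuous_on_polymonial_function[OF p(1)] in auto)
      show "P (p n)" for n using poly p(1) .
      have "norm (p n x) \<le> B + 1 + norm (f x)" if "x \<in> {a<..<b}" for n x
      proof -
        have "norm (h n x) \<le> B" using closest_point_in_set[OF C(2,3), of "g n x"] by (simp add: h_def C_def)
        moreover have "norm (h n x - p n x) < 1"
        proof -
          have "inverse (real (Suc n)) \<le> 1" by (simp add: inverse_eq_divide)
          then show ?thesis using p(2)[of x n] that by simp
        qed
        ultimately show ?thesis
          using norm_triangle_sub[of "p n x" "h n x"] norm_minus_commute[of "p n x" "h n x"] norm_ge_zero[of "f x"]
          by linarith
      qed
      then show "AE x in lebesgue_on {a<..<b}. norm (p n x) \<le> B + 1 + norm (f x)" for n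
        by (intro AE_I2) auto
      have "AE x in lebesgue. x \<notin> N" using N by (intro AE_not_in) (simp add: negligible_iff_null_sets)
      then have "AE x in lebesgue. x \<in> {a<..<b} \<longrightarrow> (\<lambda>n. p n x) \<longlonglongrightarrow> f x"
      proof eventually_elim
        case (elim x)
        show ?case
        proof
          assume x: "x \<in> {a<..<b}"
          have "(\<lambda>n. h n x) \<longlonglongrightarrow> closest_point C (f x)"
            unfolding h_def
            by (rule continuous_on_tendsto_compose[OF continuous_on_closest_point[OF C, of UNIV]])
               (use gl[OF elim] x in auto)
          moreover have "closest_point C (f x) = f x" using B by (intro closest_point_self) (simp add: C_def)
          ultimately have hl: "(\<lambda>n. h n x) \<longlonglongrightarrow> f x" by simp
          have "(\<lambda>n. h n x - p n x) \<longlonglongrightarrow> 0"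
            by (rule Lim_null_comparison[OF _ LIMSEQ_inverse_real_of_nat])
               (use p(2) x in \<open>auto intro!: always_eventually less_imp_le\<close>)
          from tendsto_diff[OF hl this] show "(\<lambda>n. p n x) \<longlonglongrightarrow> f x" by simp
        qed
      qed
      then show "AE x in lebesgue_on {a<..<b}. (\<lambda>n. p n x) \<longlonglongrightarrow> f x"
        by (subst AE_restrict_space_iff) auto
    qed
  qed
  show ?thesis
  proof (rule lim[OF f, of "\<lambda>n x. if norm (f x) \<le> real n then f x else 0" 0])
    fix n
    note [measurable] = f
    show m: "(\<lambda>x. if norm (f x) \<le> real n then f x else 0) \<in> borel_measurable (lebesgue_on {a<..<b})" by measurable
    show "P (\<lambda>x. if norm (f x) \<le> real n then f x else 0)"
      by (rule bdd[OF m, of "real n"]) auto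
    show "AE x in lebesgue_on {a<..<b}. norm (if norm (f x) \<le> real n then f x else 0) \<le> 0 + norm (f x)" by simp
  next
    have "\<forall>\<^sub>F n in sequentially. (if norm (f x) \<le> real n then f x else 0) = f x" for x
      using eventually_ge_at_top[of "nat \<lceil>norm (f x)\<rceil>"] by eventually_elim (auto simp: nat_le_iff ceiling_le_iff)
    then show "AE x in lebesgue_on {a<..<b}. (\<lambda>n. if norm (f x) \<le> real n then f x else 0) \<longlonglongrightarrow> f x"
      using tendsto_eventually by (intro AE_I2) fast
  qed
qed

lemma strict_mono_eventually_choice:
  fixes Q :: "nat \<Rightarrow> nat \<Rightarrow> bool"
  assumes "\<And>k. eventually (Q k) sequentially"
  obtains r where "strict_mono r" "\<And>n. Q n (r n)"
proof -
  have ex: "\<exists>m>N. Q k m" for k N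
    using eventually_conj[OF eventually_gt_at_top[of N] assms[of k]] eventually_happens by fastforce
  have "\<exists>r. \<forall>n. Q n (r n) \<and> r n < r (Suc n)"
    by (rule dependent_nat_choice) (use ex in auto)
  then show thesis using that by (metis strict_mono_Suc_iff)
qed

text \<open>With integrals below (1/4)^n and heights (1/2)^n, the weak type estimate gives
  exceptional sets of summable measure, and Borel-Cantelli applies. Each exceptional set handles all
  \<epsilon> at once; this uniformity is what later permits exchanging the limits in
  \<open>n\<close> and \<epsilon>.\<close>

lemma trunc_hilbert_AE_uniform_subseq:
  fixes g :: "nat \<Rightarrow> real \<Rightarrow> 'a::euclidean_space"
  assumes g: "\<And>n. integrable (lebesgue_on {a<..<b}) (g n)"
    and lim: "(\<lambda>n. \<integral>t. norm (g n t) \<partial>lebesgue_on {a<..<b}) \<longlonglongrightarrow> 0"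
  obtains r where "strict_mono r"
    "AE x in lebesgue_on {a<..<b}. \<forall>\<eta>>0. \<forall>\<^sub>F n in sequentially. \<forall>\<epsilon>>0. norm (trunc_hilbert a b \<epsilon> (g (r n)) x) \<le> \<eta>"
proof -
  define K where "K = 320 * real DIM('a) ^ 2"
  have small: "\<forall>\<^sub>F n in sequentially. (\<integral>t. norm (g n t) \<partial>lebesgue_on {a<..<b}) < (1/4) ^ k" for k
    by (rule order_tendstoD(2)[OF lim]) simp
  obtain r where r: "strict_mono r"
    "\<And>n. (\<integral>t. norm (g (r n) t) \<partial>lebesgue_on {a<..<b}) < (1/4) ^ n"
    by (rule strict_mono_eventually_choice[where Q = "\<lambda>k n. (\<integral>t. norm (g n t) \<partial>lebesgue_on {a<..<b}) < (1/4) ^ k", OF small];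
        (assumption | (rule that; assumption)))
  have "\<exists>U. U \<in> lmeasurable \<and> measure lebesgue U \<le> K * (1/2) ^ n \<and>
    (\<forall>x \<epsilon>. 0 < \<epsilon> \<longrightarrow> norm (trunc_hilbert a b \<epsilon> (g (r n)) x) > (1/2) ^ n \<longrightarrow> x \<in> U)" for n
  proof -
    obtain U where U: "U \<in> lmeasurable"
      "measure lebesgue U \<le> 320 * real DIM('a) ^ 2 * (\<integral>t. norm (g (r n) t) \<partial>lebesgue_on {a<..<b}) / (1/2) ^ n"
      "\<And>x \<epsilon>. 0 < \<epsilon> \<Longrightarrow> norm (trunc_hilbert a b \<epsilon> (g (r n)) x) > (1/2) ^ n \<Longrightarrow> x \<in> U"
      by (rule trunc_hilbert_weak_type[where g = "g (r n)" and \<alpha> = "(1/2) ^ n", OF g])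
         (simp, (rule that; assumption))
    have "K * (\<integral>t. norm (g (r n) t) \<partial>lebesgue_on {a<..<b}) / (1/2) ^ n \<le> K * (1/4) ^ n / (1/2) ^ n"
      using r(2)[of n] by (intro divide_right_mono mult_left_mono) (auto simp: K_def)
    also have "\<dots> = K * (1/2) ^ n"
      by (simp add: power_divide power_mult_distrib[symmetric] field_simps)
    finally show ?thesis using U by (intro exI[of _ U]) (auto simp: K_def)
  qed
  then obtain U where U: "\<And>n. U n \<in> lmeasurable" "\<And>n. measure lebesgue (U n) \<le> K * (1/2) ^ n"
    "\<And>n x \<epsilon>. 0 < \<epsilon> \<Longrightarrow> norm (trunc_hilbert a b \<epsilon> (g (r n)) x) > (1/2) ^ n \<Longrightarrow> x \<in> U n"
    by metis
  have "AE x in lebesgue. eventually (\<lambda>n. x \<in> space lebesgue - U n) sequentially"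
  proof (rule borel_cantelli_AE1)
    show "U n \<in> sets lebesgue" "emeasure lebesgue (U n) < \<infinity>" for n using U(1)[of n] by (auto simp: fmeasurable_def)
    show "summable (\<lambda>n. measure lebesgue (U n))"
      by (rule summable_comparison_test'[of "\<lambda>n. K * (1/2) ^ n" 0])
         (use U(2) in \<open>auto intro!: summable_mult summable_geometric\<close>)
  qed
  then have "AE x in lebesgue. \<forall>\<eta>>0. \<forall>\<^sub>F n in sequentially. \<forall>\<epsilon>>0. norm (trunc_hilbert a b \<epsilon> (g (r n)) x) \<le> \<eta>"
  proof eventually_elim
    case (elim x)
    show ?case
    proof (intro allI impI)
      fix \<eta> :: real assume "0 < \<eta>"
      have "(\<lambda>n. (1/2::real) ^ n) \<longlonglongrightarrow> 0" by (rule LIMSEQ_realpow_zero) auto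
      from order_tendstoD(2)[OF this \<open>0 < \<eta>\<close>] elim
      show "\<forall>\<^sub>F n in sequentially. \<forall>\<epsilon>>0. norm (trunc_hilbert a b \<epsilon> (g (r n)) x) \<le> \<eta>"
      proof eventually_elim
        case (elim n)
        then show ?case using U(3)[of _ n x] by (meson DiffD2 le_less_trans less_imp_le not_le)
      qed
    qed
  qed
  then have "AE x in lebesgue_on {a<..<b}. \<forall>\<eta>>0. \<forall>\<^sub>F n in sequentially. \<forall>\<epsilon>>0. norm (trunc_hilbert a b \<epsilon> (g (r n)) x) \<le> \<eta>"
    by (subst AE_restrict_space_iff) auto
  with r(1) that show thesis by blast
qed

section \<open>Existence of principal values\<close>

lemma trunc_hilbert_add:
  fixes g :: "real \<Rightarrow> 'a::euclidean_space"
  assumes "integrable (lebesgue_on {a<..<b}) g" "integrable (lebesgue_on {a<..<b}) h" "0 < \<epsilon>"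
  shows "trunc_hilbert a b \<epsilon> (\<lambda>t. g t + h t) x = trunc_hilbert a b \<epsilon> g x + trunc_hilbert a b \<epsilon> h x"
  unfolding trunc_hilbert_def using assms
  by (simp add: scaleR_add_right integrable_trunc_hilbert Bochner_Integration.integral_add)

definition pv_converges :: "real \<Rightarrow> real \<Rightarrow> (real \<Rightarrow> 'a::euclidean_space) \<Rightarrow> real \<Rightarrow> bool"
  where "pv_converges a b g x \<longleftrightarrow> (\<exists>I. ((\<lambda>\<epsilon>. trunc_hilbert a b \<epsilon> g x) \<longlongrightarrow> I) (at_right 0))"

text \<open>A limit along one sequence of truncations: this makes the function total and measurable,
  and it is the principal value wherever \<open>pv_converges\<close> holds.\<close>

definition pv_hilbert :: "real \<Rightarrow> real \<Rightarrow> (real \<Rightarrow> 'a::euclidean_space) \<Rightarrow> real \<Rightarrow> 'a"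
  where "pv_hilbert a b g x = lim (\<lambda>n. trunc_hilbert a b (inverse (real (Suc n))) g x)"

lemma filterlim_inverse_Suc: "filterlim (\<lambda>n. inverse (real (Suc n))) (at_right 0) sequentially"
  unfolding filterlim_at using LIMSEQ_inverse_real_of_nat by auto

lemma pv_hilbert_eqI:
  assumes "((\<lambda>\<epsilon>. trunc_hilbert a b \<epsilon> g x) \<longlongrightarrow> I) (at_right 0)"
  shows "pv_hilbert a b g x = I"
  unfolding pv_hilbert_def by (rule limI) (rule filterlim_compose[OF assms filterlim_inverse_Suc])

lemma pv_convergesD:
  assumes "pv_converges a b g x"
  shows "((\<lambda>\<epsilon>. trunc_hilbert a b \<epsilon> g x) \<longlongrightarrow> pv_hilbert a b g x) (at_right 0)"
  using assms pv_hilbert_eqI unfolding pv_converges_def by metis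

lemma eventually_at_right_0: "eventually (\<lambda>\<epsilon>. 0 < (\<epsilon>::real)) (at_right 0)"
  by (simp add: eventually_at_right_less)

lemma pv_hilbert_add:
  fixes g h :: "real \<Rightarrow> 'a::euclidean_space"
  assumes "integrable (lebesgue_on {a<..<b}) g" "integrable (lebesgue_on {a<..<b}) h"
    "pv_converges a b g x" "pv_converges a b h x"
  shows "((\<lambda>\<epsilon>. trunc_hilbert a b \<epsilon> (\<lambda>t. g t + h t) x) \<longlongrightarrow> pv_hilbert a b g x + pv_hilbert a b h x) (at_right 0)"
  by (rule Lim_transform_eventually[OF tendsto_add[OF pv_convergesD[OF assms(3)] pv_convergesD[OF assms(4)]]],
      rule eventually_mono[OF eventually_at_right_0]) (simp add: trunc_hilbert_add assms)

lemma pv_hilbert_linear: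
  fixes g :: "real \<Rightarrow> 'a::euclidean_space" and T :: "'a \<Rightarrow> 'b::euclidean_space"
  assumes "bounded_linear T" "integrable (lebesgue_on {a<..<b}) g" "pv_converges a b g x"
  shows "((\<lambda>\<epsilon>. trunc_hilbert a b \<epsilon> (\<lambda>t. T (g t)) x) \<longlongrightarrow> T (pv_hilbert a b g x)) (at_right 0)"
  by (rule Lim_transform_eventually[OF bounded_linear.tendsto[OF assms(1) pv_convergesD[OF assms(3)]]],
      rule eventually_mono[OF eventually_at_right_0]) (simp add: trunc_hilbert_linear assms)

text \<open>Since t / (x - t) = x / (x - t) - 1, multiplying the density by the variable costs only
  the integral of \<open>g\<close> outside a shrinking neighbourhood of \<open>x\<close>.\<close>

lemma trunc_hilbert_ident_limit:
  fixes g :: "real \<Rightarrow> 'a::euclidean_space"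
  assumes g: "integrable (lebesgue_on {a<..<b}) g" and I: "((\<lambda>\<epsilon>. trunc_hilbert a b \<epsilon> g x) \<longlongrightarrow> I) (at_right 0)"
  shows "((\<lambda>\<epsilon>. trunc_hilbert a b \<epsilon> (\<lambda>t. t *\<^sub>R g t) x) \<longlongrightarrow>
      x *\<^sub>R I - (\<integral>t. g t \<partial>lebesgue_on {a<..<b})) (at_right 0)"
proof -
  define \<mu> where "\<mu> = lebesgue_on {a<..<b}"
  have [measurable]: "(\<lambda>t. t) \<in> borel_measurable \<mu>"
    using ident_borel_measurable_lebesgue_on by (simp add: \<mu>_def)
  have g\<mu>: "integrable \<mu> g" and [measurable]: "g \<in> borel_measurable \<mu>" using g by (auto simp: \<mu>_def)
  define c where "c = (\<lambda>\<epsilon> t. if \<epsilon> < \<bar>x - t\<bar> then 1 else 0 :: real)"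
  have [measurable]: "c \<epsilon> \<in> borel_measurable \<mu>" for \<epsilon> unfolding c_def by measurable
  have ci: "integrable \<mu> (\<lambda>t. c \<epsilon> t *\<^sub>R g t)" for \<epsilon>
    by (rule integrable_bounded_scaleR[OF g\<mu>, of _ 1]) (auto simp: c_def)
  have clim: "((\<lambda>\<epsilon>. \<integral>t. c \<epsilon> t *\<^sub>R g t \<partial>\<mu>) \<longlongrightarrow> (\<integral>t. g t \<partial>\<mu>)) (at_right 0)"
  proof (rule tendsto_at_right_sequentially[of 0 1])
    fix S :: "nat \<Rightarrow> real" assume S: "S \<longlonglongrightarrow> 0"
    show "(\<lambda>n. \<integral>t. c (S n) t *\<^sub>R g t \<partial>\<mu>) \<longlonglongrightarrow> (\<integral>t. g t \<partial>\<mu>)"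
    proof (rule integral_dominated_convergence[of _ _ _ "\<lambda>t. norm (g t)"])
      have "AE t in \<mu>. t \<noteq> x" unfolding \<mu>_def by (rule AE_lebesgue_on_neq) simp
      then show "AE t in \<mu>. (\<lambda>n. c (S n) t *\<^sub>R g t) \<longlonglongrightarrow> g t"
      proof eventually_elim
        case (elim t)
        have "\<forall>\<^sub>F n in sequentially. S n < \<bar>x - t\<bar>" using order_tendstoD(2)[OF S] elim by simp
        then have "\<forall>\<^sub>F n in sequentially. c (S n) t *\<^sub>R g t = g t" by eventually_elim (simp add: c_def)
        then show ?case by (rule tendsto_eventually)
      qed
    qed (use g\<mu> in \<open>auto simp: c_def\<close>)
  qed simp
  have eq: "trunc_hilbert a b \<epsilon> (\<lambda>t. t *\<^sub>R g t) x = x *\<^sub>R trunc_hilbert a b \<epsilon> g x - (\<integral>t. c \<epsilon> t *\<^sub>R g t \<partial>\<mu>)"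
    if "0 < \<epsilon>" for \<epsilon>
  proof -
    have "trunc_hilbert a b \<epsilon> (\<lambda>t. t *\<^sub>R g t) x = (\<integral>t. x *\<^sub>R (hilbert_kernel \<epsilon> (x - t) *\<^sub>R g t) - c \<epsilon> t *\<^sub>R g t \<partial>\<mu>)"
      unfolding trunc_hilbert_def \<mu>_def[symmetric]
    proof (rule Bochner_Integration.integral_cong[OF refl])
      fix t
      have "hilbert_kernel \<epsilon> (x - t) * t = x * hilbert_kernel \<epsilon> (x - t) - c \<epsilon> t"
        using that by (auto simp: hilbert_kernel_def c_def field_simps)
      then show "hilbert_kernel \<epsilon> (x - t) *\<^sub>R t *\<^sub>R g t = x *\<^sub>R hilbert_kernel \<epsilon> (x - t) *\<^sub>R g t - c \<epsilon> t *\<^sub>R g t"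
        by (simp add: scaleR_diff_left[symmetric])
    qed
    also have "\<dots> = x *\<^sub>R trunc_hilbert a b \<epsilon> g x - (\<integral>t. c \<epsilon> t *\<^sub>R g t \<partial>\<mu>)"
    proof -
      have i: "integrable \<mu> (\<lambda>t. hilbert_kernel \<epsilon> (x - t) *\<^sub>R g t)"
        using integrable_trunc_hilbert[OF g that] by (simp add: \<mu>_def)
      then have i': "integrable \<mu> (\<lambda>t. x *\<^sub>R (hilbert_kernel \<epsilon> (x - t) *\<^sub>R g t))"
        by (intro integrable_scaleR_right) auto
      show ?thesis
        unfolding trunc_hilbert_def \<mu>_def[symmetric] Bochner_Integration.integral_diff[OF i' ci]
        by (simp only: integral_scaleR_right)
    qed
    finally show ?thesis .
  qed
  show ?thesis
    unfolding \<mu>_def[symmetric]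
    by (rule Lim_transform_eventually[OF tendsto_diff[OF tendsto_scaleR[OF tendsto_const I] clim]],
        rule eventually_mono[OF eventually_at_right_0]) (simp add: eq)
qed

text \<open>The contributions ln \<epsilon> from the two sides of the gap cancel, so the value no
  longer depends on \<epsilon> once the gap fits into the interval.\<close>

lemma trunc_hilbert_const:
  fixes v :: "'a::euclidean_space"
  assumes x: "a < x" "x < b" and \<epsilon>: "0 < \<epsilon>" "\<epsilon> < x - a" "\<epsilon> < b - x"
  shows "trunc_hilbert a b \<epsilon> (\<lambda>_. v) x = (ln (x - a) - ln (b - x)) *\<^sub>R v"
proof -
  let ?k = "\<lambda>t. hilbert_kernel \<epsilon> (x - t)"
  have i: "integrable (lebesgue_on {a<..<b}) ?k"
    using integrable_trunc_hilbert[of a b "\<lambda>_. 1::real" \<epsilon> x] \<epsilon>(1)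
    by (simp add: finite_measure.integrable_const finite_measure_lebesgue_on)
  have 1: "(?k has_integral (- ln (x - (x - \<epsilon>)) - (- ln (x - a)))) {a..x - \<epsilon>}"
  proof (rule fundamental_theorem_of_calculus_interior)
    show "continuous_on {a..x - \<epsilon>} (\<lambda>t. - ln (x - t))" using \<epsilon> by (intro continuous_intros) auto
    fix t assume t: "t \<in> {a<..<x - \<epsilon>}"
    then have "((\<lambda>t. - ln (x - t)) has_real_derivative 1 / (x - t)) (at t)"
      using \<epsilon> by (auto intro!: derivative_eq_intros simp: divide_simps)
    moreover have "?k t = 1 / (x - t)" using t \<epsilon> by (auto simp: hilbert_kernel_def)
    ultimately show "((\<lambda>t. - ln (x - t)) has_vector_derivative ?k t) (at t)"
      by (simp add: has_real_derivative_iff_has_vector_derivative)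
  qed (use \<epsilon> in auto)
  have 2: "(?k has_integral 0) {x - \<epsilon>..x + \<epsilon>}"
    by (rule has_integral_is_0) (auto simp: hilbert_kernel_def)
  have 3: "(?k has_integral (- ln (b - x) - (- ln (x + \<epsilon> - x)))) {x + \<epsilon>..b}"
  proof (rule fundamental_theorem_of_calculus_interior)
    show "continuous_on {x + \<epsilon>..b} (\<lambda>t. - ln (t - x))" using \<epsilon> by (intro continuous_intros) auto
    fix t assume t: "t \<in> {x + \<epsilon><..<b}"
    then have "((\<lambda>t. - ln (t - x)) has_real_derivative - (1 / (t - x))) (at t)"
      using \<epsilon> by (auto intro!: derivative_eq_intros simp: divide_simps)
    moreover have "?k t = - (1 / (t - x))" using t \<epsilon> by (auto simp: hilbert_kernel_def divide_simps)
    ultimately show "((\<lambda>t. - ln (t - x)) has_vector_derivative ?k t) (at t)"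
      by (simp add: has_real_derivative_iff_has_vector_derivative)
  qed (use \<epsilon> in auto)
  have le: "a \<le> x - \<epsilon>" "x - \<epsilon> \<le> x + \<epsilon>" "a \<le> x + \<epsilon>" "x + \<epsilon> \<le> b" using \<epsilon> by auto
  have "(?k has_integral (ln (x - a) - ln (b - x))) {a..b}"
    using has_integral_combine[OF le(3,4) has_integral_combine[OF le(1,2) 1 2] 3] by simp
  then have "(?k has_integral (ln (x - a) - ln (b - x))) {a<..<b}" by (simp add: has_integral_Icc_iff_Ioo)
  moreover have "(?k has_integral (integral\<^sup>L (lebesgue_on {a<..<b}) ?k)) {a<..<b}"
    by (rule has_integral_integral_lebesgue_on[OF i]) simp
  ultimately have "integral\<^sup>L (lebesgue_on {a<..<b}) ?k = ln (x - a) - ln (b - x)"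
    by (rule has_integral_unique[symmetric])
  then show ?thesis unfolding trunc_hilbert_def using i by (subst integral_scaleR_left) auto
qed

text \<open>Along the subsequence the truncated transforms of \<open>F (r n)\<close> approach those
  of \<open>f\<close> uniformly in \<epsilon>, off a null set. Hence their principal values form a
  Cauchy sequence and the two limits may be exchanged.\<close>

lemma pv_converges_L1_limit:
  fixes f :: "real \<Rightarrow> 'a::euclidean_space"
  assumes f: "integrable (lebesgue_on {a<..<b}) f" and F: "\<And>n. integrable (lebesgue_on {a<..<b}) (F n)"
    and conv: "\<And>n. AE x in lebesgue_on {a<..<b}. pv_converges a b (F n) x"
    and lim: "(\<lambda>n. \<integral>t. norm (F n t - f t) \<partial>lebesgue_on {a<..<b}) \<longlonglongrightarrow> 0"
  obtains r where "strict_mono r" "AE x in lebesgue_on {a<..<b}. pv_converges a b f x"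
    "AE x in lebesgue_on {a<..<b}. (\<lambda>n. pv_hilbert a b (F (r n)) x) \<longlonglongrightarrow> pv_hilbert a b f x"
proof -
  obtain r where r: "strict_mono r"
    "AE x in lebesgue_on {a<..<b}. \<forall>\<eta>>0. \<forall>\<^sub>F n in sequentially.
       \<forall>\<epsilon>>0. norm (trunc_hilbert a b \<epsilon> (\<lambda>t. F (r n) t - f t) x) \<le> \<eta>"
  proof (rule trunc_hilbert_AE_uniform_subseq[of a b "\<lambda>n t. F n t - f t", OF _ lim])
    show "integrable (lebesgue_on {a<..<b}) (\<lambda>t. F n t - f t)" for n using F f by auto
  qed (rule that)
  have "AE x in lebesgue_on {a<..<b}. \<forall>n. pv_converges a b (F (r n)) x"
    using conv by (simp add: AE_all_countable)
  with r(2) have "AE x in lebesgue_on {a<..<b}. pv_converges a b f x \<and>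
      (\<lambda>n. pv_hilbert a b (F (r n)) x) \<longlonglongrightarrow> pv_hilbert a b f x"
  proof eventually_elim
    case (elim x)
    define h where "h = (\<lambda>n \<epsilon>. trunc_hilbert a b \<epsilon> (F (r n)) x)"
    define l where "l = (\<lambda>n. pv_hilbert a b (F (r n)) x)"
    have hl: "(h n \<longlongrightarrow> l n) (at_right 0)" for n
      using pv_convergesD[of a b "F (r n)" x] elim(2) by (simp add: h_def l_def)
    have unif: "\<forall>\<^sub>F n in sequentially. \<forall>\<epsilon>>0. norm (h n \<epsilon> - trunc_hilbert a b \<epsilon> f x) \<le> \<eta>" if "0 < \<eta>" for \<eta>
      using elim(1)[rule_format, OF that] by (simp add: trunc_hilbert_diff F f h_def)
    have "Cauchy l"
    proof (rule metric_CauchyI)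
      fix e :: real assume e: "0 < e"
      then obtain N where N: "\<And>n \<epsilon>. n \<ge> N \<Longrightarrow> 0 < \<epsilon> \<Longrightarrow> norm (h n \<epsilon> - trunc_hilbert a b \<epsilon> f x) \<le> e / 3"
        using unif[of "e / 3"] by (auto simp: eventually_sequentially)
      have "dist (l m) (l n) < e" if "m \<ge> N" "n \<ge> N" for m n
      proof -
        have "norm (l m - l n) \<le> 2 * e / 3"
        proof (rule tendsto_upperbound)
          show "((\<lambda>\<epsilon>. norm (h m \<epsilon> - h n \<epsilon>)) \<longlongrightarrow> norm (l m - l n)) (at_right 0)"
            by (intro tendsto_intros hl)
          show "\<forall>\<^sub>F \<epsilon> in at_right 0. norm (h m \<epsilon> - h n \<epsilon>) \<le> 2 * e / 3"
            using eventually_at_right_0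
          proof eventually_elim
            case (elim \<epsilon>)
            then show ?case
              using norm_triangle_ineq4[of "h m \<epsilon> - trunc_hilbert a b \<epsilon> f x" "h n \<epsilon> - trunc_hilbert a b \<epsilon> f x"]
                N[OF that(1) elim] N[OF that(2) elim] by simp
          qed
        qed simp
        then show ?thesis using e by (simp add: dist_norm)
      qed
      then show "\<exists>M. \<forall>m\<ge>M. \<forall>n\<ge>M. dist (l m) (l n) < e" by blast
    qed
    then obtain I where I: "l \<longlonglongrightarrow> I" using Cauchy_convergent_iff convergent_def by blast
    have "((\<lambda>\<epsilon>. trunc_hilbert a b \<epsilon> f x) \<longlongrightarrow> I) (at_right 0)"
    proof (rule swap_uniform_limit'[where f = h and g = l and F = sequentially and S = "{0<..}"])
      show "uniform_limit {0<..} h (\<lambda>\<epsilon>. trunc_hilbert a b \<epsilon> f x) sequentially"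
      proof (rule uniform_limitI)
        fix e :: real assume "0 < e"
        then have "0 < e / 2" by simp
        from unif[OF this] show "\<forall>\<^sub>F n in sequentially. \<forall>\<epsilon>\<in>{0<..}. dist (h n \<epsilon>) (trunc_hilbert a b \<epsilon> f x) < e"
          by eventually_elim (use \<open>0 < e\<close> in \<open>force simp: dist_norm\<close>)
      qed
    qed (use hl I eventually_at_right_0 in auto)
    then show ?case using I pv_hilbert_eqI unfolding pv_converges_def l_def by metis
  qed
  with r(1) that show thesis by auto
qed

lemma dominated_L1_limit:
  fixes f :: "real \<Rightarrow> 'a::euclidean_space"
  assumes "integrable (lebesgue_on {a<..<b}) f"
    and [measurable]: "\<And>n. F n \<in> borel_measurable (lebesgue_on {a<..<b})"
    and lim: "AE x in lebesgue_on {a<..<b}. (\<lambda>n. F n x) \<longlonglongrightarrow> f x"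
    and bd: "\<And>n. AE x in lebesgue_on {a<..<b}. norm (F n x) \<le> h x"
    and h: "integrable (lebesgue_on {a<..<b}) h"
  shows "\<And>n. integrable (lebesgue_on {a<..<b}) (F n)"
    "(\<lambda>n. \<integral>t. norm (F n t - f t) \<partial>lebesgue_on {a<..<b}) \<longlonglongrightarrow> 0"
proof -
  show "integrable (lebesgue_on {a<..<b}) (F n)" for n
    by (rule Bochner_Integration.integrable_bound[OF h]) (use bd[of n] in \<open>auto elim!: eventually_mono\<close>)
  have [measurable]: "f \<in> borel_measurable (lebesgue_on {a<..<b})" using assms(1) by auto
  have "(\<lambda>n. \<integral>t. norm (F n t - f t) \<partial>lebesgue_on {a<..<b}) \<longlonglongrightarrow> (\<integral>t. 0 \<partial>lebesgue_on {a<..<b})"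
  proof (rule integral_dominated_convergence[of _ _ _ "\<lambda>t. h t + norm (f t)"])
    show "AE t in lebesgue_on {a<..<b}. (\<lambda>n. norm (F n t - f t)) \<longlonglongrightarrow> 0"
      using lim by eventually_elim (use LIM_zero tendsto_norm_zero in blast)
    show "AE t in lebesgue_on {a<..<b}. norm (norm (F n t - f t)) \<le> h t + norm (f t)" for n
      using bd[of n]
    proof eventually_elim
      case (elim t)
      then show ?case using norm_triangle_ineq4[of "F n t" "f t"] by simp
    qed
  qed (use h assms(1) in auto)
  then show "(\<lambda>n. \<integral>t. norm (F n t - f t) \<partial>lebesgue_on {a<..<b}) \<longlonglongrightarrow> 0" by simp
qed

lemma finite_measure_Ioo: "finite_measure (lebesgue_on {a<..<b::real})"
  by (rule finite_measure_lebesgue_on) simp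

lemma integrable_const_Ioo: "integrable (lebesgue_on {a<..<b::real}) (\<lambda>_. c)"
  by (rule finite_measure.integrable_const[OF finite_measure_Ioo])

lemma integrable_continuous_Ioo:
  fixes f :: "real \<Rightarrow> 'a::euclidean_space"
  assumes "continuous_on UNIV f"
  shows "integrable (lebesgue_on {a<..<b}) f"
proof -
  have "compact (f ` {a..b})" using assms by (intro compact_continuous_image) (auto intro: continuous_on_subset)
  then obtain B where B: "\<And>x. x \<in> {a..b} \<Longrightarrow> norm (f x) \<le> B"
    using compact_imp_bounded bounded_iff by (metis imageI)
  show ?thesis
  proof (rule finite_measure.integrable_const_bound[OF finite_measure_Ioo])
    show "AE x in lebesgue_on {a<..<b}. norm (f x) \<le> B" using B by (intro AE_I2) auto
    show "f \<in> borel_measurable (lebesgue_on {a<..<b})"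
      by (rule continuous_imp_measurable_on_sets_lebesgue) (auto intro: continuous_on_subset[OF assms])
  qed
qed

text \<open>The class of functions with almost everywhere convergent truncations contains the
  constants, is stable under multiplication by the variable, and is closed under convergence in the
  mean by the weak type estimate.\<close>

theorem AE_pv_converges:
  fixes g :: "real \<Rightarrow> 'a::euclidean_space"
  assumes "integrable (lebesgue_on {a<..<b}) g"
  shows "AE x in lebesgue_on {a<..<b}. pv_converges a b g x"
proof -
  have "g \<in> borel_measurable (lebesgue_on {a<..<b})" using assms by auto
  then have "integrable (lebesgue_on {a<..<b}) g \<longrightarrow> (AE x in lebesgue_on {a<..<b}. pv_converges a b g x)"
  proof (induction g rule: measurable_approx_induct)
    case (const v)
    have "pv_converges a b (\<lambda>_. v) x" if x: "x \<in> {a<..<b}" for x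
    proof -
      have "\<forall>\<^sub>F \<epsilon> in at_right 0. \<epsilon> < min (x - a) (b - x)"
        using eventually_at_right_real[of 0 "min (x - a) (b - x)"] x by (auto elim: eventually_mono)
      with eventually_at_right_0
      have "\<forall>\<^sub>F \<epsilon> in at_right 0. trunc_hilbert a b \<epsilon> (\<lambda>_. v) x = (ln (x - a) - ln (b - x)) *\<^sub>R v"
        by eventually_elim (use x in \<open>auto intro!: trunc_hilbert_const\<close>)
      then show ?thesis unfolding pv_converges_def by (blast intro: tendsto_eventually)
    qed
    then show ?case by (auto intro!: AE_I2)
  next
    case (add f g)
    have "integrable (lebesgue_on {a<..<b}) f" "integrable (lebesgue_on {a<..<b}) g"
      using add.hyps by (auto intro!: integrable_continuous_Ioo)
    then have "AE x in lebesgue_on {a<..<b}. pv_converges a b f x" "AE x in lebesgue_on {a<..<b}. pv_converges a b g x"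
      using add.IH by auto
    then have "AE x in lebesgue_on {a<..<b}. pv_converges a b (\<lambda>x. f x + g x) x"
    proof eventually_elim
      case (elim x)
      then show ?case unfolding pv_converges_def[of a b "\<lambda>x. f x + g x"]
        using pv_hilbert_add[OF \<open>integrable _ f\<close> \<open>integrable _ g\<close>] by blast
    qed
    then show ?case by blast
  next
    case (mult f)
    then have i: "integrable (lebesgue_on {a<..<b}) f" by (auto intro!: integrable_continuous_Ioo)
    then have "AE x in lebesgue_on {a<..<b}. pv_converges a b f x" using mult.IH by auto
    then have "AE x in lebesgue_on {a<..<b}. pv_converges a b (\<lambda>x. x *\<^sub>R f x) x"
      by eventually_elim (use trunc_hilbert_ident_limit[OF i] in \<open>unfold pv_converges_def, blast\<close>)
    then show ?case by blast
  next
    case (lim f F c)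
    show ?case
    proof
      assume f: "integrable (lebesgue_on {a<..<b}) f"
      have h: "integrable (lebesgue_on {a<..<b}) (\<lambda>x. c + norm (f x))"
        by (intro Bochner_Integration.integrable_add integrable_norm f integrable_const_Ioo)
      note * = dominated_L1_limit[OF f lim(2-4) h]
      have "AE x in lebesgue_on {a<..<b}. pv_converges a b (F n) x" for n
        using lim(5)[of n] *(1) by blast
      from *(1) this *(2)
      show "AE x in lebesgue_on {a<..<b}. pv_converges a b f x"
        by (rule pv_converges_L1_limit[OF f])
    qed
  qed
  then show ?thesis using assms by blast
qed

section \<open>Antisymmetry of the Hilbert transform on bounded functions\<close>

lemma Fubini_bounded:
  fixes f :: "'a \<Rightarrow> 'b \<Rightarrow> 'c::euclidean_space"
  assumes M: "finite_measure M" and N: "finite_measure N"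
    and f: "case_prod f \<in> borel_measurable (M \<Otimes>\<^sub>M N)" and C: "\<And>x y. x \<in> space M \<Longrightarrow> y \<in> space N \<Longrightarrow> norm (f x y) \<le> C"
  shows "(\<integral>y. (\<integral>x. f x y \<partial>M) \<partial>N) = (\<integral>x. (\<integral>y. f x y \<partial>N) \<partial>M)"
proof -
  interpret M: finite_measure M by fact
  interpret N: finite_measure N by fact
  interpret P: pair_sigma_finite M N ..
  have "finite_measure (M \<Otimes>\<^sub>M N)" by (rule finite_measure_pair_measure[OF N M])
  then have "integrable (M \<Otimes>\<^sub>M N) (case_prod f)"
    by (rule finite_measure.integrable_const_bound[of _ _ C]) (use f C in \<open>auto simp: space_pair_measure\<close>)
  then show ?thesis by (rule P.Fubini_integral)
qed

lemma borel_measurable_convolution: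
  fixes g :: "real \<Rightarrow> 'a::euclidean_space"
  assumes k: "k \<in> borel_measurable borel" and g: "g \<in> borel_measurable (lebesgue_on T)"
  shows "(\<lambda>(x, t). k (x - t) *\<^sub>R g t) \<in> borel_measurable (lebesgue_on S \<Otimes>\<^sub>M lebesgue_on T)"
proof -
  have [measurable]: "(\<lambda>z. fst z) \<in> borel_measurable (lebesgue_on S \<Otimes>\<^sub>M lebesgue_on T)"
    "(\<lambda>z. snd z) \<in> borel_measurable (lebesgue_on S \<Otimes>\<^sub>M lebesgue_on T)"
    using measurable_compose[OF measurable_fst ident_borel_measurable_lebesgue_on]
      measurable_compose[OF measurable_snd ident_borel_measurable_lebesgue_on] by auto
  have [measurable]: "(\<lambda>z. g (snd z)) \<in> borel_measurable (lebesgue_on S \<Otimes>\<^sub>M lebesgue_on T)"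
    by (rule measurable_compose[OF measurable_snd g])
  note [measurable] = k
  show ?thesis unfolding case_prod_beta by measurable
qed

lemma borel_measurable_convolution_integral:
  fixes g :: "real \<Rightarrow> 'a::euclidean_space"
  assumes "k \<in> borel_measurable borel" "g \<in> borel_measurable (lebesgue_on {a<..<b})"
  shows "(\<lambda>x. \<integral>t. k (x - t) *\<^sub>R g t \<partial>lebesgue_on {a<..<b}) \<in> borel_measurable (lebesgue_on S)"
proof -
  interpret finite_measure "lebesgue_on {a<..<b}" by (rule finite_measure_Ioo)
  show ?thesis by (rule borel_measurable_lebesgue_integral[OF borel_measurable_convolution[OF assms]])
qed

lemma borel_measurable_trunc_hilbert:
  fixes g :: "real \<Rightarrow> 'a::euclidean_space"
  assumes "g \<in> borel_measurable (lebesgue_on {a<..<b})"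
  shows "trunc_hilbert a b \<epsilon> g \<in> borel_measurable (lebesgue_on S)"
  using borel_measurable_convolution_integral[OF borel_measurable_hilbert_kernel assms]
  unfolding trunc_hilbert_def[abs_def] .

lemma borel_measurable_pv_hilbert:
  fixes g :: "real \<Rightarrow> 'a::euclidean_space"
  assumes "g \<in> borel_measurable (lebesgue_on {a<..<b})"
  shows "pv_hilbert a b g \<in> borel_measurable (lebesgue_on S)"
  unfolding pv_hilbert_def[abs_def]
  by (rule borel_measurable_lim_metric) (rule borel_measurable_trunc_hilbert[OF assms])

lemma integrable_bounded_Ioo:
  fixes f :: "real \<Rightarrow> 'a::euclidean_space"
  assumes "f \<in> borel_measurable (lebesgue_on {a<..<b})" "\<And>x. x \<in> {a<..<b} \<Longrightarrow> norm (f x) \<le> C"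
  shows "integrable (lebesgue_on {a<..<b}) f"
  by (rule finite_measure.integrable_const_bound[OF finite_measure_Ioo, of _ C]) (use assms in auto)

lemma norm_trunc_hilbert_le:
  fixes u :: "real \<Rightarrow> 'a::euclidean_space"
  assumes "0 < \<epsilon>" "integrable (lebesgue_on {a<..<b}) u"
  shows "norm (trunc_hilbert a b \<epsilon> u x) \<le> (\<integral>t. norm (u t) \<partial>lebesgue_on {a<..<b}) / \<epsilon>"
proof -
  have "norm (trunc_hilbert a b \<epsilon> u x) \<le> (\<integral>t. norm (u t) / \<epsilon> \<partial>lebesgue_on {a<..<b})"
    unfolding trunc_hilbert_def
  proof (rule Bochner_Integration.integral_norm_bound_integral[OF integrable_trunc_hilbert[OF assms(2,1)]])
    show "norm (hilbert_kernel \<epsilon> (x - t) *\<^sub>R u t) \<le> norm (u t) / \<epsilon>" for t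
      using mult_right_mono[OF abs_hilbert_kernel_le[OF assms(1), of "x - t"], of "norm (u t)"] by simp
  qed (use assms(2) in auto)
  then show ?thesis by simp
qed

lemma integrable_trunc_hilbert_bounded:
  fixes u :: "real \<Rightarrow> 'a::euclidean_space"
  assumes "0 < \<epsilon>" "integrable (lebesgue_on {a<..<b}) u"
  shows "integrable (lebesgue_on {a<..<b}) (trunc_hilbert a b \<epsilon> u)"
  by (rule integrable_bounded_Ioo[OF borel_measurable_trunc_hilbert norm_trunc_hilbert_le[OF assms]]) (use assms(2) in auto)

text \<open>The truncated kernel is odd and bounded by 1 / \<epsilon>, so Fubini applies directly to
  bounded functions on the finite interval.\<close>

lemma trunc_hilbert_antisymmetric:
  fixes u v :: "real \<Rightarrow> 'a::euclidean_space"
  assumes \<epsilon>: "0 < \<epsilon>"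
    and u: "u \<in> borel_measurable (lebesgue_on {a<..<b})" "\<And>x. x \<in> {a<..<b} \<Longrightarrow> norm (u x) \<le> U"
    and v: "v \<in> borel_measurable (lebesgue_on {a<..<b})" "\<And>x. x \<in> {a<..<b} \<Longrightarrow> norm (v x) \<le> V"
  shows "(\<integral>x. u x \<bullet> trunc_hilbert a b \<epsilon> v x \<partial>lebesgue_on {a<..<b})
    = - (\<integral>x. v x \<bullet> trunc_hilbert a b \<epsilon> u x \<partial>lebesgue_on {a<..<b})"
proof -
  let ?\<mu> = "lebesgue_on {a<..<b}" and ?k = "hilbert_kernel \<epsilon>"
  have i: "integrable ?\<mu> (\<lambda>t. ?k (x - t) *\<^sub>R z t)" if "integrable ?\<mu> z" for x and z :: "real \<Rightarrow> 'a"
    by (rule integrable_trunc_hilbert[OF that \<epsilon>])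
  note iu = i[OF integrable_bounded_Ioo[OF u]] and iv = i[OF integrable_bounded_Ioo[OF v]]
  have "(\<integral>x. u x \<bullet> trunc_hilbert a b \<epsilon> v x \<partial>?\<mu>) = (\<integral>x. (\<integral>t. u x \<bullet> (?k (x - t) *\<^sub>R v t) \<partial>?\<mu>) \<partial>?\<mu>)"
    unfolding trunc_hilbert_def using iv by (simp add: integral_inner_right del: inner_scaleR_right)
  also have "\<dots> = (\<integral>t. (\<integral>x. u x \<bullet> (?k (x - t) *\<^sub>R v t) \<partial>?\<mu>) \<partial>?\<mu>)"
  proof (rule Fubini_bounded[OF finite_measure_Ioo finite_measure_Ioo, symmetric])
    have [measurable]: "(\<lambda>z. u (fst z)) \<in> borel_measurable (?\<mu> \<Otimes>\<^sub>M ?\<mu>)"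
      by (rule measurable_compose[OF measurable_fst u(1)])
    have [measurable]: "(\<lambda>z. ?k (fst z - snd z) *\<^sub>R v (snd z)) \<in> borel_measurable (?\<mu> \<Otimes>\<^sub>M ?\<mu>)"
      using borel_measurable_convolution[OF borel_measurable_hilbert_kernel v(1)] by (simp add: case_prod_beta)
    show "(\<lambda>(x, t). u x \<bullet> (?k (x - t) *\<^sub>R v t)) \<in> borel_measurable (?\<mu> \<Otimes>\<^sub>M ?\<mu>)"
      unfolding case_prod_beta by measurable
    fix x t assume "x \<in> space ?\<mu>" "t \<in> space ?\<mu>"
    then have xt: "norm (u x) \<le> U" "norm (v t) \<le> V" using u v by auto
    have "norm (u x \<bullet> (?k (x - t) *\<^sub>R v t)) \<le> norm (u x) * (\<bar>?k (x - t)\<bar> * norm (v t))"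
      using Cauchy_Schwarz_ineq2[of "u x" "?k (x - t) *\<^sub>R v t"] by simp
    also have "\<dots> \<le> U * (1 / \<epsilon> * V)"
      using xt abs_hilbert_kernel_le[OF \<epsilon>] \<epsilon> by (intro mult_mono) (auto intro: order_trans[OF norm_ge_zero])
    finally show "norm (u x \<bullet> (?k (x - t) *\<^sub>R v t)) \<le> U * (1 / \<epsilon> * V)" .
  qed
  also have "\<dots> = (\<integral>t. (\<integral>x. - (v t \<bullet> (?k (t - x) *\<^sub>R u x)) \<partial>?\<mu>) \<partial>?\<mu>)"
  proof -
    have "u x \<bullet> (?k (x - t) *\<^sub>R v t) = - (v t \<bullet> (?k (t - x) *\<^sub>R u x))" for x t
      using hilbert_kernel_minus[of \<epsilon> "t - x"] inner_commute[of "u x" "v t"] by simp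
    then show ?thesis by (simp only:)
  qed
  also have "\<dots> = - (\<integral>t. v t \<bullet> trunc_hilbert a b \<epsilon> u t \<partial>?\<mu>)"
    unfolding trunc_hilbert_def using iu by (simp add: integral_inner_right del: inner_scaleR_right)
  finally show ?thesis .
qed

section \<open>Duality, restricted type and uniform integrability of the truncations\<close>

lemma trunc_hilbert_small_set:
  fixes g :: "real \<Rightarrow> 'a::euclidean_space"
  assumes g: "integrable (lebesgue_on {a<..<b}) g" and \<alpha>: "0 < \<alpha>"
  obtains F where "F \<in> sets (lebesgue_on {a<..<b})"
    "measure (lebesgue_on {a<..<b}) F \<le> 320 * real DIM('a) ^ 2 * (\<integral>t. norm (g t) \<partial>lebesgue_on {a<..<b}) / \<alpha>"
    "\<And>x \<epsilon>. 0 < \<epsilon> \<Longrightarrow> x \<in> {a<..<b} - F \<Longrightarrow> norm (trunc_hilbert a b \<epsilon> g x) \<le> \<alpha>"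
proof -
  obtain U where U: "U \<in> lmeasurable"
    "measure lebesgue U \<le> 320 * real DIM('a) ^ 2 * (\<integral>t. norm (g t) \<partial>lebesgue_on {a<..<b}) / \<alpha>"
    "\<And>x \<epsilon>. 0 < \<epsilon> \<Longrightarrow> norm (trunc_hilbert a b \<epsilon> g x) > \<alpha> \<Longrightarrow> x \<in> U"
    by (rule trunc_hilbert_weak_type[where g = g, OF g \<alpha>]; (assumption | (rule that; assumption)))
  have UI: "U \<inter> {a<..<b} \<in> lmeasurable" using U(1) by (intro fmeasurable.Int) auto
  show thesis
  proof (rule that[of "U \<inter> {a<..<b}"])
    show "U \<inter> {a<..<b} \<in> sets (lebesgue_on {a<..<b})" using UI by (auto simp: sets_restrict_space)
    have "measure (lebesgue_on {a<..<b}) (U \<inter> {a<..<b}) \<le> measure lebesgue U"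
      using measure_mono_fmeasurable[OF _ fmeasurableD[OF UI] U(1)] by (simp add: measure_restrict_space)
    then show "measure (lebesgue_on {a<..<b}) (U \<inter> {a<..<b})
        \<le> 320 * real DIM('a) ^ 2 * (\<integral>t. norm (g t) \<partial>lebesgue_on {a<..<b}) / \<alpha>" using U(2) by linarith
    show "norm (trunc_hilbert a b \<epsilon> g x) \<le> \<alpha>" if "0 < \<epsilon>" "x \<in> {a<..<b} - U \<inter> {a<..<b}" for x \<epsilon>
      using U(3)[OF that(1), of x] that(2) by force
  qed
qed

lemma indicator_Ioo:
  assumes "E \<in> sets (lebesgue_on {a<..<b})"
  shows "integrable (lebesgue_on {a<..<b}) (indicator E :: real \<Rightarrow> real)"
    "(\<integral>x. indicator E x \<partial>lebesgue_on {a<..<b}) = measure (lebesgue_on {a<..<b}) E"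
proof -
  interpret finite_measure "lebesgue_on {a<..<b}" by (rule finite_measure_Ioo)
  show "integrable (lebesgue_on {a<..<b}) (indicator E :: real \<Rightarrow> real)"
    using assms by (intro integrable_const_bound[of _ 1]) (auto simp: indicator_def)
  have "E \<inter> {a<..<b} = E" using sets.sets_into_space[OF assms] by auto
  then show "(\<integral>x. indicator E x \<partial>lebesgue_on {a<..<b}) = measure (lebesgue_on {a<..<b}) E" by simp
qed

text \<open>The vector-valued counterpart of an indicator function in restricted type estimates:
  duality produces direction fields on a set, not indicators themselves.\<close>

definition sub_indicator :: "real \<Rightarrow> real \<Rightarrow> real set \<Rightarrow> (real \<Rightarrow> 'a::euclidean_space) \<Rightarrow> bool"
  where "sub_indicator a b G u \<longleftrightarrow> G \<in> sets (lebesgue_on {a<..<b}) \<and> u \<in> borel_measurable (lebesgue_on {a<..<b}) \<and>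
    (\<forall>x. norm (u x) \<le> indicator G x)"

lemma sub_indicatorD:
  assumes "sub_indicator a b G u"
  shows "u \<in> borel_measurable (lebesgue_on {a<..<b})" "norm (u x) \<le> 1" "norm (u x) \<le> indicator G x"
    "integrable (lebesgue_on {a<..<b}) u"
    "(\<integral>x. norm (u x) \<partial>lebesgue_on {a<..<b}) \<le> measure (lebesgue_on {a<..<b}) G"
proof -
  interpret finite_measure "lebesgue_on {a<..<b}" by (rule finite_measure_Ioo)
  show m: "u \<in> borel_measurable (lebesgue_on {a<..<b})" and le: "\<And>x. norm (u x) \<le> indicator G x"
    and "norm (u x) \<le> 1" for x
    using assms by (auto simp: sub_indicator_def intro: order_trans[OF _ indicator_le_1])
  show i: "integrable (lebesgue_on {a<..<b}) u"
    by (rule integrable_bounded_Ioo[OF m, of 1]) (use le in \<open>auto intro: order_trans[OF _ indicator_le_1]\<close>)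
  have "(\<integral>x. norm (u x) \<partial>lebesgue_on {a<..<b}) \<le> (\<integral>x. indicator G x \<partial>lebesgue_on {a<..<b})"
    using assms le i by (intro integral_mono indicator_Ioo(1)) (auto simp: sub_indicator_def)
  also have "\<dots> = measure (lebesgue_on {a<..<b}) G"
    using assms by (intro indicator_Ioo(2)) (simp add: sub_indicator_def)
  finally show "(\<integral>x. norm (u x) \<partial>lebesgue_on {a<..<b}) \<le> measure (lebesgue_on {a<..<b}) G" .
qed

text \<open>Taking for \<open>w\<close> the direction of the transform of \<open>v\<close> on
  \<open>F\<close> turns the integral of the norm into a pairing. Antisymmetry moves the transform
  onto \<open>w\<close>, and the bound on \<open>v\<close> then confines the integral to
  \<open>G\<close>: the two sets exchange their roles.\<close>

lemma trunc_hilbert_duality: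
  fixes v :: "real \<Rightarrow> 'a::euclidean_space"
  assumes \<epsilon>: "0 < \<epsilon>" and F: "F \<in> sets (lebesgue_on {a<..<b})"
    and v: "v \<in> borel_measurable (lebesgue_on {a<..<b})" "\<And>x. norm (v x) \<le> V * indicator G x"
    and G: "G \<in> sets (lebesgue_on {a<..<b})"
  obtains w :: "real \<Rightarrow> 'a" where "sub_indicator a b F w"
    "(\<integral>x. indicator F x * norm (trunc_hilbert a b \<epsilon> v x) \<partial>lebesgue_on {a<..<b})
      \<le> V * (\<integral>x. indicator G x * norm (trunc_hilbert a b \<epsilon> w x) \<partial>lebesgue_on {a<..<b})"
proof -
  let ?\<mu> = "lebesgue_on {a<..<b}" and ?H = "trunc_hilbert a b \<epsilon>"
  define w where "w = (\<lambda>x. indicator F x *\<^sub>R sgn (?H v x))"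
  have V: "norm (v x) \<le> \<bar>V\<bar>" for x using v(2)[of x] by (cases "x \<in> G") auto
  have [measurable]: "?H v \<in> borel_measurable ?\<mu>" by (rule borel_measurable_trunc_hilbert[OF v(1)])
  have "w \<in> borel_measurable ?\<mu>" unfolding w_def sgn_div_norm using F by measurable
  then have w: "sub_indicator a b F w"
    using F by (auto simp: sub_indicator_def w_def norm_sgn indicator_def)
  have "(\<integral>x. indicator F x * norm (?H v x) \<partial>?\<mu>) = (\<integral>x. w x \<bullet> ?H v x \<partial>?\<mu>)"
  proof (rule Bochner_Integration.integral_cong[OF refl])
    have "sgn z \<bullet> z = norm z" for z :: 'a by (cases "z = 0") (simp_all add: sgn_div_norm dot_square_norm power2_eq_square)
    then show "indicator F x * norm (?H v x) = w x \<bullet> ?H v x" for x by (simp add: w_def)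
  qed
  also have "\<dots> = (\<integral>x. - (v x \<bullet> ?H w x) \<partial>?\<mu>)"
    using trunc_hilbert_antisymmetric[OF \<epsilon> sub_indicatorD(1,2)[OF w] v(1) V] by simp
  also have "\<dots> \<le> (\<integral>x. V * (indicator G x * norm (?H w x)) \<partial>?\<mu>)"
  proof (rule integral_mono')
    have [measurable]: "?H w \<in> borel_measurable ?\<mu>" by (rule borel_measurable_trunc_hilbert[OF sub_indicatorD(1)[OF w]])
    have "integrable ?\<mu> (\<lambda>x. indicator G x *\<^sub>R ?H w x)"
      by (rule integrable_bounded_scaleR[OF integrable_trunc_hilbert_bounded[OF \<epsilon> sub_indicatorD(4)[OF w]], of _ 1])
         (use G in \<open>auto simp: indicator_def\<close>)
    from integrable_norm[OF this] show "integrable ?\<mu> (\<lambda>x. V * (indicator G x * norm (?H w x)))"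
      by (intro integrable_mult_right) (simp add: indicator_def)
    fix x
    have "norm (v x) * norm (?H w x) \<le> V * indicator G x * norm (?H w x)" by (rule mult_right_mono[OF v(2)]) simp
    then show "- (v x \<bullet> ?H w x) \<le> V * (indicator G x * norm (?H w x))"
      using Cauchy_Schwarz_ineq2[of "v x" "?H w x"] by (simp add: mult.assoc)
    have "0 \<le> V * indicator G x" using v(2)[of x] norm_ge_zero order_trans by blast
    then show "0 \<le> V * (indicator G x * norm (?H w x))" by (simp add: mult.assoc[symmetric])
  qed
  finally show thesis using that[OF w] by simp
qed

text \<open>\<open>F\<close> is meant to be the exceptional set of the weak type estimate at height
  \<beta>; the pointwise bound handles \<open>E\<close> outside it.\<close>

lemma integral_trunc_hilbert_split:
  fixes u :: "real \<Rightarrow> 'a::euclidean_space"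
  assumes \<epsilon>: "0 < \<epsilon>" and u: "integrable (lebesgue_on {a<..<b}) u"
    and E: "E \<in> sets (lebesgue_on {a<..<b})" and F: "F \<in> sets (lebesgue_on {a<..<b})"
    and le: "\<And>x. x \<in> E - F \<Longrightarrow> norm (trunc_hilbert a b \<epsilon> u x) \<le> \<beta>" and \<beta>: "0 \<le> \<beta>"
  shows "(\<integral>x. indicator E x * norm (trunc_hilbert a b \<epsilon> u x) \<partial>lebesgue_on {a<..<b})
    \<le> \<beta> * measure (lebesgue_on {a<..<b}) E + (\<integral>x. indicator F x * norm (trunc_hilbert a b \<epsilon> u x) \<partial>lebesgue_on {a<..<b})"
proof -
  let ?\<mu> = "lebesgue_on {a<..<b}" and ?H = "trunc_hilbert a b \<epsilon> u"
  interpret finite_measure ?\<mu> by (rule finite_measure_Ioo)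
  have iF: "integrable ?\<mu> (\<lambda>x. indicator F x * norm (?H x))"
    using integrable_bounded_scaleR[OF integrable_norm[OF integrable_trunc_hilbert_bounded[OF \<epsilon> u]], of "indicator F" 1] F
    by (simp add: indicator_def)
  have iE: "integrable ?\<mu> (\<lambda>x. \<beta> * indicator E x)"
    by (intro integrable_mult_right indicator_Ioo(1) E)
  have "(\<integral>x. indicator E x * norm (?H x) \<partial>?\<mu>) \<le> (\<integral>x. \<beta> * indicator E x + indicator F x * norm (?H x) \<partial>?\<mu>)"
    by (rule integral_mono'[OF Bochner_Integration.integrable_add[OF iE iF]]) (use le \<beta> in \<open>auto simp: indicator_def\<close>)
  also have "\<dots> = \<beta> * measure ?\<mu> E + (\<integral>x. indicator F x * norm (?H x) \<partial>?\<mu>)"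
    using Bochner_Integration.integral_add[OF iE iF] indicator_Ioo(2)[OF E] by (simp only: integral_mult_right_zero)
  finally show ?thesis .
qed

text \<open>Iterates the weak type estimate and duality: each round trades a pair of sets of measure \<open>\<delta>\<close> for a pair of
  measure \<open>\<delta> / 4\<close>, and the crude bound \<open>1 / \<epsilon>\<close> of the kernel makes the remainder vanish in the limit.\<close>

lemma trunc_hilbert_restricted_type:
  fixes u :: "real \<Rightarrow> 'a::euclidean_space"
  defines "\<beta> \<equiv> 4 * (320 * real DIM('a) ^ 2)"
  assumes \<epsilon>: "0 < \<epsilon>" and E: "E \<in> sets (lebesgue_on {a<..<b})" "measure (lebesgue_on {a<..<b}) E \<le> \<delta>"
    and u: "sub_indicator a b G u" "measure (lebesgue_on {a<..<b}) G \<le> \<delta>"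
  shows "(\<integral>x. indicator E x * norm (trunc_hilbert a b \<epsilon> u x) \<partial>lebesgue_on {a<..<b}) \<le> 3 * \<beta> * \<delta>"
proof -
  let ?\<mu> = "lebesgue_on {a<..<b}" and ?H = "trunc_hilbert a b \<epsilon> :: (real \<Rightarrow> 'a) \<Rightarrow> real \<Rightarrow> 'a"
  have \<beta>: "0 < \<beta>" by (simp add: \<beta>_def)
  have step: "\<exists>F (w :: real \<Rightarrow> 'a). F \<in> sets ?\<mu> \<and> measure ?\<mu> F \<le> measure ?\<mu> G / 4 \<and> sub_indicator a b F w \<and>
      (\<integral>x. indicator E x * norm (?H u x) \<partial>?\<mu>) \<le> \<beta> * measure ?\<mu> E + (\<integral>x. indicator G x * norm (?H w x) \<partial>?\<mu>)"
    if E: "E \<in> sets ?\<mu>" and u: "sub_indicator a b G u" for E G and u :: "real \<Rightarrow> 'a"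
  proof -
    note D = sub_indicatorD[OF u]
    obtain F where F: "F \<in> sets ?\<mu>" "measure ?\<mu> F \<le> 320 * real DIM('a) ^ 2 * (\<integral>t. norm (u t) \<partial>?\<mu>) / \<beta>"
      "\<And>x \<epsilon>. 0 < \<epsilon> \<Longrightarrow> x \<in> {a<..<b} - F \<Longrightarrow> norm (trunc_hilbert a b \<epsilon> u x) \<le> \<beta>"
      by (rule trunc_hilbert_small_set[OF D(4) \<beta>]; (assumption | (rule that; assumption)))
    \<comment> \<open>The height \<beta> is four times the weak type constant, which produces the
      quarter.\<close>
    have "measure ?\<mu> F \<le> measure ?\<mu> G / 4" using F(2) D(5) by (simp add: \<beta>_def)
    moreover obtain w :: "real \<Rightarrow> 'a" where w: "sub_indicator a b F w"
      "(\<integral>x. indicator F x * norm (?H u x) \<partial>?\<mu>) \<le> 1 * (\<integral>x. indicator G x * norm (?H w x) \<partial>?\<mu>)"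
    proof (rule trunc_hilbert_duality[OF \<epsilon> F(1) D(1)])
      show "norm (u x) \<le> 1 * indicator G x" for x using D(3) by simp
      show "G \<in> sets ?\<mu>" using u by (simp add: sub_indicator_def)
    qed
    moreover have "(\<integral>x. indicator E x * norm (?H u x) \<partial>?\<mu>) \<le> \<beta> * measure ?\<mu> E + (\<integral>x. indicator F x * norm (?H u x) \<partial>?\<mu>)"
      by (rule integral_trunc_hilbert_split[OF \<epsilon> D(4) E F(1)]) (use F(3)[OF \<epsilon>] sets.sets_into_space[OF E] \<beta> in auto)
    ultimately show ?thesis using F(1) by (intro exI[of _ F] exI[of _ w]) auto
  qed
  have iter: "(\<integral>x. indicator E x * norm (?H u x) \<partial>?\<mu>) \<le> 3 * \<beta> * \<delta> + (\<delta> / 4 ^ n)\<^sup>2 / \<epsilon>"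
    if "E \<in> sets ?\<mu>" "measure ?\<mu> E \<le> \<delta>" "sub_indicator a b G u" "measure ?\<mu> G \<le> \<delta>"
      for n E \<delta> G and u :: "real \<Rightarrow> 'a"
    using that
  proof (induction n arbitrary: E \<delta> G u)
    case 0
    note D = sub_indicatorD[OF 0(3)]
    have \<delta>: "0 \<le> \<delta>" using 0(2) measure_nonneg order_trans by blast
    have "norm (?H u x) \<le> \<delta> / \<epsilon>" for x
      using norm_trunc_hilbert_le[OF \<epsilon> D(4), of x] divide_right_mono[OF order_trans[OF D(5) 0(4)], of \<epsilon>] \<epsilon> by linarith
    then have "(\<integral>x. indicator E x * norm (?H u x) \<partial>?\<mu>) \<le> \<delta> / \<epsilon> * measure ?\<mu> E + (\<integral>x. indicator {} x * norm (?H u x) \<partial>?\<mu>)"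
      by (intro integral_trunc_hilbert_split[OF \<epsilon> D(4) 0(1)]) (use \<delta> \<epsilon> in auto)
    also have "\<dots> \<le> \<delta> / \<epsilon> * \<delta>" using mult_left_mono[OF 0(2), of "\<delta> / \<epsilon>"] \<delta> \<epsilon> by simp
    also have "\<dots> \<le> 3 * \<beta> * \<delta> + (\<delta> / 4 ^ 0)\<^sup>2 / \<epsilon>" using \<beta> \<delta> by (simp add: power2_eq_square)
    finally show ?case .
  next
    case (Suc n)
    obtain F w where F: "F \<in> sets ?\<mu>" "measure ?\<mu> F \<le> measure ?\<mu> G / 4" "sub_indicator a b F w"
      "(\<integral>x. indicator E x * norm (?H u x) \<partial>?\<mu>) \<le> \<beta> * measure ?\<mu> E + (\<integral>x. indicator G x * norm (?H w x) \<partial>?\<mu>)"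
      using step[OF Suc.prems(1,3)] by blast
    have G: "G \<in> sets ?\<mu>" using Suc.prems(3) by (simp add: sub_indicator_def)
    \<comment> \<open>A single step leads from the pair \<open>E\<close>, \<open>G\<close> to the
      pair \<open>G\<close>, \<open>F\<close> and shrinks only one set. After the second step both
      sets, \<open>F\<close> and \<open>F'\<close>, have measure at most \<delta> / 4.\<close>
    obtain F' w' where F': "measure ?\<mu> F' \<le> measure ?\<mu> F / 4" "sub_indicator a b F' w'"
      "(\<integral>x. indicator G x * norm (?H w x) \<partial>?\<mu>) \<le> \<beta> * measure ?\<mu> G + (\<integral>x. indicator F x * norm (?H w' x) \<partial>?\<mu>)"
      using step[OF G F(3)] by blast
    have "(\<integral>x. indicator F x * norm (?H w' x) \<partial>?\<mu>) \<le> 3 * \<beta> * (\<delta> / 4) + (\<delta> / 4 / 4 ^ n)\<^sup>2 / \<epsilon>"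
      by (rule Suc.IH[OF F(1) _ F'(2)]) (use F(2) F'(1) Suc.prems(4) measure_nonneg[of ?\<mu> F] in linarith)+
    \<comment> \<open>The two steps cost at most 2 \<beta> \<delta>; with 3 \<beta> \<delta> / 4
      from the induction hypothesis the sum stays below 3 \<beta> \<delta>.\<close>
    moreover have "\<beta> * measure ?\<mu> E \<le> \<beta> * \<delta>" "\<beta> * measure ?\<mu> G \<le> \<beta> * \<delta>"
      using Suc.prems(2,4) \<beta> by auto
    moreover have "0 \<le> \<beta> * \<delta>" using \<beta> order_trans[OF measure_nonneg Suc.prems(2)] by simp
    ultimately show ?case using F(4) F'(3) by simp
  qed
  have "(\<lambda>n. 3 * \<beta> * \<delta> + (\<delta> / 4 ^ n)\<^sup>2 / \<epsilon>) \<longlonglongrightarrow> 3 * \<beta> * \<delta> + 0\<^sup>2 / \<epsilon>"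
    using tendsto_mult[OF tendsto_const[of \<delta>] LIMSEQ_realpow_zero[of "1/4 :: real"]] \<epsilon>
    by (intro tendsto_intros) (auto simp: power_divide)
  then show ?thesis
    by (intro LIMSEQ_le_const[where a = "\<integral>x. indicator E x * norm (?H u x) \<partial>?\<mu>"]) (use iter[OF E u] in auto)
qed

text \<open>Duality moves the transform from \<open>v\<close> to a function \<open>w\<close>
  supported in \<open>E\<close>, whose norm has integral at most \<delta>. The height sqrt \<delta>
  balances the two parts: off \<open>F\<close> the integral is at most (b - a) sqrt \<delta>, and
  \<open>F\<close> has measure at most c sqrt \<delta>, where the restricted type estimate takes
  over. The constant \<open>K\<close> is the same for all \<epsilon>.\<close>

lemma trunc_hilbert_uniformly_integrable:
  fixes v :: "real \<Rightarrow> 'a::euclidean_space"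
  assumes v: "v \<in> borel_measurable (lebesgue_on {a<..<b})" "\<And>x. x \<in> {a<..<b} \<Longrightarrow> norm (v x) \<le> V" and ab: "a < b"
  obtains K where "\<And>\<epsilon> \<delta> E. 0 < \<epsilon> \<Longrightarrow> 0 < \<delta> \<Longrightarrow> E \<in> sets (lebesgue_on {a<..<b}) \<Longrightarrow> measure (lebesgue_on {a<..<b}) E \<le> \<delta>
    \<Longrightarrow> \<delta> \<le> b - a \<Longrightarrow> (\<integral>x. indicator E x * norm (trunc_hilbert a b \<epsilon> v x) \<partial>lebesgue_on {a<..<b}) \<le> K * sqrt \<delta>"
proof -
  let ?\<mu> = "lebesgue_on {a<..<b}"
  define c where "c = 320 * real DIM('a) ^ 2"
  define K where "K = V * ((b - a) + 12 * c * (sqrt (b - a) + c))"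
  \<comment> \<open>Duality asks for a bound at every real number, whereas \<open>v\<close> is
    bounded on the interval.\<close>
  define v' where "v' = (\<lambda>x. indicator {a<..<b} x *\<^sub>R v x)"
  have V: "0 \<le> V" by (rule order_trans[OF norm_ge_zero v(2)[of "(a + b) / 2"]]) (use ab in auto)
  have v': "v' \<in> borel_measurable ?\<mu>" "\<And>x. norm (v' x) \<le> V * indicator {a<..<b} x"
  proof -
    show "v' \<in> borel_measurable ?\<mu>" by (rule measurable_cong[THEN iffD1, OF _ v(1)]) (simp add: v'_def)
    show "norm (v' x) \<le> V * indicator {a<..<b} x" for x using v(2)[of x] by (simp add: v'_def indicator_def)
  qed
  have H: "trunc_hilbert a b \<epsilon> v = trunc_hilbert a b \<epsilon> v'" for \<epsilon>
    unfolding trunc_hilbert_def v'_def by (intro ext Bochner_Integration.integral_cong) auto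
  have c: "0 \<le> c" by (simp add: c_def)
  have "(\<integral>x. indicator E x * norm (trunc_hilbert a b \<epsilon> v x) \<partial>?\<mu>) \<le> K * sqrt \<delta>"
    if \<epsilon>: "0 < \<epsilon>" and \<delta>: "0 < \<delta>" and E: "E \<in> sets ?\<mu>" "measure ?\<mu> E \<le> \<delta>" and \<delta>b: "\<delta> \<le> b - a" for \<epsilon> \<delta> E
  proof -
    let ?H = "trunc_hilbert a b \<epsilon> :: (real \<Rightarrow> 'a) \<Rightarrow> real \<Rightarrow> 'a"
    obtain w :: "real \<Rightarrow> 'a" where w: "sub_indicator a b E w"
      "(\<integral>x. indicator E x * norm (?H v' x) \<partial>?\<mu>) \<le> V * (\<integral>x. indicator {a<..<b} x * norm (?H w x) \<partial>?\<mu>)"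
      by (rule trunc_hilbert_duality[OF \<epsilon> E(1) v']) (auto intro: that)
    note D = sub_indicatorD[OF w(1)]
    have s: "0 < sqrt \<delta>" using \<delta> by simp
    obtain F where F: "F \<in> sets ?\<mu>" "measure ?\<mu> F \<le> 320 * real DIM('a) ^ 2 * (\<integral>t. norm (w t) \<partial>?\<mu>) / sqrt \<delta>"
      "\<And>x \<epsilon>. 0 < \<epsilon> \<Longrightarrow> x \<in> {a<..<b} - F \<Longrightarrow> norm (trunc_hilbert a b \<epsilon> w x) \<le> sqrt \<delta>"
      by (rule trunc_hilbert_small_set[OF D(4) s]; (assumption | (rule that; assumption)))
    have \<delta>s: "\<delta> = sqrt \<delta> * sqrt \<delta>" using \<delta> by simp
    have "measure ?\<mu> F \<le> c * \<delta> / sqrt \<delta>"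
      using F(2) divide_right_mono[OF mult_left_mono[OF order_trans[OF D(5) E(2)] c], of "sqrt \<delta>"] s by (simp add: c_def)
    also have "\<dots> = c * sqrt \<delta>"
      using real_div_sqrt[of \<delta>] \<delta> by (simp del: times_divide_eq_right add: times_divide_eq_right[symmetric])
    finally have mF: "measure ?\<mu> F \<le> c * sqrt \<delta>" .
    have "\<delta> \<le> sqrt (b - a) * sqrt \<delta>"
      using mult_right_mono[OF real_sqrt_le_mono[OF \<delta>b], of "sqrt \<delta>"] s \<delta>s by linarith
    \<comment> \<open>The restricted type estimate takes one bound for the measures of both sets. So
      the bound \<delta> for \<open>E\<close> is also written as a multiple of sqrt \<delta>, which
      is where \<delta> \<le> b - a comes in.\<close>
    then have d: "\<delta> \<le> (sqrt (b - a) + c) * sqrt \<delta>" "c * sqrt \<delta> \<le> (sqrt (b - a) + c) * sqrt \<delta>"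
      unfolding distrib_right using mult_nonneg_nonneg[OF c less_imp_le[OF s]] \<delta> by linarith+
    have "(\<integral>x. indicator {a<..<b} x * norm (?H w x) \<partial>?\<mu>)
        \<le> sqrt \<delta> * measure ?\<mu> {a<..<b} + (\<integral>x. indicator F x * norm (?H w x) \<partial>?\<mu>)"
      by (rule integral_trunc_hilbert_split[OF \<epsilon> D(4) _ F(1) F(3)[OF \<epsilon>]]) (use s in auto)
    also have "(\<integral>x. indicator F x * norm (?H w x) \<partial>?\<mu>) \<le> 3 * (4 * c) * ((sqrt (b - a) + c) * sqrt \<delta>)"
      unfolding c_def
      by (rule trunc_hilbert_restricted_type[OF \<epsilon> F(1) _ w(1)]) (use mF E(2) d in \<open>auto simp: c_def\<close>)
    finally have "(\<integral>x. indicator {a<..<b} x * norm (?H w x) \<partial>?\<mu>) \<le> ((b - a) + 12 * c * (sqrt (b - a) + c)) * sqrt \<delta>"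
      using ab by (simp add: measure_restrict_space algebra_simps)
    from order_trans[OF w(2) mult_left_mono[OF this V]] show ?thesis unfolding H K_def by (simp add: mult.assoc)
  qed
  then show thesis by (rule that)
qed

section \<open>Convergence theorems and the passage from truncations to principal values\<close>

lemma Fatou_real:
  fixes h :: "nat \<Rightarrow> 'b \<Rightarrow> real"
  assumes [measurable]: "h' \<in> borel_measurable M" and lim: "AE x in M. (\<lambda>n. h n x) \<longlonglongrightarrow> h' x"
    and i: "\<And>n. integrable M (h n)" and pos: "\<And>n x. 0 \<le> h n x" "\<And>x. 0 \<le> h' x" and C: "\<And>n. (\<integral>x. h n x \<partial>M) \<le> C"
  shows "integrable M h'" "(\<integral>x. h' x \<partial>M) \<le> C"
proof -
  have [measurable]: "h n \<in> borel_measurable M" for n using i[of n] by auto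
  have C0: "0 \<le> C" by (rule order_trans[OF Bochner_Integration.integral_nonneg C[of 0]]) (rule pos)
  have "(\<integral>\<^sup>+x. ennreal (h' x) \<partial>M) = (\<integral>\<^sup>+x. liminf (\<lambda>n. ennreal (h n x)) \<partial>M)"
  proof (rule nn_integral_cong_AE)
    show "AE x in M. ennreal (h' x) = liminf (\<lambda>n. ennreal (h n x))"
      using lim by eventually_elim (auto intro!: lim_imp_Liminf[symmetric] tendsto_ennrealI)
  qed
  also have "\<dots> \<le> liminf (\<lambda>n. \<integral>\<^sup>+x. ennreal (h n x) \<partial>M)" by (rule nn_integral_liminf) simp
  also have "\<dots> \<le> ennreal C"
  proof (rule Liminf_le)
    show "\<forall>\<^sub>F n in sequentially. (\<integral>\<^sup>+x. ennreal (h n x) \<partial>M) \<le> ennreal C"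
      using C pos by (intro always_eventually allI) (simp add: nn_integral_eq_integral[OF i] ennreal_leI)
  qed simp
  finally have le: "(\<integral>\<^sup>+x. ennreal (h' x) \<partial>M) \<le> ennreal C" .
  show int: "integrable M h'"
    by (rule integrableI_bounded) (use le pos in \<open>auto intro: le_less_trans\<close>)
  show "(\<integral>x. h' x \<partial>M) \<le> C"
    using le C0 pos by (simp add: nn_integral_eq_integral[OF int])
qed

text \<open>The modulus K sqrt \<delta> is uniform in \<open>n\<close>, so Fatou's lemma hands it on
  to \<open>W\<close>; applied to the whole space with \<delta> = m it yields integrability. The
  difference is at most \<eta> off \<open>E n\<close>, and on \<open>E n\<close>, whose measure
  tends to 0, both functions have small integrals.\<close>

lemma Vitali_convergence:
  fixes w :: "nat \<Rightarrow> 'b \<Rightarrow> 'a::euclidean_space"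
  assumes M: "finite_measure M" and w: "\<And>n. integrable M (w n)" and W[measurable]: "W \<in> borel_measurable M"
    and lim: "AE x in M. (\<lambda>n. w n x) \<longlonglongrightarrow> W x" and m: "0 < m" "measure M (space M) \<le> m"
    and ui: "\<And>n \<delta> E. 0 < \<delta> \<Longrightarrow> E \<in> sets M \<Longrightarrow> measure M E \<le> \<delta> \<Longrightarrow> \<delta> \<le> m \<Longrightarrow> (\<integral>x. indicator E x * norm (w n x) \<partial>M) \<le> K * sqrt \<delta>"
  shows "integrable M W" "(\<lambda>n. \<integral>x. norm (w n x - W x) \<partial>M) \<longlonglongrightarrow> 0"
proof -
  interpret finite_measure M by fact
  have [measurable]: "w n \<in> borel_measurable M" for n using w[of n] by auto
  have iw: "integrable M (\<lambda>x. indicator E x * norm (z x))" if "integrable M z" "E \<in> sets M" for E and z :: "'b \<Rightarrow> 'a"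
    using integrable_bounded_scaleR[OF integrable_norm[OF that(1)], of "indicator E" 1] that(2) by (simp add: indicator_def)
  have FatouE: "integrable M (\<lambda>x. indicator E x * norm (W x))" "(\<integral>x. indicator E x * norm (W x) \<partial>M) \<le> K * sqrt \<delta>"
    if E: "0 < \<delta>" "E \<in> sets M" "measure M E \<le> \<delta>" "\<delta> \<le> m" for \<delta> E
  proof -
    have [measurable]: "E \<in> sets M" by fact
    have l: "AE x in M. (\<lambda>n. indicator E x * norm (w n x)) \<longlonglongrightarrow> indicator E x * norm (W x)"
      using lim by eventually_elim (intro tendsto_intros)
    show "integrable M (\<lambda>x. indicator E x * norm (W x))" "(\<integral>x. indicator E x * norm (W x) \<partial>M) \<le> K * sqrt \<delta>"
      by (rule Fatou_real[OF _ l iw[OF w E(2)] _ _ ui[OF E]]; simp)+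
  qed
  have "integrable M (\<lambda>x. norm (W x))"
    by (rule Bochner_Integration.integrable_cong[THEN iffD1, OF refl _ FatouE(1)[OF m(1) sets.top m(2) order_refl]]) auto
  then show iW: "integrable M W" by (simp add: integrable_norm_iff)
  show "(\<lambda>n. \<integral>x. norm (w n x - W x) \<partial>M) \<longlonglongrightarrow> 0"
  proof (rule LIMSEQ_I)
    fix r :: real assume r: "0 < r"
    \<comment> \<open>The part off \<open>E n\<close> contributes less than r / 2, and each of the
      two integrals over \<open>E n\<close> at most r / 8. The denominators m + 1 and
      \<open>\<bar>K\<bar> + 1\<close> give a strict inequality and a positive denominator for every
      real \<open>K\<close>.\<close>
    define \<eta> where "\<eta> = r / (2 * (m + 1))"
    define \<delta> where "\<delta> = min m ((r / (8 * (\<bar>K\<bar> + 1)))\<^sup>2)"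
    have \<eta>: "0 < \<eta>" "\<eta> * m < r / 2" and \<delta>: "0 < \<delta>" "\<delta> \<le> m" using r m by (auto simp: \<eta>_def \<delta>_def field_simps)
    have "sqrt \<delta> \<le> r / (8 * (\<bar>K\<bar> + 1))"
      using real_sqrt_le_mono[of \<delta> "(r / (8 * (\<bar>K\<bar> + 1)))\<^sup>2"] r by (simp add: \<delta>_def)
    then have "\<bar>K\<bar> * sqrt \<delta> \<le> (\<bar>K\<bar> + 1) * (r / (8 * (\<bar>K\<bar> + 1)))" using \<delta> by (intro mult_mono) auto
    also have "\<dots> = r / 8"
    proof -
      have "k * (r / (8 * k)) = r / 8" if "0 < k" for k using that by (simp add: field_simps)
      then show ?thesis by (simp only: add_nonneg_pos abs_ge_zero zero_less_one)
    qed
    finally have K: "K * sqrt \<delta> \<le> r / 8"      using mult_right_mono[OF abs_ge_self[of K] real_sqrt_ge_zero[OF less_imp_le[OF \<delta>(1)]]] by linarith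
    define E where "E = (\<lambda>n. {x \<in> space M. \<eta> < norm (w n x - W x)})"
    have [measurable]: "E n \<in> sets M" for n unfolding E_def by measurable
    have "(\<lambda>n. \<integral>x. indicator (E n) x \<partial>M) \<longlonglongrightarrow> (\<integral>x. 0 \<partial>M :: real)"
    proof (rule integral_dominated_convergence[of _ _ _ "\<lambda>_. 1"])
      show "AE x in M. (\<lambda>n. indicator (E n) x :: real) \<longlonglongrightarrow> 0"
        using lim
      proof eventually_elim
        case (elim x)
        then have "(\<lambda>n. norm (w n x - W x)) \<longlonglongrightarrow> 0" using LIM_zero tendsto_norm_zero by blast
        from order_tendstoD(2)[OF this \<eta>(1)] have "\<forall>\<^sub>F n in sequentially. indicator (E n) x = (0 :: real)"
          by eventually_elim (simp add: E_def)
        then show ?case by (rule tendsto_eventually)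
      qed
    qed (auto simp: indicator_def)
    moreover have "E n \<inter> space M = E n" for n by (auto simp: E_def)
    ultimately have "(\<lambda>n. measure M (E n)) \<longlonglongrightarrow> 0" by simp
    from order_tendstoD(2)[OF this \<delta>(1)]
    have "\<forall>\<^sub>F n in sequentially. norm ((\<integral>x. norm (w n x - W x) \<partial>M) - 0) < r"
    proof eventually_elim
      case (elim n)
      note E = \<delta>(1) \<open>E n \<in> sets M\<close> less_imp_le[OF elim] \<delta>(2)
      have i: "integrable M (\<lambda>x. \<eta> + (indicator (E n) x * norm (w n x) + indicator (E n) x * norm (W x)))"
        using iw[OF w E(2)] FatouE(1)[OF E] by auto
      have "(\<integral>x. norm (w n x - W x) \<partial>M) \<le> (\<integral>x. \<eta> + (indicator (E n) x * norm (w n x) + indicator (E n) x * norm (W x)) \<partial>M)"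
      proof (rule integral_mono'[OF i])
        fix x assume "x \<in> space M"
        then show "norm (w n x - W x) \<le> \<eta> + (indicator (E n) x * norm (w n x) + indicator (E n) x * norm (W x))"
          using \<eta>(1) norm_triangle_ineq4[of "w n x" "W x"] by (auto simp: E_def indicator_def)
        show "0 \<le> \<eta> + (indicator (E n) x * norm (w n x) + indicator (E n) x * norm (W x))"
          using \<eta>(1) by simp
      qed
      also have "\<dots> = \<eta> * measure M (space M) + ((\<integral>x. indicator (E n) x * norm (w n x) \<partial>M) + (\<integral>x. indicator (E n) x * norm (W x) \<partial>M))"
        using iw[OF w E(2)] FatouE(1)[OF E] by simp
      also have "\<dots> \<le> \<eta> * m + (r / 8 + r / 8)"
        using ui[OF E, of n] FatouE(2)[OF E] K mult_left_mono[OF m(2), of \<eta>] \<eta>(1) by linarith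
      also have "\<dots> < r" using \<eta>(2) r by simp
      finally have "(\<integral>x. norm (w n x - W x) \<partial>M) < r" .
      moreover have "0 \<le> (\<integral>x. norm (w n x - W x) \<partial>M)" by (rule Bochner_Integration.integral_nonneg) simp
      ultimately show ?case by simp
    qed
    then show "\<exists>no. \<forall>n\<ge>no. norm ((\<integral>x. norm (w n x - W x) \<partial>M) - 0) < r" by (simp add: eventually_sequentially)
  qed
qed

lemma integrable_of_L2:
  fixes W :: "real \<Rightarrow> 'a::euclidean_space"
  assumes "W \<in> borel_measurable (lebesgue_on {a<..<b})" "integrable (lebesgue_on {a<..<b}) (\<lambda>x. (norm (W x))\<^sup>2)"
  shows "integrable (lebesgue_on {a<..<b}) W"
proof (rule Bochner_Integration.integrable_bound)
  show "integrable (lebesgue_on {a<..<b}) (\<lambda>x. 1 + (norm (W x))\<^sup>2)"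
    by (intro Bochner_Integration.integrable_add integrable_const_Ioo assms(2))
  have "norm (W x) \<le> 1 + (norm (W x))\<^sup>2" for x
    using sum_squares_bound[of 1 "norm (W x)"] norm_ge_zero[of "W x"] by (simp only: power_one mult_1_right)
  then show "AE x in lebesgue_on {a<..<b}. norm (W x) \<le> norm (1 + (norm (W x))\<^sup>2)"
    by (intro AE_I2) (auto intro: order_trans[OF _ abs_ge_self])
qed (rule assms(1))

text \<open>Uniform integrability upgrades almost everywhere convergence of the truncations to
  convergence in the mean, which a bounded \<open>u\<close> respects.\<close>

lemma pv_hilbert_bounded_pairing:
  fixes u v :: "real \<Rightarrow> 'a::euclidean_space"
  assumes ab: "a < b"
    and u: "u \<in> borel_measurable (lebesgue_on {a<..<b})" "\<And>x. x \<in> {a<..<b} \<Longrightarrow> norm (u x) \<le> U"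
    and v: "v \<in> borel_measurable (lebesgue_on {a<..<b})" "\<And>x. x \<in> {a<..<b} \<Longrightarrow> norm (v x) \<le> V"
  shows "integrable (lebesgue_on {a<..<b}) (\<lambda>x. u x \<bullet> pv_hilbert a b v x)"
    and "(\<lambda>n. \<integral>x. u x \<bullet> trunc_hilbert a b (inverse (real (Suc n))) v x \<partial>lebesgue_on {a<..<b})
      \<longlonglongrightarrow> (\<integral>x. u x \<bullet> pv_hilbert a b v x \<partial>lebesgue_on {a<..<b})"
proof -
  let ?\<mu> = "lebesgue_on {a<..<b}"
  define w where "w = (\<lambda>n. trunc_hilbert a b (inverse (real (Suc n))) v)"
  define W where "W = pv_hilbert a b v"
  have v1: "integrable ?\<mu> v" by (rule integrable_bounded_Ioo[OF v])
  have iw: "integrable ?\<mu> (w n)" for n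
    unfolding w_def by (rule integrable_trunc_hilbert_bounded[OF _ v1]) simp
  have W: "W \<in> borel_measurable ?\<mu>" unfolding W_def by (rule borel_measurable_pv_hilbert[OF v(1)])
  have lim: "AE x in ?\<mu>. (\<lambda>n. w n x) \<longlonglongrightarrow> W x"
    using AE_pv_converges[OF v1]
    by eventually_elim (use filterlim_compose[OF pv_convergesD filterlim_inverse_Suc] in \<open>simp add: w_def W_def\<close>)
  obtain K where K: "\<And>\<epsilon> \<delta> E. 0 < \<epsilon> \<Longrightarrow> 0 < \<delta> \<Longrightarrow> E \<in> sets ?\<mu> \<Longrightarrow> measure ?\<mu> E \<le> \<delta> \<Longrightarrow> \<delta> \<le> b - a
      \<Longrightarrow> (\<integral>x. indicator E x * norm (trunc_hilbert a b \<epsilon> v x) \<partial>?\<mu>) \<le> K * sqrt \<delta>"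
    by (rule trunc_hilbert_uniformly_integrable[OF v ab]; (assumption | (rule that; assumption)))
  have vit: "integrable ?\<mu> W" "(\<lambda>n. \<integral>x. norm (w n x - W x) \<partial>?\<mu>) \<longlonglongrightarrow> 0"
    by (rule Vitali_convergence[OF finite_measure_Ioo iw W lim, of "b - a" K];
        use ab K in \<open>simp add: w_def measure_restrict_space\<close>)+
  note iW = vit(1)
  have iu: "integrable ?\<mu> (\<lambda>x. u x \<bullet> z x)" if z: "integrable ?\<mu> z" for z
  proof (rule Bochner_Integration.integrable_bound)
    show "integrable ?\<mu> (\<lambda>x. U * norm (z x))" by (intro integrable_mult_right integrable_norm z)
    show "(\<lambda>x. u x \<bullet> z x) \<in> borel_measurable ?\<mu>" using z u(1) by (intro borel_measurable_inner) auto
    show "AE x in ?\<mu>. norm (u x \<bullet> z x) \<le> norm (U * norm (z x))"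
    proof (rule AE_I2)
      fix x assume "x \<in> space ?\<mu>"
      then have "norm (u x) * norm (z x) \<le> U * norm (z x)" using u(2) by (intro mult_right_mono) auto
      then show "norm (u x \<bullet> z x) \<le> norm (U * norm (z x))"
        using Cauchy_Schwarz_ineq2[of "u x" "z x"] by simp
    qed
  qed
  show "integrable ?\<mu> (\<lambda>x. u x \<bullet> pv_hilbert a b v x)" using iu[OF iW] by (simp add: W_def)
  have "(\<lambda>n. (\<integral>x. u x \<bullet> w n x \<partial>?\<mu>) - (\<integral>x. u x \<bullet> W x \<partial>?\<mu>)) \<longlonglongrightarrow> 0"
  proof (rule Lim_null_comparison)
    show "(\<lambda>n. U * (\<integral>x. norm (w n x - W x) \<partial>?\<mu>)) \<longlonglongrightarrow> 0"
      using tendsto_mult_left[OF vit(2), of U] by simp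
    show "\<forall>\<^sub>F n in sequentially. norm ((\<integral>x. u x \<bullet> w n x \<partial>?\<mu>) - (\<integral>x. u x \<bullet> W x \<partial>?\<mu>)) \<le> U * (\<integral>x. norm (w n x - W x) \<partial>?\<mu>)"
    proof (intro always_eventually allI)
      fix n
      have id: "integrable ?\<mu> (\<lambda>x. w n x - W x)" using iw iW by auto
      have "(\<integral>x. u x \<bullet> w n x \<partial>?\<mu>) - (\<integral>x. u x \<bullet> W x \<partial>?\<mu>) = (\<integral>x. u x \<bullet> (w n x - W x) \<partial>?\<mu>)"
        using iu[OF iw] iu[OF iW] by (simp add: inner_diff_right Bochner_Integration.integral_diff)
      also have "norm \<dots> \<le> (\<integral>x. norm (u x \<bullet> (w n x - W x)) \<partial>?\<mu>)" by (rule integral_norm_bound)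
      also have "\<dots> \<le> (\<integral>x. U * norm (w n x - W x) \<partial>?\<mu>)"
      proof (rule integral_mono)
        show "integrable ?\<mu> (\<lambda>x. norm (u x \<bullet> (w n x - W x)))" by (rule integrable_norm[OF iu[OF id]])
        show "integrable ?\<mu> (\<lambda>x. U * norm (w n x - W x))" by (intro integrable_mult_right integrable_norm id)
        fix x assume "x \<in> space ?\<mu>"
        then have "norm (u x) * norm (w n x - W x) \<le> U * norm (w n x - W x)" using u(2) by (intro mult_right_mono) auto
        then show "norm (u x \<bullet> (w n x - W x)) \<le> U * norm (w n x - W x)"
          using Cauchy_Schwarz_ineq2[of "u x" "w n x - W x"] by simp
      qed
      finally show "norm ((\<integral>x. u x \<bullet> w n x \<partial>?\<mu>) - (\<integral>x. u x \<bullet> W x \<partial>?\<mu>)) \<le> U * (\<integral>x. norm (w n x - W x) \<partial>?\<mu>)"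
        by simp
    qed
  qed
  then show "(\<lambda>n. \<integral>x. u x \<bullet> trunc_hilbert a b (inverse (real (Suc n))) v x \<partial>?\<mu>)
      \<longlonglongrightarrow> (\<integral>x. u x \<bullet> pv_hilbert a b v x \<partial>?\<mu>)"
    using LIM_zero_cancel by (simp add: w_def W_def)
qed

theorem pv_hilbert_antisymmetric:
  fixes u v :: "real \<Rightarrow> 'a::euclidean_space"
  assumes ab: "a < b"
    and u: "u \<in> borel_measurable (lebesgue_on {a<..<b})" "\<And>x. x \<in> {a<..<b} \<Longrightarrow> norm (u x) \<le> U"
    and v: "v \<in> borel_measurable (lebesgue_on {a<..<b})" "\<And>x. x \<in> {a<..<b} \<Longrightarrow> norm (v x) \<le> V"
  shows "(\<integral>x. u x \<bullet> pv_hilbert a b v x \<partial>lebesgue_on {a<..<b})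
    = - (\<integral>x. v x \<bullet> pv_hilbert a b u x \<partial>lebesgue_on {a<..<b})"
proof (rule LIMSEQ_unique)
  show "(\<lambda>n. \<integral>x. u x \<bullet> trunc_hilbert a b (inverse (real (Suc n))) v x \<partial>lebesgue_on {a<..<b})
      \<longlonglongrightarrow> (\<integral>x. u x \<bullet> pv_hilbert a b v x \<partial>lebesgue_on {a<..<b})"
    by (rule pv_hilbert_bounded_pairing(2)[OF ab u v])
  have "(\<integral>x. u x \<bullet> trunc_hilbert a b (inverse (real (Suc n))) v x \<partial>lebesgue_on {a<..<b})
      = - (\<integral>x. v x \<bullet> trunc_hilbert a b (inverse (real (Suc n))) u x \<partial>lebesgue_on {a<..<b})" for n
    by (rule trunc_hilbert_antisymmetric[OF _ u v]) simp
  then show "(\<lambda>n. \<integral>x. u x \<bullet> trunc_hilbert a b (inverse (real (Suc n))) v x \<partial>lebesgue_on {a<..<b})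
      \<longlonglongrightarrow> - (\<integral>x. v x \<bullet> pv_hilbert a b u x \<partial>lebesgue_on {a<..<b})"
    using tendsto_minus[OF pv_hilbert_bounded_pairing(2)[OF ab v u]] by (simp only:)
qed

section \<open>Square-integrable vector functions\<close>

text \<open>The euclidean inner product is the real part of the Hermitian one, and all symmetry
  statements below use it: \<open>adjoint_matrix\<close> is still the adjoint, and complex scalars
  move across with a conjugate.\<close>

lemma inner_complex_vec: "(x :: complex ^ 'n) \<bullet> y = Re (\<Sum>i\<in>UNIV. cnj (x $ i) * y $ i)"
  by (simp add: inner_vec_def inner_complex_def)

lemma inner_adjoint_matrix:
  fixes M :: "complex ^ 'm ^ 'k"
  shows "(adjoint_matrix M *v y) \<bullet> w = y \<bullet> (M *v w)"
proof -
  have "(\<Sum>j\<in>UNIV. cnj ((adjoint_matrix M *v y) $ j) * w $ j) = (\<Sum>j\<in>UNIV. \<Sum>i\<in>UNIV. cnj (y $ i) * (M $ i $ j * w $ j))"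
    by (simp add: adjoint_matrix_def matrix_vector_mult_def sum_distrib_left sum_distrib_right mult_ac)
  also have "\<dots> = (\<Sum>i\<in>UNIV. \<Sum>j\<in>UNIV. cnj (y $ i) * (M $ i $ j * w $ j))" by (rule sum.swap)
  also have "\<dots> = (\<Sum>i\<in>UNIV. cnj (y $ i) * (M *v w) $ i)"
    by (simp add: matrix_vector_mult_def sum_distrib_left)
  finally show ?thesis by (simp add: inner_complex_vec)
qed

lemma inner_scalar_mult: "(c *s x) \<bullet> y = x \<bullet> (cnj c *s (y :: complex ^ 'n))"
  by (simp add: inner_complex_vec sum_distrib_left[symmetric] mult_ac)

lemma mat_mult_vec: "mat c *v (y :: complex ^ 'n) = c *s y"
  by (simp add: vec_eq_iff matrix_vector_mult_def mat_def if_distrib[of "\<lambda>z. z * _"] cong: if_cong)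

lemma bounded_linear_matrix_vector: "bounded_linear (\<lambda>y. (M :: complex ^ 'm ^ 'k) *v y)"
  by (rule linear_conv_bounded_linear[THEN iffD1], rule linearI)
     (auto simp: vec_eq_iff matrix_vector_mult_def sum.distrib scaleR_sum_right algebra_simps)

lemma bounded_linear_scalar_mult: "bounded_linear (\<lambda>y. c *s (y :: complex ^ 'n))"
  by (rule linear_conv_bounded_linear[THEN iffD1], rule linearI) (auto simp: vec_eq_iff algebra_simps)

lemma bounded_linear_matrix_arg: "bounded_linear (\<lambda>M. (M :: complex ^ 'm ^ 'k) *v w)"
  by (rule linear_conv_bounded_linear[THEN iffD1], rule linearI)
     (auto simp: vec_eq_iff matrix_vector_mult_def sum.distrib scaleR_sum_right algebra_simps)

lemma scalar_mult_matrix_vector: "M *v (c *s y) = c *s ((M :: complex ^ 'm ^ 'k) *v y)"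
  by (auto simp: vec_eq_iff matrix_vector_mult_def sum_distrib_left mult_ac)

lemma borel_measurable_bounded_linear:
  fixes T :: "'a::euclidean_space \<Rightarrow> 'b::euclidean_space"
  assumes "bounded_linear T" "f \<in> borel_measurable M"
  shows "(\<lambda>x. T (f x)) \<in> borel_measurable M"
  using borel_measurable_continuous_onI[of T] linear_continuous_on[OF assms(1)] measurable_compose[OF assms(2)] by blast

text \<open>A finite sum of norms, hence measurable in the matrix, that dominates the operator norms
  of \<open>M\<close> and of its adjoint. The sum runs over the real basis, so it also contains the
  columns multiplied by \<open>\<i>\<close>.\<close>

definition column_norm :: "complex ^ 'm ^ 'k \<Rightarrow> real"
  where "column_norm M = (\<Sum>w\<in>Basis. norm (M *v w))"

lemma column_norm_nonneg: "0 \<le> column_norm M"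
  by (simp add: column_norm_def sum_nonneg)

lemma norm_adjoint_matrix_vector_le: "norm (adjoint_matrix M *v y) \<le> column_norm M * norm y"
proof -
  have "norm (adjoint_matrix M *v y) \<le> (\<Sum>w\<in>Basis. \<bar>(adjoint_matrix M *v y) \<bullet> w\<bar>)" by (rule norm_le_l1)
  also have "\<dots> \<le> (\<Sum>w\<in>Basis. norm (M *v w) * norm y)"
    by (rule sum_mono) (use Cauchy_Schwarz_ineq2 in \<open>auto simp: inner_adjoint_matrix mult.commute\<close>)
  finally show ?thesis by (simp add: column_norm_def sum_distrib_right)
qed

lemma norm_matrix_vector_le:
  fixes M :: "complex ^ 'm ^ 'k"
  shows "norm (M *v y) \<le> column_norm M * norm y"
proof -
  have "M *v y = (\<Sum>w\<in>Basis. (y \<bullet> w) *\<^sub>R (M *v w))"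
    using bounded_linear_matrix_vector[of M, THEN bounded_linear.linear]
    by (subst (1) euclidean_representation[of y, symmetric]) (simp add: linear_sum linear_scale)
  also have "norm \<dots> \<le> (\<Sum>w\<in>Basis. norm ((y \<bullet> w) *\<^sub>R (M *v w)))" by (rule norm_sum)
  also have "\<dots> \<le> (\<Sum>w\<in>Basis. norm (M *v w) * norm y)"
    by (rule sum_mono) (auto simp: mult.commute Basis_le_norm intro!: mult_right_mono)
  finally show ?thesis by (simp add: column_norm_def sum_distrib_right)
qed

lemma borel_measurable_column_norm:
  "B \<in> borel_measurable N \<Longrightarrow> (\<lambda>x. column_norm (B x)) \<in> borel_measurable N"
  unfolding column_norm_def
  by (intro borel_measurable_sum borel_measurable_norm[THEN measurable_compose[rotated]]
      borel_measurable_bounded_linear[OF bounded_linear_matrix_arg])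

lemma borel_measurable_matrix_vector:
  fixes B :: "'x \<Rightarrow> complex ^ 'm ^ 'k"
  assumes "B \<in> borel_measurable N" "f \<in> borel_measurable N"
  shows "(\<lambda>x. B x *v f x) \<in> borel_measurable N"
proof -
  have "B x *v f x = (\<Sum>w\<in>Basis. (f x \<bullet> w) *\<^sub>R (B x *v w))" for x
    using bounded_linear_matrix_vector[of "B x", THEN bounded_linear.linear]
    by (subst (1) euclidean_representation[of "f x", symmetric]) (simp add: linear_sum linear_scale)
  then show ?thesis
    using assms by (simp only:) (intro borel_measurable_sum borel_measurable_scaleR borel_measurable_inner
        borel_measurable_const borel_measurable_bounded_linear[OF bounded_linear_matrix_arg])
qed

lemma borel_measurable_of_columns:
  fixes M :: "'x \<Rightarrow> complex ^ 'm ^ 'k"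
  assumes "\<And>j. (\<lambda>x. M x *v axis j 1) \<in> borel_measurable N"
  shows "M \<in> borel_measurable N"
proof -
  define J :: "'m \<Rightarrow> complex ^ 'k \<Rightarrow> complex ^ 'm ^ 'k" where "J = (\<lambda>j y. \<chi> i j'. if j' = j then y $ i else 0)"
  have J: "bounded_linear (J j)" for j
    by (rule linear_conv_bounded_linear[THEN iffD1], rule linearI) (auto simp: J_def vec_eq_iff)
  have "M x = (\<Sum>j\<in>UNIV. J j (M x *v axis j 1))" for x
    by (simp add: J_def vec_eq_iff matrix_vector_mult_def axis_def if_distrib[of "\<lambda>z. _ * z"] cong: if_cong)
  then have "M = (\<lambda>x. \<Sum>j\<in>UNIV. J j (M x *v axis j 1))" ..
  also have "\<dots> \<in> borel_measurable N"
    by (rule borel_measurable_sum, rule borel_measurable_bounded_linear[OF J assms])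
  finally show ?thesis .
qed

lemma adjoint_matrix_vector_expand:
  "adjoint_matrix M *v y = (\<Sum>w\<in>Basis. (y \<bullet> (M *v w)) *\<^sub>R w)"
  by (subst euclidean_representation[of "adjoint_matrix M *v y", symmetric]) (simp add: inner_adjoint_matrix)

section \<open>Membership, pairings and limits in \<open>L2_functions\<close>\<close>

lemma L2D:
  assumes "f \<in> L2_functions a b"
  shows "f \<in> borel_measurable (lebesgue_on {a<..<b})" "integrable (lebesgue_on {a<..<b}) (\<lambda>x. (norm (f x))\<^sup>2)"
  using assms by (auto simp: L2_functions_def)

lemma L2_dominated:
  assumes f: "f \<in> borel_measurable (lebesgue_on {a<..<b})"
    and h: "integrable (lebesgue_on {a<..<b}) h" and le: "AE x in lebesgue_on {a<..<b}. (norm (f x))\<^sup>2 \<le> h x"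
  shows "f \<in> L2_functions a b"
proof -
  have "integrable (lebesgue_on {a<..<b}) (\<lambda>x. (norm (f x))\<^sup>2)"
    by (rule Bochner_Integration.integrable_bound[OF h])
       (use f le in \<open>auto intro!: borel_measurable_power elim!: eventually_mono\<close>)
  then show ?thesis using f by (simp add: L2_functions_def)
qed

lemma norm_add_square_le: "(norm (x + y))\<^sup>2 \<le> 2 * (norm x)\<^sup>2 + 2 * (norm (y :: 'a::real_normed_vector))\<^sup>2"
proof -
  have "(norm (x + y))\<^sup>2 \<le> (norm x + norm y)\<^sup>2" by (intro power_mono norm_triangle_ineq) auto
  also have "\<dots> \<le> 2 * (norm x)\<^sup>2 + 2 * (norm y)\<^sup>2"
    using sum_squares_bound[of "norm x" "norm y"] by (simp add: power2_sum)
  finally show ?thesis .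
qed

lemma L2_add:
  assumes "f \<in> L2_functions a b" "g \<in> L2_functions a b"
  shows "(\<lambda>x. f x + g x) \<in> L2_functions a b"
proof (rule L2_dominated)
  show "(\<lambda>x. f x + g x) \<in> borel_measurable (lebesgue_on {a<..<b})"
    by (intro borel_measurable_add L2D(1) assms)
  show "integrable (lebesgue_on {a<..<b}) (\<lambda>x. 2 * (norm (f x))\<^sup>2 + 2 * (norm (g x))\<^sup>2)"
    by (intro Bochner_Integration.integrable_add integrable_mult_right L2D(2) assms)
qed (simp add: norm_add_square_le)

lemma L2_bounded_linear:
  fixes f :: "real \<Rightarrow> complex ^ 'k"
  assumes "bounded_linear T" "f \<in> L2_functions a b"
  shows "(\<lambda>x. T (f x) :: complex ^ 'k) \<in> L2_functions a b"
proof -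
  obtain K where K: "\<And>y. norm (T y) \<le> norm y * K" using bounded_linear.bounded[OF assms(1)] by blast
  show ?thesis
  proof (rule L2_dominated)
    show "(\<lambda>x. T (f x)) \<in> borel_measurable (lebesgue_on {a<..<b})"
      by (rule borel_measurable_bounded_linear[OF assms(1) L2D(1)[OF assms(2)]])
    show "integrable (lebesgue_on {a<..<b}) (\<lambda>x. K\<^sup>2 * (norm (f x))\<^sup>2)"
      by (intro integrable_mult_right L2D(2) assms)
    have "(norm (T y))\<^sup>2 \<le> K\<^sup>2 * (norm y)\<^sup>2" for y
      using power_mono[OF K[of y], of 2] by (simp add: power_mult_distrib mult.commute)
    then show "AE x in lebesgue_on {a<..<b}. (norm (T (f x)))\<^sup>2 \<le> K\<^sup>2 * (norm (f x))\<^sup>2" by simp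
  qed
qed

lemma L2_scalar_mult: "f \<in> L2_functions a b \<Longrightarrow> (\<lambda>x. c *s f x) \<in> L2_functions a b"
  by (rule L2_bounded_linear[OF bounded_linear_scalar_mult])

lemma L2_diff:
  assumes "f \<in> L2_functions a b" "g \<in> L2_functions a b"
  shows "(\<lambda>x. f x - g x) \<in> L2_functions a b"
  using L2_add[OF assms(1) L2_scalar_mult[OF assms(2), of "-1"]] by simp

lemma L2_bounded:
  assumes "f \<in> borel_measurable (lebesgue_on {a<..<b})" "\<And>x. x \<in> {a<..<b} \<Longrightarrow> norm (f x) \<le> C"
  shows "f \<in> L2_functions a b"
proof (rule L2_dominated[OF assms(1)])
  show "integrable (lebesgue_on {a<..<b}) (\<lambda>x. C\<^sup>2)" by (rule integrable_const_Ioo)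
  show "AE x in lebesgue_on {a<..<b}. (norm (f x))\<^sup>2 \<le> C\<^sup>2"
    using assms(2) by (intro AE_I2 power_mono) auto
qed

lemma L2_const: "(\<lambda>_. v) \<in> L2_functions a b"
  by (rule L2_bounded[of _ _ _ "norm v"]) auto

lemma L2_Q_op:
  assumes f: "f \<in> L2_functions a b"
  shows "Q_op f \<in> L2_functions a b"
proof (rule L2_dominated)
  show "Q_op f \<in> borel_measurable (lebesgue_on {a<..<b})"
    unfolding Q_op_def by (intro borel_measurable_scaleR ident_borel_measurable_lebesgue_on L2D(1)[OF f])
  show "integrable (lebesgue_on {a<..<b}) (\<lambda>x. (max \<bar>a\<bar> \<bar>b\<bar>)\<^sup>2 * (norm (f x))\<^sup>2)"
    by (intro integrable_mult_right L2D(2) f)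
  show "AE x in lebesgue_on {a<..<b}. (norm (Q_op f x))\<^sup>2 \<le> (max \<bar>a\<bar> \<bar>b\<bar>)\<^sup>2 * (norm (f x))\<^sup>2"
  proof (rule AE_I2)
    fix x assume "x \<in> space (lebesgue_on {a<..<b})"
    then have "norm (Q_op f x) \<le> max \<bar>a\<bar> \<bar>b\<bar> * norm (f x)" by (auto simp: Q_op_def intro!: mult_right_mono)
    from power_mono[OF this, of 2] show "(norm (Q_op f x))\<^sup>2 \<le> (max \<bar>a\<bar> \<bar>b\<bar>)\<^sup>2 * (norm (f x))\<^sup>2"
      by (simp add: power_mult_distrib)
  qed
qed

lemma L2_inner_integrable:
  fixes f g :: "real \<Rightarrow> complex ^ 'k"
  assumes "f \<in> L2_functions a b" "g \<in> L2_functions a b"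
  shows "integrable (lebesgue_on {a<..<b}) (\<lambda>x. norm (f x) * norm (g x))"
    and "integrable (lebesgue_on {a<..<b}) (\<lambda>x. f x \<bullet> g x)"
proof -
  have i: "integrable (lebesgue_on {a<..<b}) (\<lambda>x. (norm (f x))\<^sup>2 + (norm (g x))\<^sup>2)"
    by (intro Bochner_Integration.integrable_add L2D(2) assms)
  have le: "norm (f x) * norm (g x) \<le> (norm (f x))\<^sup>2 + (norm (g x))\<^sup>2" for x
    using sum_squares_bound[of "norm (f x)" "norm (g x)"] mult_nonneg_nonneg[OF norm_ge_zero[of "f x"] norm_ge_zero[of "g x"]]
    by linarith
  have fm: "f \<in> borel_measurable (lebesgue_on {a<..<b})" and gm: "g \<in> borel_measurable (lebesgue_on {a<..<b})"
    using assms L2D(1) by blast+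
  show n: "integrable (lebesgue_on {a<..<b}) (\<lambda>x. norm (f x) * norm (g x))"
    by (rule Bochner_Integration.integrable_bound[OF i])
       (use fm gm le in \<open>auto intro!: borel_measurable_times\<close>)
  show "integrable (lebesgue_on {a<..<b}) (\<lambda>x. f x \<bullet> g x)"
    by (rule Bochner_Integration.integrable_bound[OF n])
       (use fm gm in \<open>auto intro!: borel_measurable_inner simp: Cauchy_Schwarz_ineq2\<close>)
qed

lemma L2_Cauchy_Schwarz:
  fixes f g :: "real \<Rightarrow> complex ^ 'k"
  assumes f: "f \<in> L2_functions a b" and g: "g \<in> L2_functions a b"
  shows "\<bar>\<integral>x. f x \<bullet> g x \<partial>lebesgue_on {a<..<b}\<bar> \<le> L2_norm a b f * L2_norm a b g"
proof -
  let ?\<mu> = "lebesgue_on {a<..<b}"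
  define A B C where "A = (\<integral>x. (norm (f x))\<^sup>2 \<partial>?\<mu>)" and "B = (\<integral>x. f x \<bullet> g x \<partial>?\<mu>)" and "C = (\<integral>x. (norm (g x))\<^sup>2 \<partial>?\<mu>)"
  note i = L2D(2)[OF f] L2D(2)[OF g] L2_inner_integrable(2)[OF f g]
  have q: "0 \<le> A + 2 * t * B + t\<^sup>2 * C" for t
  proof -
    have "0 \<le> (\<integral>x. (norm (f x + t *\<^sub>R g x))\<^sup>2 \<partial>?\<mu>)" by (rule Bochner_Integration.integral_nonneg) simp
    also have "(\<lambda>x. (norm (f x + t *\<^sub>R g x))\<^sup>2) = (\<lambda>x. (norm (f x))\<^sup>2 + 2 * t * (f x \<bullet> g x) + t\<^sup>2 * (norm (g x))\<^sup>2)"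
      unfolding power2_norm_eq_inner
      by (auto simp: inner_add_left inner_add_right inner_commute power2_eq_square algebra_simps)
    also have "(\<integral>x. (norm (f x))\<^sup>2 + 2 * t * (f x \<bullet> g x) + t\<^sup>2 * (norm (g x))\<^sup>2 \<partial>?\<mu>) = A + 2 * t * B + t\<^sup>2 * C"
      using i by (simp add: A_def B_def C_def)
    finally show ?thesis .
  qed
  have AC: "0 \<le> A" "0 \<le> C" by (auto simp: A_def C_def)
  have "B\<^sup>2 \<le> A * C"
  proof (cases "C = 0")
    case True
    have "B = 0"
    proof (rule ccontr)
      assume "B \<noteq> 0"
      \<comment> \<open>For C = 0 the quadratic degenerates to A + 2 t B; this choice of
        \<open>t\<close> would give it the value -1.\<close>
      then have "2 * (- (A + 1) / (2 * B)) * B = - (A + 1)" by simp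
      then show False using q[of "- (A + 1) / (2 * B)"] True by simp
    qed
    then show ?thesis using AC by simp
  next
    case False
    have "0 \<le> (A + 2 * (- B / C) * B + (- B / C)\<^sup>2 * C) * C" by (rule mult_nonneg_nonneg[OF q AC(2)])
    also have "\<dots> = A * C - B\<^sup>2" using False by (simp add: field_simps power2_eq_square)
    finally show ?thesis by simp
  qed
  then have "sqrt (B\<^sup>2) \<le> sqrt (A * C)" by (rule real_sqrt_le_mono)
  then show ?thesis by (simp add: A_def B_def C_def L2_norm_def real_sqrt_mult)
qed

lemma L2_norm_nonneg: "0 \<le> L2_norm a b f"
  by (simp add: L2_norm_def)

lemma L2_norm_cong_AE:
  assumes "AE x in lebesgue_on {a<..<b}. f x = g x" "f \<in> L2_functions a b" "g \<in> L2_functions a b"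
  shows "L2_norm a b f = L2_norm a b g"
  unfolding L2_norm_def
  by (rule arg_cong[of _ _ sqrt], rule integral_cong_AE)
     (use assms L2D(2)[OF assms(2)] L2D(2)[OF assms(3)] in \<open>auto elim!: eventually_mono\<close>)

lemma L2_dominated_convergence:
  fixes f :: "real \<Rightarrow> complex ^ 'k"
  assumes f: "f \<in> L2_functions a b" and F: "\<And>n. F n \<in> borel_measurable (lebesgue_on {a<..<b})"
    and lim: "AE x in lebesgue_on {a<..<b}. (\<lambda>n. F n x) \<longlonglongrightarrow> f x"
    and bd: "\<And>n. AE x in lebesgue_on {a<..<b}. norm (F n x) \<le> c + norm (f x)"
  shows "\<And>n. F n \<in> L2_functions a b" "(\<lambda>n. L2_norm a b (\<lambda>x. F n x - f x)) \<longlonglongrightarrow> 0"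
proof -
  let ?\<mu> = "lebesgue_on {a<..<b}"
  have "integrable ?\<mu> (\<lambda>x. 2 * c\<^sup>2 + 2 * (norm (f x))\<^sup>2)" for c
    by (intro Bochner_Integration.integrable_add integrable_mult_right L2D(2) f integrable_const_Ioo)
  note h = this
  have sq: "(c + y)\<^sup>2 \<le> 2 * c\<^sup>2 + 2 * y\<^sup>2" for c y :: real
    using sum_squares_bound[of c y] by (simp add: power2_sum)
  show FL: "F n \<in> L2_functions a b" for n
  proof (rule L2_dominated[OF F h])
    show "AE x in ?\<mu>. (norm (F n x))\<^sup>2 \<le> 2 * c\<^sup>2 + 2 * (norm (f x))\<^sup>2"
      using bd[of n]
    proof eventually_elim
      case (elim x)
      from power_mono[OF this, of 2] show ?case using sq[of c "norm (f x)"] by simp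
    qed
  qed
  have "(\<lambda>n. \<integral>x. (norm (F n x - f x))\<^sup>2 \<partial>?\<mu>) \<longlonglongrightarrow> (\<integral>x. 0 \<partial>?\<mu>)"
  proof (rule integral_dominated_convergence[of _ _ _ "\<lambda>x. 2 * c\<^sup>2 + 2 * (2 * norm (f x))\<^sup>2"])
    show "integrable ?\<mu> (\<lambda>x. 2 * c\<^sup>2 + 2 * (2 * norm (f x))\<^sup>2)"
      using integrable_const_Ioo[of a b "2 * c\<^sup>2"] L2D(2)[OF f]
      by (auto simp: power_mult_distrib)
    show "(\<lambda>x. (norm (F n x - f x))\<^sup>2) \<in> borel_measurable ?\<mu>" for n
      using L2D(2)[OF L2_diff[OF FL f]] by auto
    show "AE x in ?\<mu>. (\<lambda>n. (norm (F n x - f x))\<^sup>2) \<longlonglongrightarrow> 0"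
      using lim
    proof eventually_elim
      case (elim x)
      then have "(\<lambda>n. norm (F n x - f x)) \<longlonglongrightarrow> 0" using LIM_zero tendsto_norm_zero by blast
      from tendsto_power[OF this, of 2] show ?case by simp
    qed
    show "AE x in ?\<mu>. norm ((norm (F n x - f x))\<^sup>2) \<le> 2 * c\<^sup>2 + 2 * (2 * norm (f x))\<^sup>2" for n
      using bd[of n]
    proof eventually_elim
      case (elim x)
      then have "norm (F n x - f x) \<le> c + 2 * norm (f x)" using norm_triangle_ineq4[of "F n x" "f x"] by linarith
      from power_mono[OF this, of 2] show ?case using sq[of c "2 * norm (f x)"] by simp
    qed
  qed simp
  then have "(\<lambda>n. sqrt (\<integral>x. (norm (F n x - f x))\<^sup>2 \<partial>?\<mu>)) \<longlonglongrightarrow> sqrt 0" by (intro tendsto_real_sqrt) simp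
  then show "(\<lambda>n. L2_norm a b (\<lambda>x. F n x - f x)) \<longlonglongrightarrow> 0" by (simp add: L2_norm_def)
qed

section \<open>Operators with principal value kernels\<close>

definition adjoint_apply :: "(real \<Rightarrow> complex ^ 'm ^ 'k) \<Rightarrow> (real \<Rightarrow> complex ^ 'k) \<Rightarrow> real \<Rightarrow> complex ^ 'm"
  where "adjoint_apply B f = (\<lambda>t. adjoint_matrix (B t) *v f t)"

definition L2_columns :: "real \<Rightarrow> real \<Rightarrow> (real \<Rightarrow> complex ^ 'm ^ 'k) \<Rightarrow> bool"
  where "L2_columns a b B \<longleftrightarrow> (\<forall>w. (\<lambda>x. B x *v w) \<in> L2_functions a b)"

lemma L2_columns_measurable:
  assumes "L2_columns a b B"
  shows "B \<in> borel_measurable (lebesgue_on {a<..<b})"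
  by (rule borel_measurable_of_columns) (use assms L2D(1) in \<open>auto simp: L2_columns_def\<close>)

text \<open>The form \<open>has_pv_form\<close> takes for the kernel c B(x) B(t)^* once the factor
  depending on \<open>x\<close> is pulled out of the principal value. It occurs with
  \<open>\<i>\<close> and \<open>A\<close> for \<open>S\<close>, and with \<open>- \<i>\<close> and
  \<open>B\<close> for \<open>T\<close>.\<close>

definition pv_representation ::
    "real \<Rightarrow> real \<Rightarrow> ((real \<Rightarrow> complex ^ 'k) \<Rightarrow> (real \<Rightarrow> complex ^ 'k)) \<Rightarrow> (real \<Rightarrow> complex ^ 'k ^ 'k)
      \<Rightarrow> complex \<Rightarrow> (real \<Rightarrow> complex ^ 'm ^ 'k) \<Rightarrow> (real \<Rightarrow> complex ^ 'k) \<Rightarrow> bool"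
  where "pv_representation a b R M c B f \<longleftrightarrow>
    (AE x in lebesgue_on {a<..<b}. R f x = M x *v f x + c *s (B x *v pv_hilbert a b (adjoint_apply B f) x))"

lemma adjoint_apply_expand: "adjoint_apply B f t = (\<Sum>w\<in>Basis. (f t \<bullet> (B t *v w)) *\<^sub>R w)"
  unfolding adjoint_apply_def by (rule adjoint_matrix_vector_expand)

lemma borel_measurable_adjoint_apply:
  assumes "L2_columns a b B" "f \<in> borel_measurable (lebesgue_on {a<..<b})"
  shows "adjoint_apply B f \<in> borel_measurable (lebesgue_on {a<..<b})"
proof -
  have "(\<lambda>x. B x *v w) \<in> borel_measurable (lebesgue_on {a<..<b})" for w
    using assms(1) L2D(1) by (auto simp: L2_columns_def)
  then show ?thesis
    unfolding adjoint_apply_expand[abs_def]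
    by (intro borel_measurable_sum borel_measurable_scaleR borel_measurable_inner borel_measurable_const assms(2))
qed

lemma integrable_adjoint_apply:
  assumes "L2_columns a b B" "f \<in> L2_functions a b"
  shows "integrable (lebesgue_on {a<..<b}) (adjoint_apply B f)"
  unfolding adjoint_apply_expand[abs_def]
  by (intro Bochner_Integration.integrable_sum integrable_scaleR_left L2_inner_integrable(2) assms)
     (use assms in \<open>auto simp: L2_columns_def\<close>)

lemma AE_pv_adjoint_apply:
  assumes "L2_columns a b B" "f \<in> L2_functions a b"
  shows "AE x in lebesgue_on {a<..<b}. pv_converges a b (adjoint_apply B f) x"
  by (rule AE_pv_converges[OF integrable_adjoint_apply[OF assms]])

text \<open>The majorant is a product of two square-integrable functions,
  \<open>column_norm (B x)\<close> and \<open>c + norm (f x)\<close>, so the convergence is in the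
  mean.\<close>

lemma adjoint_apply_dominated_convergence:
  fixes f :: "real \<Rightarrow> complex ^ 'k"
  assumes B: "L2_columns a b B" and f: "f \<in> L2_functions a b"
    and F: "\<And>n. F n \<in> borel_measurable (lebesgue_on {a<..<b})"
    and lim: "AE x in lebesgue_on {a<..<b}. (\<lambda>n. F n x) \<longlonglongrightarrow> f x"
    and bd: "\<And>n. AE x in lebesgue_on {a<..<b}. norm (F n x) \<le> c + norm (f x)"
  shows "(\<lambda>n. \<integral>t. norm (adjoint_apply B (F n) t - adjoint_apply B f t) \<partial>lebesgue_on {a<..<b}) \<longlonglongrightarrow> 0"
proof (rule dominated_L1_limit(2)[OF integrable_adjoint_apply[OF B f] borel_measurable_adjoint_apply[OF B F]])
  show "integrable (lebesgue_on {a<..<b}) (\<lambda>x. column_norm (B x) * (c + norm (f x)))"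
  proof -
    have Bw: "(\<lambda>x. B x *v w) \<in> L2_functions a b" for w using B by (simp add: L2_columns_def)
    have "integrable (lebesgue_on {a<..<b}) (\<lambda>x. \<Sum>w\<in>Basis. c * norm (B x *v w) + norm (B x *v w) * norm (f x))"
      by (intro Bochner_Integration.integrable_sum Bochner_Integration.integrable_add integrable_mult_right
          integrable_norm[OF integrable_of_L2[OF L2D(1)[OF Bw] L2D(2)[OF Bw]]] L2_inner_integrable(1)[OF Bw f])
    moreover have "column_norm (B x) * (c + norm (f x)) = (\<Sum>w\<in>Basis. c * norm (B x *v w) + norm (B x *v w) * norm (f x))" for x
      by (simp only: column_norm_def sum_distrib_right distrib_left sum.distrib mult.commute[of c])
    ultimately show ?thesis by (simp only:)
  qed
  show "AE x in lebesgue_on {a<..<b}. (\<lambda>n. adjoint_apply B (F n) x) \<longlonglongrightarrow> adjoint_apply B f x"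
    using lim unfolding adjoint_apply_def
    by eventually_elim (rule bounded_linear.tendsto[OF bounded_linear_matrix_vector])
  show "AE x in lebesgue_on {a<..<b}. norm (adjoint_apply B (F n) x) \<le> column_norm (B x) * (c + norm (f x))" for n
    using bd[of n] unfolding adjoint_apply_def
    by eventually_elim (rule order_trans[OF norm_adjoint_matrix_vector_le mult_left_mono[OF _ column_norm_nonneg]])
qed

section \<open>Bounded operators, up to null sets, and stability of
  \<open>pv_representation\<close>\<close>

lemma bounded_L2_operatorD:
  assumes "bounded_L2_operator a b R" "f \<in> L2_functions a b"
  shows "R f \<in> L2_functions a b"
    and "g \<in> L2_functions a b \<Longrightarrow> AE x in lebesgue_on {a<..<b}. f x = g x \<Longrightarrow> AE x in lebesgue_on {a<..<b}. R f x = R g x"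
    and "g \<in> L2_functions a b \<Longrightarrow> AE x in lebesgue_on {a<..<b}. R (\<lambda>x. f x + g x) x = R f x + R g x"
    and "AE x in lebesgue_on {a<..<b}. R (\<lambda>x. c *s f x) x = c *s R f x"
  using assms unfolding bounded_L2_operator_def L2_eq_def by auto

lemma L2_operator_diff:
  assumes R: "bounded_L2_operator a b R" and f: "f \<in> L2_functions a b" and g: "g \<in> L2_functions a b"
  shows "AE x in lebesgue_on {a<..<b}. R (\<lambda>x. f x - g x) x = R f x - R g x"
  using bounded_L2_operatorD(3)[OF R f L2_scalar_mult[OF g, of "-1"]] bounded_L2_operatorD(4)[OF R g, of "-1"]
  by eventually_elim simp

lemma L2_operator_tendsto:
  assumes R: "bounded_L2_operator a b R" and f: "f \<in> L2_functions a b" and F: "\<And>n. F n \<in> L2_functions a b"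
    and lim: "(\<lambda>n. L2_norm a b (\<lambda>x. F n x - f x)) \<longlonglongrightarrow> 0"
  shows "(\<lambda>n. L2_norm a b (\<lambda>x. R (F n) x - R f x)) \<longlonglongrightarrow> 0"
proof -
  obtain C where C: "\<And>f. f \<in> L2_functions a b \<Longrightarrow> L2_norm a b (R f) \<le> C * L2_norm a b f"
    using R unfolding bounded_L2_operator_def by blast
  note Rf = bounded_L2_operatorD(1)[OF R]
  have le: "norm (L2_norm a b (\<lambda>x. R (F n) x - R f x)) \<le> C * L2_norm a b (\<lambda>x. F n x - f x)" for n
  proof -
    have "L2_norm a b (R (\<lambda>x. F n x - f x)) = L2_norm a b (\<lambda>x. R (F n) x - R f x)"
      by (rule L2_norm_cong_AE[OF L2_operator_diff[OF R F f] Rf[OF L2_diff[OF F f]] L2_diff[OF Rf[OF F] Rf[OF f]]])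
    then show ?thesis using C[OF L2_diff[OF F[of n] f]] by (simp add: L2_norm_nonneg)
  qed
  show ?thesis
    by (rule Lim_null_comparison[OF always_eventually[OF allI[OF le]]]) (use tendsto_mult_left[OF lim, of C] in simp)
qed

lemma L2_norm_tendsto_AE_subseq:
  fixes h :: "nat \<Rightarrow> real \<Rightarrow> complex ^ 'k"
  assumes h: "\<And>n. h n \<in> L2_functions a b" and lim: "(\<lambda>n. L2_norm a b (h n)) \<longlonglongrightarrow> 0"
  obtains r where "strict_mono r" "AE x in lebesgue_on {a<..<b}. (\<lambda>n. h (r n) x) \<longlonglongrightarrow> 0"
proof -
  have "(\<lambda>n. \<integral>x. norm ((norm (h n x))\<^sup>2) \<partial>lebesgue_on {a<..<b}) = (\<lambda>n. (L2_norm a b (h n))\<^sup>2)"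
    by (simp add: L2_norm_def)
  moreover have "(\<lambda>n. (L2_norm a b (h n))\<^sup>2) \<longlonglongrightarrow> 0" using tendsto_power[OF lim, of 2] by simp
  ultimately have "\<exists>r. strict_mono r \<and> (AE x in lebesgue_on {a<..<b}. (\<lambda>n. (norm (h (r n) x))\<^sup>2) \<longlonglongrightarrow> 0)"
    by (intro tendsto_L1_AE_subseq L2D(2) h) simp
  then obtain r where r: "strict_mono r" "AE x in lebesgue_on {a<..<b}. (\<lambda>n. (norm (h (r n) x))\<^sup>2) \<longlonglongrightarrow> 0" by blast
  from r(2) have "AE x in lebesgue_on {a<..<b}. (\<lambda>n. h (r n) x) \<longlonglongrightarrow> 0"
  proof eventually_elim
    case (elim x)
    from tendsto_real_sqrt[OF this] show ?case by (simp add: tendsto_norm_zero_iff)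
  qed
  with r(1) that show thesis by blast
qed

lemma pv_representation_add:
  assumes R: "bounded_L2_operator a b R" and B: "L2_columns a b B"
    and f: "f \<in> L2_functions a b" and g: "g \<in> L2_functions a b"
    and Pf: "pv_representation a b R M c B f" and Pg: "pv_representation a b R M c B g"
  shows "pv_representation a b R M c B (\<lambda>x. f x + g x)"
  using bounded_L2_operatorD(3)[OF R f g] Pf Pg AE_pv_adjoint_apply[OF B f] AE_pv_adjoint_apply[OF B g]
  unfolding pv_representation_def
proof eventually_elim
  case (elim x)
  have "adjoint_apply B (\<lambda>x. f x + g x) = (\<lambda>t. adjoint_apply B f t + adjoint_apply B g t)"
    by (simp add: adjoint_apply_def matrix_vector_right_distrib)
  then have "pv_hilbert a b (adjoint_apply B (\<lambda>x. f x + g x)) x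
      = pv_hilbert a b (adjoint_apply B f) x + pv_hilbert a b (adjoint_apply B g) x"
    using pv_hilbert_eqI[OF pv_hilbert_add[OF integrable_adjoint_apply[OF B f] integrable_adjoint_apply[OF B g] elim(4,5)]]
    by simp
  then show ?case using elim by (simp add: matrix_vector_right_distrib vector_add_ldistrib)
qed

lemma pv_representation_scalar_mult:
  assumes R: "bounded_L2_operator a b R" and B: "L2_columns a b B"
    and f: "f \<in> L2_functions a b" and Pf: "pv_representation a b R M c B f"
  shows "pv_representation a b R M c B (\<lambda>x. d *s f x)"
  using bounded_L2_operatorD(4)[OF R f, of d] Pf AE_pv_adjoint_apply[OF B f]
  unfolding pv_representation_def
proof eventually_elim
  case (elim x)
  have "adjoint_apply B (\<lambda>x. d *s f x) = (\<lambda>t. d *s adjoint_apply B f t)"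
    by (simp add: adjoint_apply_def scalar_mult_matrix_vector)
  then have "pv_hilbert a b (adjoint_apply B (\<lambda>x. d *s f x)) x = d *s pv_hilbert a b (adjoint_apply B f) x"
    using pv_hilbert_eqI[OF pv_hilbert_linear[OF bounded_linear_scalar_mult integrable_adjoint_apply[OF B f] elim(3)]]
    by simp
  then show ?case using elim by (simp add: scalar_mult_matrix_vector vector_add_ldistrib vector_smult_assoc mult.commute)
qed

text \<open>Passing to \<open>Q_op f\<close> changes both sides by the same finite rank term: on the
  left by the commutator hypothesis, on the right by
  \<open>trunc_hilbert_ident_limit\<close>.\<close>

lemma pv_representation_Q_op:
  assumes R: "bounded_L2_operator a b R" and B: "L2_columns a b B"
    and f: "f \<in> L2_functions a b" and Pf: "pv_representation a b R M c B f"
    and comm: "AE x in lebesgue_on {a<..<b}. Q_op (R f) x - R (Q_op f) x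
        = c *s (B x *v (\<integral>t. adjoint_apply B f t \<partial>lebesgue_on {a<..<b}))"
  shows "pv_representation a b R M c B (Q_op f)"
  using comm Pf AE_pv_adjoint_apply[OF B f]
  unfolding pv_representation_def
proof eventually_elim
  case (elim x)
  have lin: "linear (\<lambda>y. c *s (B x *v y))"
    using bounded_linear_compose[OF bounded_linear_scalar_mult bounded_linear_matrix_vector] by (rule bounded_linear.linear)
  have "adjoint_apply B (Q_op f) = (\<lambda>t. t *\<^sub>R adjoint_apply B f t)"
    by (simp add: adjoint_apply_def Q_op_def linear_scale[OF bounded_linear.linear[OF bounded_linear_matrix_vector]])
  then have "pv_hilbert a b (adjoint_apply B (Q_op f)) x
      = x *\<^sub>R pv_hilbert a b (adjoint_apply B f) x - (\<integral>t. adjoint_apply B f t \<partial>lebesgue_on {a<..<b})"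
    using pv_hilbert_eqI[OF trunc_hilbert_ident_limit[OF integrable_adjoint_apply[OF B f] pv_convergesD[OF elim(3)]]]
    by simp
  then have "c *s (B x *v pv_hilbert a b (adjoint_apply B (Q_op f)) x)
      = x *\<^sub>R (c *s (B x *v pv_hilbert a b (adjoint_apply B f) x)) - c *s (B x *v (\<integral>t. adjoint_apply B f t \<partial>lebesgue_on {a<..<b}))"
    using linear_diff[OF lin] linear_scale[OF lin] by simp
  moreover have "y = z - w" if "z - y = w" for w y z :: "complex ^ 'a" using that by auto
  from this[OF elim(1)] have "R (Q_op f) x = x *\<^sub>R R f x - c *s (B x *v (\<integral>t. adjoint_apply B f t \<partial>lebesgue_on {a<..<b}))"
    by (simp add: Q_op_def)
  ultimately show ?case using elim(2)
    by (simp add: linear_scale[OF bounded_linear.linear[OF bounded_linear_matrix_vector]] scaleR_add_right Q_op_def[of f])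
qed

text \<open>Convergence in norm gives almost everywhere convergence only along subsequences:
  \<open>r\<close> serves the transforms, and \<open>s\<close> is extracted from it for
  \<open>R\<close>.\<close>

lemma pv_representation_limit:
  assumes R: "bounded_L2_operator a b R" and B: "L2_columns a b B"
    and f: "f \<in> L2_functions a b" and F: "\<And>n. F n \<in> borel_measurable (lebesgue_on {a<..<b})"
    and lim: "AE x in lebesgue_on {a<..<b}. (\<lambda>n. F n x) \<longlonglongrightarrow> f x"
    and bd: "\<And>n. AE x in lebesgue_on {a<..<b}. norm (F n x) \<le> d + norm (f x)"
    and P: "\<And>n. pv_representation a b R M c B (F n)"
  shows "pv_representation a b R M c B f"
proof -
  let ?\<mu> = "lebesgue_on {a<..<b}"
  note FL = L2_dominated_convergence[OF f F lim bd]
  obtain r where r: "strict_mono r"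
    "AE x in ?\<mu>. (\<lambda>n. pv_hilbert a b (adjoint_apply B (F (r n))) x) \<longlonglongrightarrow> pv_hilbert a b (adjoint_apply B f) x"
    by (rule pv_converges_L1_limit[OF integrable_adjoint_apply[OF B f] integrable_adjoint_apply[OF B FL(1)]
          AE_pv_adjoint_apply[OF B FL(1)] adjoint_apply_dominated_convergence[OF B f F lim bd]])
       (rule that)
  have lim0: "(\<lambda>n. L2_norm a b (\<lambda>x. R (F (r n)) x - R f x)) \<longlonglongrightarrow> 0"
    using LIMSEQ_subseq_LIMSEQ[OF L2_operator_tendsto[OF R f FL] r(1)] by (simp add: o_def)
  have diffL: "(\<lambda>x. R (F (r n)) x - R f x) \<in> L2_functions a b" for n
    by (intro L2_diff bounded_L2_operatorD(1)[OF R] FL(1) f)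
  obtain s where s: "strict_mono s" "AE x in ?\<mu>. (\<lambda>n. R (F (r (s n))) x - R f x) \<longlonglongrightarrow> 0"
    by (rule L2_norm_tendsto_AE_subseq[of "\<lambda>n x. R (F (r n)) x - R f x" a b, OF diffL lim0])
  have "AE x in ?\<mu>. \<forall>n. R (F n) x = M x *v F n x + c *s (B x *v pv_hilbert a b (adjoint_apply B (F n)) x)"
    using P unfolding pv_representation_def by (simp add: AE_all_countable)
  with r(2) s(2) lim show ?thesis
    unfolding pv_representation_def
  proof eventually_elim
    case (elim x)
    have 1: "(\<lambda>n. R (F (r (s n))) x) \<longlonglongrightarrow> R f x" using elim(2) by (rule LIM_zero_cancel)
    have 2: "(\<lambda>n. pv_hilbert a b (adjoint_apply B (F (r (s n)))) x) \<longlonglongrightarrow> pv_hilbert a b (adjoint_apply B f) x"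
      using LIMSEQ_subseq_LIMSEQ[OF elim(1) s(1)] by (simp add: o_def)
    have 3: "(\<lambda>n. F (r (s n)) x) \<longlonglongrightarrow> f x"
      using LIMSEQ_subseq_LIMSEQ[OF elim(3) strict_mono_o[OF r(1) s(1)]] by (simp add: o_def)
    have "(\<lambda>n. M x *v F (r (s n)) x + c *s (B x *v pv_hilbert a b (adjoint_apply B (F (r (s n)))) x))
        \<longlonglongrightarrow> M x *v f x + c *s (B x *v pv_hilbert a b (adjoint_apply B f) x)"
      by (intro tendsto_add bounded_linear.tendsto[OF bounded_linear_matrix_vector]
          bounded_linear.tendsto[OF bounded_linear_scalar_mult] 2 3)
    then show ?case using 1 LIMSEQ_unique elim(4) by simp
  qed
qed

lemma L2_continuous:
  assumes "continuous_on UNIV (f :: real \<Rightarrow> complex ^ 'k)"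
  shows "f \<in> L2_functions a b"
proof -
  have "continuous_on UNIV (\<lambda>x. (norm (f x))\<^sup>2)" by (intro continuous_intros assms)
  then show ?thesis
    using integrable_continuous_Ioo[OF assms] integrable_continuous_Ioo[of "\<lambda>x. (norm (f x))\<^sup>2"]
    by (auto simp: L2_functions_def)
qed

text \<open>Subtracting the principal value part from \<open>R\<close> leaves an operator that commutes with \<open>Q\<close>, hence a
  multiplication operator; its matrix is read off on the constant functions.\<close>

theorem pv_representation_of_commutator:
  fixes R :: "(real \<Rightarrow> complex ^ 'k) \<Rightarrow> (real \<Rightarrow> complex ^ 'k)" and B :: "real \<Rightarrow> complex ^ 'm ^ 'k"
  assumes R: "bounded_L2_operator a b R" and B: "L2_columns a b B"
    and comm: "\<And>f. f \<in> L2_functions a b \<Longrightarrow> AE x in lebesgue_on {a<..<b}. Q_op (R f) x - R (Q_op f) x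
        = c *s (B x *v (\<integral>t. adjoint_apply B f t \<partial>lebesgue_on {a<..<b}))"
  obtains M where "M \<in> borel_measurable (lebesgue_on {a<..<b})"
    "\<And>f. f \<in> L2_functions a b \<Longrightarrow> pv_representation a b R M c B f"
proof -
  let ?\<mu> = "lebesgue_on {a<..<b}"
  define e where "e = (\<lambda>j::'k. (\<lambda>_::real. axis j (1::complex)))"
  \<comment> \<open>Forced by the formula to be proved: on the constant function \<open>e j\<close>
    it must produce column \<open>j\<close> of the matrix.\<close>
  define G where "G = (\<lambda>j x. R (e j) x - c *s (B x *v pv_hilbert a b (adjoint_apply B (e j)) x))"
  define M :: "real \<Rightarrow> complex ^ 'k ^ 'k" where "M = (\<lambda>x. \<chi> i j. G j x $ i)"
  have eL: "e j \<in> L2_functions a b" for j unfolding e_def by (rule L2_const)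
  have Me: "M x *v axis j 1 = G j x" for x j
    by (simp add: vec_eq_iff M_def matrix_vector_mult_def axis_def if_distrib[of "\<lambda>z. _ * z"] cong: if_cong)
  have Gm: "G j \<in> borel_measurable ?\<mu>" for j
    unfolding G_def
    by (intro borel_measurable_diff L2D(1)[OF bounded_L2_operatorD(1)[OF R eL]]
        borel_measurable_bounded_linear[OF bounded_linear_scalar_mult]
        borel_measurable_matrix_vector[OF L2_columns_measurable[OF B]] borel_measurable_pv_hilbert
        borel_measurable_adjoint_apply[OF B L2D(1)[OF eL]])
  have Mm: "M \<in> borel_measurable ?\<mu>"
    by (rule borel_measurable_of_columns) (simp only: Me Gm)
  have rep_e: "pv_representation a b R M c B (e j)" for j
    unfolding pv_representation_def by (rule AE_I2) (simp add: e_def[of] Me G_def)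
  have rep_const: "pv_representation a b R M c B (\<lambda>_. v)" for v
  proof -
    have sum: "pv_representation a b R M c B (\<lambda>x. \<Sum>j\<in>J. v $ j *s e j x)" if "finite J" for J
      using that
    proof (induction J rule: finite_induct)
      case empty
      then show ?case using pv_representation_scalar_mult[OF R B eL rep_e, of 0] by simp
    next
      case (insert j J)
      have "(\<lambda>x. \<Sum>j\<in>J. v $ j *s e j x) \<in> L2_functions a b"
        unfolding e_def by (rule L2_const)
      from pv_representation_add[OF R B L2_scalar_mult[OF eL] this pv_representation_scalar_mult[OF R B eL rep_e] insert.IH, of "v $ j" j]
      show ?case using insert.hyps by simp
    qed
    from sum[of UNIV] show ?thesis unfolding e_def basis_expansion by simp
  qed
  have "f \<in> L2_functions a b \<longrightarrow> pv_representation a b R M c B f" if "f \<in> borel_measurable ?\<mu>" for f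
    using that
  proof (induction f rule: measurable_approx_induct)
    case (const v)
    then show ?case using rep_const by blast
  next
    case (add f g)
    then show ?case by (intro impI pv_representation_add[OF R B]) (auto intro: L2_continuous)
  next
    case (mult f)
    have fL: "f \<in> L2_functions a b" by (rule L2_continuous[OF mult(1)])
    \<comment> \<open>The commutator hypothesis enters here: it carries the representation from the
      constants to all polynomials.\<close>
    have "pv_representation a b R M c B (Q_op f)"
      by (rule pv_representation_Q_op[OF R B fL mp[OF mult(2) fL] comm[OF fL]])
    then show ?case by (simp add: Q_op_def)
  next
    case (lim f F d)
    show ?case
    proof
      assume f: "f \<in> L2_functions a b"
      have "pv_representation a b R M c B (F n)" for n
        using lim(5)[of n] L2_dominated_convergence(1)[OF f lim(2-4)] by simp
      then show "pv_representation a b R M c B f" by (rule pv_representation_limit[OF R B f lim(2-4)])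
    qed
  qed
  then have "pv_representation a b R M c B f" if "f \<in> L2_functions a b" for f
    using that L2D(1)[OF that] by simp
  then show thesis by (rule that[OF Mm])
qed

section \<open>Principal value forms with degenerate kernel\<close>

lemma has_pv_integral_unique:
  assumes "has_pv_integral a b x g I" "has_pv_integral a b x g I'"
  shows "I = I'"
  using assms tendsto_unique[OF trivial_limit_at_right_real] unfolding has_pv_integral_def by blast

lemma has_pv_integral_of_pv_converges:
  fixes g :: "real \<Rightarrow> 'a::euclidean_space" and T :: "'a \<Rightarrow> complex ^ 'k"
  assumes T: "bounded_linear T" and g: "integrable (lebesgue_on {a<..<b}) g" and conv: "pv_converges a b g x"
    and h: "\<And>t. t \<in> {a<..<b} \<Longrightarrow> h t = T (g t)"
  shows "has_pv_integral a b x (\<lambda>t. (1 / (x - t)) *\<^sub>R h t) (T (pv_hilbert a b g x))"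
proof -
  have Tg: "integrable (lebesgue_on {a<..<b}) (\<lambda>t. T (g t))"
    by (rule integrable_bounded_linear[OF T g])
  have eq: "indicator {t \<in> {a<..<b}. \<epsilon> < \<bar>x - t\<bar>} t *\<^sub>R ((1 / (x - t)) *\<^sub>R h t)
      = indicator {a<..<b} t *\<^sub>R (hilbert_kernel \<epsilon> (x - t) *\<^sub>R T (g t))" for t \<epsilon>
    using h by (auto simp: indicator_def hilbert_kernel_def)
  have int: "set_lebesgue_integral lebesgue {t \<in> {a<..<b}. \<epsilon> < \<bar>x - t\<bar>} (\<lambda>t. (1 / (x - t)) *\<^sub>R h t)
      = trunc_hilbert a b \<epsilon> (\<lambda>t. T (g t)) x" for \<epsilon>
    unfolding set_lebesgue_integral_def trunc_hilbert_def eq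
    by (rule integral_restrict_space[symmetric]) simp
  have "set_integrable lebesgue {t \<in> {a<..<b}. \<epsilon> < \<bar>x - t\<bar>} (\<lambda>t. (1 / (x - t)) *\<^sub>R h t)" if "0 < \<epsilon>" for \<epsilon>
    using integrable_trunc_hilbert[OF Tg that, of x] unfolding set_integrable_def eq
    by (subst (asm) integrable_restrict_space) auto
  then show ?thesis
    unfolding has_pv_integral_def int using pv_hilbert_linear[OF T g conv] by blast
qed

lemma bounded_linear_kernel: "bounded_linear (\<lambda>y. c *s ((B :: complex ^ 'm ^ 'k) *v y))"
  by (rule bounded_linear_compose[OF bounded_linear_scalar_mult bounded_linear_matrix_vector])

text \<open>Since \<open>adjoint_apply B f\<close> is integrable, its principal value exists almost
  everywhere and, being unique, is the witness in \<open>has_pv_form\<close>. The equivalence is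
  read forwards for \<open>S\<close> and backwards for \<open>T\<close>.\<close>

lemma pv_form_iff_representation:
  fixes R :: "(real \<Rightarrow> complex ^ 'k) \<Rightarrow> (real \<Rightarrow> complex ^ 'k)" and B :: "real \<Rightarrow> complex ^ 'm ^ 'k"
  assumes B: "L2_columns a b B"
    and K: "\<And>x t. x \<in> {a<..<b} \<Longrightarrow> t \<in> {a<..<b} \<Longrightarrow> K x t = mat c ** (B x ** adjoint_matrix (B t))"
  shows "has_pv_form a b R M K \<longleftrightarrow> (\<forall>f\<in>L2_functions a b. pv_representation a b R M c B f)"
proof -
  have "(AE x in lebesgue_on {a<..<b}. \<exists>I. has_pv_integral a b x (\<lambda>t. (1 / (x - t)) *\<^sub>R (K x t *v f t)) I \<and> R f x = M x *v f x + I)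
      \<longleftrightarrow> pv_representation a b R M c B f" if f: "f \<in> L2_functions a b" for f
  proof -
    have *: "AE x in lebesgue_on {a<..<b}. (\<exists>I. has_pv_integral a b x (\<lambda>t. (1 / (x - t)) *\<^sub>R (K x t *v f t)) I \<and> R f x = M x *v f x + I)
      \<longleftrightarrow> R f x = M x *v f x + c *s (B x *v pv_hilbert a b (adjoint_apply B f) x)"
      using AE_pv_adjoint_apply[OF B f] AE_space
    proof eventually_elim
      case (elim x)
      have "has_pv_integral a b x (\<lambda>t. (1 / (x - t)) *\<^sub>R (K x t *v f t)) (c *s (B x *v pv_hilbert a b (adjoint_apply B f) x))"
      proof (rule has_pv_integral_of_pv_converges[OF bounded_linear_kernel integrable_adjoint_apply[OF B f] elim(1)])
        fix t assume "t \<in> {a<..<b}"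
        then show "K x t *v f t = c *s (B x *v adjoint_apply B f t)"
          using K elim(2) by (simp add: matrix_vector_mul_assoc[symmetric] mat_mult_vec adjoint_apply_def)
      qed
      then show ?case using has_pv_integral_unique by blast
    qed
    show ?thesis
      unfolding pv_representation_def
    proof
      assume "AE x in lebesgue_on {a<..<b}. \<exists>I. has_pv_integral a b x (\<lambda>t. (1 / (x - t)) *\<^sub>R (K x t *v f t)) I \<and> R f x = M x *v f x + I"
      with * show "AE x in lebesgue_on {a<..<b}. R f x = M x *v f x + c *s (B x *v pv_hilbert a b (adjoint_apply B f) x)"
        by eventually_elim blast
    next
      assume "AE x in lebesgue_on {a<..<b}. R f x = M x *v f x + c *s (B x *v pv_hilbert a b (adjoint_apply B f) x)"
      with * show "AE x in lebesgue_on {a<..<b}. \<exists>I. has_pv_integral a b x (\<lambda>t. (1 / (x - t)) *\<^sub>R (K x t *v f t)) I \<and> R f x = M x *v f x + I"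
        by eventually_elim blast
    qed
  qed
  then show ?thesis by (auto simp: has_pv_form_def)
qed

text \<open>Bounded functions supported where \<open>B\<close> and \<open>M\<close> are bounded. For
  them \<open>adjoint_apply B f\<close> is bounded as well, so that
  \<open>pv_hilbert_antisymmetric\<close> is available.\<close>

definition tame :: "real \<Rightarrow> real \<Rightarrow> (real \<Rightarrow> complex ^ 'm ^ 'k) \<Rightarrow> (real \<Rightarrow> complex ^ 'k ^ 'k) \<Rightarrow> real \<Rightarrow> (real \<Rightarrow> complex ^ 'k) \<Rightarrow> bool"
  where "tame a b B M N f \<longleftrightarrow> f \<in> borel_measurable (lebesgue_on {a<..<b}) \<and>
    (\<forall>x\<in>{a<..<b}. norm (f x) \<le> N \<and> (f x \<noteq> 0 \<longrightarrow> column_norm (B x) \<le> N \<and> column_norm (M x) \<le> N))"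

lemma tame_nonneg: "a < b \<Longrightarrow> tame a b B M N f \<Longrightarrow> 0 \<le> N"
  unfolding tame_def by (meson dense greaterThanLessThan_iff norm_ge_zero order_trans)

lemma tame_L2: "tame a b B M N f \<Longrightarrow> f \<in> L2_functions a b"
  unfolding tame_def by (rule L2_bounded) auto

lemma norm_scalar_mult: "norm (c *s (y :: complex ^ 'n)) = cmod c * norm y"
  by (simp add: norm_vec_def norm_mult L2_set_right_distrib)

lemma tame_adjoint_apply_bound:
  assumes "a < b" "tame a b B M N f" "x \<in> {a<..<b}"
  shows "norm (c *s adjoint_apply B f x) \<le> cmod c * (N * N)"
proof -
  have N: "0 \<le> N" by (rule tame_nonneg[OF assms(1,2)])
  have "norm (adjoint_apply B f x) \<le> N * N"
  proof (cases "f x = 0")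
    case False
    then have "column_norm (B x) * norm (f x) \<le> N * N"
      using assms(2,3) N by (intro mult_mono column_norm_nonneg) (auto simp: tame_def)
    then show ?thesis
      using norm_adjoint_matrix_vector_le[of "B x" "f x"] unfolding adjoint_apply_def by linarith
  qed (simp add: adjoint_apply_def N)
  then show ?thesis unfolding norm_scalar_mult by (rule mult_left_mono) simp
qed

text \<open>For general \<open>f\<close> nothing ensures that the two parts of \<open>R f\<close>
  can be integrated separately against \<open>g\<close>; tameness makes both integrals exist, the
  second one after \<open>B\<close> has been moved over to \<open>g\<close>.\<close>

lemma tame_pairing:
  fixes R :: "(real \<Rightarrow> complex ^ 'k) \<Rightarrow> (real \<Rightarrow> complex ^ 'k)" and B :: "real \<Rightarrow> complex ^ 'm ^ 'k"
  assumes ab: "a < b" and B: "L2_columns a b B" and R: "bounded_L2_operator a b R"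
    and M: "M \<in> borel_measurable (lebesgue_on {a<..<b})"
    and c: "cnj c = - c" and f: "tame a b B M N f" and g: "tame a b B M N g"
    and Pf: "pv_representation a b R M c B f"
  shows "integrable (lebesgue_on {a<..<b}) (\<lambda>x. (M x *v f x) \<bullet> g x)"
    and "(\<integral>x. R f x \<bullet> g x \<partial>lebesgue_on {a<..<b}) = (\<integral>x. (M x *v f x) \<bullet> g x \<partial>lebesgue_on {a<..<b})
      - (\<integral>x. (c *s adjoint_apply B g x) \<bullet> pv_hilbert a b (adjoint_apply B f) x \<partial>lebesgue_on {a<..<b})"
proof -
  let ?\<mu> = "lebesgue_on {a<..<b}"
  have N: "0 \<le> N" by (rule tame_nonneg[OF ab f])
  have fm: "f \<in> borel_measurable ?\<mu>" and gm: "g \<in> borel_measurable ?\<mu>" using f g by (auto simp: tame_def)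
  have Mfm: "(\<lambda>x. M x *v f x) \<in> borel_measurable ?\<mu>" by (rule borel_measurable_matrix_vector[OF M fm])
  show i1: "integrable ?\<mu> (\<lambda>x. (M x *v f x) \<bullet> g x)"
  proof (rule integrable_bounded_Ioo[where C = "N * N * N"])
    show "(\<lambda>x. (M x *v f x) \<bullet> g x) \<in> borel_measurable ?\<mu>" by (intro borel_measurable_inner Mfm gm)
    fix x assume x: "x \<in> {a<..<b}"
    show "norm ((M x *v f x) \<bullet> g x) \<le> N * N * N"
    proof (cases "f x = 0")
      case False
      have "norm (M x *v f x) * norm (g x) \<le> (column_norm (M x) * norm (f x)) * norm (g x)"
        by (intro mult_right_mono norm_matrix_vector_le) auto
      also have "\<dots> \<le> N * N * N"
        using f g x False N by (intro mult_mono mult_nonneg_nonneg column_norm_nonneg) (auto simp: tame_def)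
      finally show ?thesis using Cauchy_Schwarz_ineq2[of "M x *v f x" "g x"] by simp
    next
      case True
      then have "M x *v f x = 0" by (simp add: vec_eq_iff matrix_vector_mult_def)
      then show ?thesis using N by simp
    qed
  qed
  have um: "(\<lambda>x. d *s adjoint_apply B h x) \<in> borel_measurable ?\<mu>" if "h \<in> borel_measurable ?\<mu>" for d h
    by (intro borel_measurable_bounded_linear[OF bounded_linear_scalar_mult] borel_measurable_adjoint_apply[OF B that])
  have i2: "integrable ?\<mu> (\<lambda>x. (c *s adjoint_apply B g x) \<bullet> pv_hilbert a b (adjoint_apply B f) x)"
    using pv_hilbert_bounded_pairing(1)[OF ab um[OF gm] tame_adjoint_apply_bound[OF ab g]
        um[OF fm, of 1] tame_adjoint_apply_bound[OF ab f]] by simp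
  have "(\<integral>x. R f x \<bullet> g x \<partial>?\<mu>) = (\<integral>x. (M x *v f x) \<bullet> g x - (c *s adjoint_apply B g x) \<bullet> pv_hilbert a b (adjoint_apply B f) x \<partial>?\<mu>)"
  proof (rule integral_cong_AE)
    show "(\<lambda>x. R f x \<bullet> g x) \<in> borel_measurable ?\<mu>"
      by (intro borel_measurable_inner gm L2D(1)[OF bounded_L2_operatorD(1)[OF R tame_L2[OF f]]])
    show "(\<lambda>x. (M x *v f x) \<bullet> g x - (c *s adjoint_apply B g x) \<bullet> pv_hilbert a b (adjoint_apply B f) x) \<in> borel_measurable ?\<mu>"
      using i1 i2 by auto
    show "AE x in ?\<mu>. R f x \<bullet> g x = (M x *v f x) \<bullet> g x - (c *s adjoint_apply B g x) \<bullet> pv_hilbert a b (adjoint_apply B f) x"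
      using Pf unfolding pv_representation_def
    proof eventually_elim
      case (elim x)
      define z where "z = pv_hilbert a b (adjoint_apply B f) x"
      \<comment> \<open>Moving \<open>c\<close> across conjugates it, and \<open>cnj c = - c\<close>
        accounts for the minus sign in the statement.\<close>
      have "(c *s (B x *v z)) \<bullet> g x = (B x *v z) \<bullet> (cnj c *s g x)" by (rule inner_scalar_mult)
      also have "\<dots> = (adjoint_matrix (B x) *v (cnj c *s g x)) \<bullet> z" by (subst inner_adjoint_matrix) (rule inner_commute)
      also have "\<dots> = - ((c *s adjoint_apply B g x) \<bullet> z)"
        unfolding scalar_mult_matrix_vector adjoint_apply_def c by simp
      finally show ?case using elim by (simp add: z_def inner_add_left)
    qed
  qed
  also have "\<dots> = (\<integral>x. (M x *v f x) \<bullet> g x \<partial>?\<mu>) - (\<integral>x. (c *s adjoint_apply B g x) \<bullet> pv_hilbert a b (adjoint_apply B f) x \<partial>?\<mu>)"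
    by (rule Bochner_Integration.integral_diff[OF i1 i2])
  finally show "(\<integral>x. R f x \<bullet> g x \<partial>?\<mu>) = \<dots>" .
qed

text \<open>The principal value part contributes nothing to the antisymmetric part of the form of \<open>R\<close>.\<close>

lemma tame_symmetry_defect:
  fixes R :: "(real \<Rightarrow> complex ^ 'k) \<Rightarrow> (real \<Rightarrow> complex ^ 'k)" and B :: "real \<Rightarrow> complex ^ 'm ^ 'k"
  assumes ab: "a < b" and B: "L2_columns a b B" and R: "bounded_L2_operator a b R"
    and M: "M \<in> borel_measurable (lebesgue_on {a<..<b})"
    and c: "cnj c = - c" and f: "tame a b B M N f" and g: "tame a b B M N g"
    and P: "\<And>f. f \<in> L2_functions a b \<Longrightarrow> pv_representation a b R M c B f"
  shows "(\<integral>x. R f x \<bullet> g x \<partial>lebesgue_on {a<..<b}) - (\<integral>x. f x \<bullet> R g x \<partial>lebesgue_on {a<..<b})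
    = (\<integral>x. (M x *v f x) \<bullet> g x \<partial>lebesgue_on {a<..<b}) - (\<integral>x. f x \<bullet> (M x *v g x) \<partial>lebesgue_on {a<..<b})"
proof -
  let ?\<mu> = "lebesgue_on {a<..<b}"
  define u v where "u = adjoint_apply B g" and "v = adjoint_apply B f"
  have fL: "f \<in> L2_functions a b" and gL: "g \<in> L2_functions a b" using f g tame_L2 by blast+
  have um: "(\<lambda>x. c *s u x) \<in> borel_measurable ?\<mu>" and vm: "v \<in> borel_measurable ?\<mu>"
    unfolding u_def v_def
    by (intro borel_measurable_bounded_linear[OF bounded_linear_scalar_mult] borel_measurable_adjoint_apply[OF B] L2D(1) fL gL)+
  have vb: "norm (v x) \<le> 1 * (N * N)" if "x \<in> {a<..<b}" for x
    using tame_adjoint_apply_bound[OF ab f that, of 1] by (simp add: v_def)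
  have ub: "norm (c *s u x) \<le> cmod c * (N * N)" if "x \<in> {a<..<b}" for x
    using tame_adjoint_apply_bound[OF ab g that] by (simp add: u_def)
  have "(\<integral>x. (c *s u x) \<bullet> pv_hilbert a b v x \<partial>?\<mu>) = - (\<integral>x. v x \<bullet> pv_hilbert a b (\<lambda>x. c *s u x) x \<partial>?\<mu>)"
    by (rule pv_hilbert_antisymmetric[OF ab um ub vm vb])
  \<comment> \<open>Moving \<open>c\<close> out of the transform and across the inner product gives
    a second sign, which cancels the one from antisymmetry: the principal value term is symmetric in
    \<open>f\<close> and \<open>g\<close>.\<close>
  also have "(\<integral>x. v x \<bullet> pv_hilbert a b (\<lambda>x. c *s u x) x \<partial>?\<mu>) = (\<integral>x. - ((c *s v x) \<bullet> pv_hilbert a b u x) \<partial>?\<mu>)"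
  proof (rule integral_cong_AE)
    have um': "u \<in> borel_measurable ?\<mu>" unfolding u_def by (rule borel_measurable_adjoint_apply[OF B L2D(1)[OF gL]])
    show "(\<lambda>x. v x \<bullet> pv_hilbert a b (\<lambda>x. c *s u x) x) \<in> borel_measurable ?\<mu>"
      by (intro borel_measurable_inner vm borel_measurable_pv_hilbert um)
    show "(\<lambda>x. - ((c *s v x) \<bullet> pv_hilbert a b u x)) \<in> borel_measurable ?\<mu>"
      by (intro borel_measurable_uminus borel_measurable_inner borel_measurable_bounded_linear[OF bounded_linear_scalar_mult]
          vm borel_measurable_pv_hilbert um')
    show "AE x in ?\<mu>. v x \<bullet> pv_hilbert a b (\<lambda>x. c *s u x) x = - ((c *s v x) \<bullet> pv_hilbert a b u x)"
      using AE_pv_adjoint_apply[OF B gL]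
    proof eventually_elim
      case (elim x)
      have "pv_hilbert a b (\<lambda>x. c *s u x) x = c *s pv_hilbert a b u x"
        unfolding u_def
        by (rule pv_hilbert_eqI[OF pv_hilbert_linear[OF bounded_linear_scalar_mult integrable_adjoint_apply[OF B gL] elim]])
      then show ?case by (simp add: inner_scalar_mult c)
    qed
  qed
  finally have "(\<integral>x. (c *s u x) \<bullet> pv_hilbert a b v x \<partial>?\<mu>) = (\<integral>x. (c *s v x) \<bullet> pv_hilbert a b u x \<partial>?\<mu>)" by simp
  then show ?thesis
    using tame_pairing(2)[OF ab B R M c f g P[OF fL]] tame_pairing(2)[OF ab B R M c g f P[OF gL]]
    by (simp add: u_def v_def inner_commute)
qed

lemma L2_inner_tendsto:
  fixes f g :: "real \<Rightarrow> complex ^ 'k"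
  assumes f: "f \<in> L2_functions a b" and g: "g \<in> L2_functions a b"
    and F: "\<And>n. F n \<in> L2_functions a b" and G: "\<And>n. G n \<in> L2_functions a b"
    and lf: "(\<lambda>n. L2_norm a b (\<lambda>x. F n x - f x)) \<longlonglongrightarrow> 0" and lg: "(\<lambda>n. L2_norm a b (\<lambda>x. G n x - g x)) \<longlonglongrightarrow> 0"
  shows "(\<lambda>n. \<integral>x. F n x \<bullet> G n x \<partial>lebesgue_on {a<..<b}) \<longlonglongrightarrow> (\<integral>x. f x \<bullet> g x \<partial>lebesgue_on {a<..<b})"
proof -
  let ?\<mu> = "lebesgue_on {a<..<b}"
  let ?a = "\<lambda>n. L2_norm a b (\<lambda>x. F n x - f x)" and ?b = "\<lambda>n. L2_norm a b (\<lambda>x. G n x - g x)"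
  note dF = L2_diff[OF F f] and dG = L2_diff[OF G g]
  have le: "norm ((\<integral>x. F n x \<bullet> G n x \<partial>?\<mu>) - (\<integral>x. f x \<bullet> g x \<partial>?\<mu>)) \<le> ?a n * ?b n + ?a n * L2_norm a b g + L2_norm a b f * ?b n" for n
  proof -
    have "(\<integral>x. F n x \<bullet> G n x \<partial>?\<mu>) - (\<integral>x. f x \<bullet> g x \<partial>?\<mu>) = (\<integral>x. F n x \<bullet> G n x - f x \<bullet> g x \<partial>?\<mu>)"
      by (rule Bochner_Integration.integral_diff[symmetric]) (intro L2_inner_integrable(2) F G f g)+
    also have "\<dots> = (\<integral>x. (F n x - f x) \<bullet> (G n x - g x) + (F n x - f x) \<bullet> g x + f x \<bullet> (G n x - g x) \<partial>?\<mu>)"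
      by (rule Bochner_Integration.integral_cong) (auto simp: inner_diff_left inner_diff_right)
    also have "\<dots> = (\<integral>x. (F n x - f x) \<bullet> (G n x - g x) \<partial>?\<mu>) + (\<integral>x. (F n x - f x) \<bullet> g x \<partial>?\<mu>) + (\<integral>x. f x \<bullet> (G n x - g x) \<partial>?\<mu>)"
      using L2_inner_integrable(2)[OF dF dG] L2_inner_integrable(2)[OF dF g] L2_inner_integrable(2)[OF f dG]
      by (simp add: Bochner_Integration.integral_add)
    finally show ?thesis
      using L2_Cauchy_Schwarz[OF dF dG, of n n] L2_Cauchy_Schwarz[OF dF g, of n] L2_Cauchy_Schwarz[OF f dG, of n]
      unfolding real_norm_def by linarith
  qed
  have lim: "(\<lambda>n. ?a n * ?b n + ?a n * L2_norm a b g + L2_norm a b f * ?b n) \<longlonglongrightarrow> 0"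
    using tendsto_add[OF tendsto_add[OF tendsto_mult[OF lf lg] tendsto_mult_right[OF lf, of "L2_norm a b g"]]
        tendsto_mult_left[OF lg, of "L2_norm a b f"]] by simp
  have "(\<lambda>n. (\<integral>x. F n x \<bullet> G n x \<partial>?\<mu>) - (\<integral>x. f x \<bullet> g x \<partial>?\<mu>)) \<longlonglongrightarrow> 0"
    by (rule Lim_null_comparison[OF always_eventually[OF allI[OF le]] lim])
  then show ?thesis by (rule LIM_zero_cancel)
qed

text \<open>On tame functions the symmetry defect is that of multiplication by \<open>M\<close>,
  which vanishes for hermitian \<open>M\<close>. Cut-offs approximate every function in norm by tame
  ones, and boundedness of \<open>R\<close> carries the identity to the limit.\<close>

lemma L2_symmetric_of_hermitian:
  fixes R :: "(real \<Rightarrow> complex ^ 'k) \<Rightarrow> (real \<Rightarrow> complex ^ 'k)" and B :: "real \<Rightarrow> complex ^ 'm ^ 'k"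
  assumes ab: "a < b" and B: "L2_columns a b B" and R: "bounded_L2_operator a b R"
    and M: "M \<in> borel_measurable (lebesgue_on {a<..<b})" and herm: "\<And>x. x \<in> {a<..<b} \<Longrightarrow> M x = adjoint_matrix (M x)"
    and c: "cnj c = - c"
    and P: "\<And>f. f \<in> L2_functions a b \<Longrightarrow> pv_representation a b R M c B f"
    and f: "f \<in> L2_functions a b" and g: "g \<in> L2_functions a b"
  shows "(\<integral>x. R f x \<bullet> g x \<partial>lebesgue_on {a<..<b}) = (\<integral>x. f x \<bullet> R g x \<partial>lebesgue_on {a<..<b})"
proof -
  let ?\<mu> = "lebesgue_on {a<..<b}"
  \<comment> \<open>One level \<open>n\<close> bounds \<open>B\<close>, \<open>M\<close> and the
    function together; at each point the cut-off is eventually inactive.\<close>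
  define cut where "cut = (\<lambda>n h x. if column_norm (B x) \<le> real n \<and> column_norm (M x) \<le> real n \<and> norm (h x) \<le> real n
      then h x else 0 :: complex ^ 'k)"
  have [measurable]: "(\<lambda>x. column_norm (B x)) \<in> borel_measurable ?\<mu>" "(\<lambda>x. column_norm (M x)) \<in> borel_measurable ?\<mu>"
    by (rule borel_measurable_column_norm, rule L2_columns_measurable[OF B] M)+
  have tm: "tame a b B M (real n) (cut n h)" if h: "h \<in> L2_functions a b" for n h
  proof -
    note [measurable] = L2D(1)[OF h]
    have "cut n h \<in> borel_measurable ?\<mu>" unfolding cut_def by measurable
    then show ?thesis by (auto simp: tame_def cut_def)
  qed
  have lim: "(\<lambda>n. L2_norm a b (\<lambda>x. cut n h x - h x)) \<longlonglongrightarrow> 0" if h: "h \<in> L2_functions a b" for h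
  proof (rule L2_dominated_convergence(2)[OF h, of _ 0])
    show "cut n h \<in> borel_measurable ?\<mu>" for n using tm[OF h] by (auto simp: tame_def)
    show "AE x in ?\<mu>. norm (cut n h x) \<le> 0 + norm (h x)" for n by (simp add: cut_def)
    have "(\<lambda>n. cut n h x) \<longlonglongrightarrow> h x" for x
    proof (rule tendsto_eventually)
      define m where "m = nat \<lceil>max (column_norm (B x)) (max (column_norm (M x)) (norm (h x)))\<rceil>"
      have "cut n h x = h x" if "m \<le> n" for n
        using that by (auto simp: cut_def m_def nat_le_iff ceiling_le_iff)
      then show "\<forall>\<^sub>F n in sequentially. cut n h x = h x" unfolding eventually_sequentially by blast
    qed
    then show "AE x in ?\<mu>. (\<lambda>n. cut n h x) \<longlonglongrightarrow> h x" by simp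
  qed
  have eq: "(\<integral>x. R (cut n f) x \<bullet> cut n g x \<partial>?\<mu>) = (\<integral>x. cut n f x \<bullet> R (cut n g) x \<partial>?\<mu>)" for n
  proof -
    have "(\<integral>x. (M x *v cut n f x) \<bullet> cut n g x \<partial>?\<mu>) = (\<integral>x. cut n f x \<bullet> (M x *v cut n g x) \<partial>?\<mu>)"
    proof (rule Bochner_Integration.integral_cong[OF refl])
      fix x assume "x \<in> space ?\<mu>"
      then have "M x = adjoint_matrix (M x)" using herm by simp
      then show "(M x *v cut n f x) \<bullet> cut n g x = cut n f x \<bullet> (M x *v cut n g x)"
        using inner_adjoint_matrix[of "M x"] by simp
    qed
    then show ?thesis using tame_symmetry_defect[OF ab B R M c tm[OF f] tm[OF g] P, of n] by simp
  qed
  note cL = tame_L2[OF tm] and RL = bounded_L2_operatorD(1)[OF R]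
  show ?thesis
  proof (rule LIMSEQ_unique)
    show "(\<lambda>n. \<integral>x. R (cut n f) x \<bullet> cut n g x \<partial>?\<mu>) \<longlonglongrightarrow> (\<integral>x. R f x \<bullet> g x \<partial>?\<mu>)"
      by (rule L2_inner_tendsto[OF RL[OF f] g RL[OF cL[OF f]] cL[OF g] L2_operator_tendsto[OF R f cL[OF f] lim[OF f]] lim[OF g]])
    show "(\<lambda>n. \<integral>x. R (cut n f) x \<bullet> cut n g x \<partial>?\<mu>) \<longlonglongrightarrow> (\<integral>x. f x \<bullet> R g x \<partial>?\<mu>)"
      unfolding eq
      by (rule L2_inner_tendsto[OF f RL[OF g] cL[OF f] RL[OF cL[OF g]] lim[OF f] L2_operator_tendsto[OF R g cL[OF g] lim[OF g]]])
  qed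
qed

text \<open>Testing with basis vectors restricted to a measurable set localizes the symmetry defect,
  so that integral identities yield a pointwise one.\<close>

lemma hermitian_of_L2_symmetric:
  fixes R :: "(real \<Rightarrow> complex ^ 'k) \<Rightarrow> (real \<Rightarrow> complex ^ 'k)" and B :: "real \<Rightarrow> complex ^ 'm ^ 'k"
  assumes ab: "a < b" and B: "L2_columns a b B" and R: "bounded_L2_operator a b R"
    and M: "M \<in> borel_measurable (lebesgue_on {a<..<b})" and c: "cnj c = - c"
    and P: "\<And>f. f \<in> L2_functions a b \<Longrightarrow> pv_representation a b R M c B f"
    and sym: "\<And>f g. f \<in> L2_functions a b \<Longrightarrow> g \<in> L2_functions a b \<Longrightarrow>
      (\<integral>x. R f x \<bullet> g x \<partial>lebesgue_on {a<..<b}) = (\<integral>x. f x \<bullet> R g x \<partial>lebesgue_on {a<..<b})"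
  shows "AE x in lebesgue_on {a<..<b}. M x = adjoint_matrix (M x)"
proof -
  let ?\<mu> = "lebesgue_on {a<..<b}"
  define d where "d = (\<lambda>w w' x. (M x *v w) \<bullet> w' - w \<bullet> (M x *v w'))"
  have [measurable]: "(\<lambda>x. column_norm (B x)) \<in> borel_measurable ?\<mu>" "(\<lambda>x. column_norm (M x)) \<in> borel_measurable ?\<mu>"
    by (rule borel_measurable_column_norm, rule L2_columns_measurable[OF B] M)+
  have dm [measurable]: "d w w' \<in> borel_measurable ?\<mu>" for w w'
    unfolding d_def
    by (intro borel_measurable_diff borel_measurable_inner borel_measurable_const borel_measurable_bounded_linear[OF bounded_linear_matrix_arg M])
  have le0: "AE x in ?\<mu>. \<forall>n::nat. column_norm (B x) \<le> n \<and> column_norm (M x) \<le> n \<longrightarrow> d w w' x \<le> 0"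
    if w: "w \<in> Basis" "w' \<in> Basis" for w w' :: "complex ^ 'k"
    unfolding AE_all_countable
  proof
    fix n :: nat
    \<comment> \<open>Selects the points where the defect \<open>d\<close> is positive and the
      matrices are bounded. Symmetry makes the integral of \<open>E x * d w w' x\<close> vanish,
      although the integrand is nonnegative.\<close>
    define E where "E = (\<lambda>x. if column_norm (B x) \<le> n \<and> column_norm (M x) \<le> n \<and> 0 < d w w' x then 1 else 0 :: real)"
    have Em [measurable]: "E \<in> borel_measurable ?\<mu>" unfolding E_def by measurable
    \<comment> \<open>The bound \<open>max 1\<close> accommodates the norm of a basis vector when n
      = 0.\<close>
    have tm: "tame a b B M (max 1 (real n)) (\<lambda>x. E x *\<^sub>R v)" if "v \<in> Basis" for v
    proof -
      have "(\<lambda>x. E x *\<^sub>R v) \<in> borel_measurable ?\<mu>" by measurable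
      then show ?thesis using that by (auto simp: tame_def E_def norm_Basis)
    qed
    have i: "integrable ?\<mu> (\<lambda>x. (M x *v (E x *\<^sub>R v)) \<bullet> (E x *\<^sub>R v'))" if "v \<in> Basis" "v' \<in> Basis" for v v'
      by (rule tame_pairing(1)[OF ab B R M c tm[OF that(1)] tm[OF that(2)] P[OF tame_L2[OF tm[OF that(1)]]]])
    have e: "(M x *v (E x *\<^sub>R w)) \<bullet> (E x *\<^sub>R w') - (E x *\<^sub>R w) \<bullet> (M x *v (E x *\<^sub>R w')) = E x * d w w' x" for x
      by (simp add: d_def E_def linear_0[OF bounded_linear.linear[OF bounded_linear_matrix_vector]])
    have i': "integrable ?\<mu> (\<lambda>x. (E x *\<^sub>R w) \<bullet> (M x *v (E x *\<^sub>R w')))"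
      using i[OF w(2,1)] by (simp only: inner_commute)
    have iE: "integrable ?\<mu> (\<lambda>x. E x * d w w' x)"
      using Bochner_Integration.integrable_diff[OF i[OF w] i'] unfolding e .
    have "(\<integral>x. E x * d w w' x \<partial>?\<mu>) = (\<integral>x. (M x *v (E x *\<^sub>R w)) \<bullet> (E x *\<^sub>R w') \<partial>?\<mu>) - (\<integral>x. (E x *\<^sub>R w) \<bullet> (M x *v (E x *\<^sub>R w')) \<partial>?\<mu>)"
      using Bochner_Integration.integral_diff[OF i[OF w] i'] unfolding e .
    also have "\<dots> = 0"
      using tame_symmetry_defect[OF ab B R M c tm[OF w(1)] tm[OF w(2)] P]
        sym[OF tame_L2[OF tm[OF w(1)]] tame_L2[OF tm[OF w(2)]]] by simp
    finally have "AE x in ?\<mu>. E x * d w w' x = 0"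
      by (subst (asm) integral_nonneg_eq_0_iff_AE[OF iE]) (auto simp: E_def)
    then show "AE x in ?\<mu>. column_norm (B x) \<le> n \<and> column_norm (M x) \<le> n \<longrightarrow> d w w' x \<le> 0"
      by eventually_elim (auto simp: E_def split: if_splits)
  qed
  have "AE x in ?\<mu>. \<forall>w\<in>Basis. \<forall>w'\<in>Basis. \<forall>n::nat. column_norm (B x) \<le> n \<and> column_norm (M x) \<le> n \<longrightarrow> d w w' x \<le> 0"
    using le0 by (intro AE_finite_allI) auto
  then show ?thesis
  proof eventually_elim
    case (elim x)
    obtain n :: nat where n: "max (column_norm (B x)) (column_norm (M x)) \<le> n" using real_arch_simple by blast
    have "d w w' x = 0" if "w \<in> Basis" "w' \<in> Basis" for w w'
    proof -
      \<comment> \<open>Antisymmetry of the defect turns the one-sided bound for both orders of the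
        vectors into equality.\<close>
      have "d w' w x = - d w w' x" by (simp add: d_def inner_commute)
      moreover have "d w w' x \<le> 0" "d w' w x \<le> 0" using elim that n by auto
      ultimately show ?thesis by simp
    qed
    then have mw: "(M x *v w) \<bullet> w' = (adjoint_matrix (M x) *v w) \<bullet> w'" if "w \<in> Basis" "w' \<in> Basis" for w w'
      using that by (simp add: d_def inner_adjoint_matrix)
    have Mw: "M x *v w = adjoint_matrix (M x) *v w" if "w \<in> Basis" for w
      by (rule euclidean_eqI) (rule mw[OF that])
    show "M x = adjoint_matrix (M x)"
      unfolding matrix_eq
    proof
      fix y
      have lin: "linear (\<lambda>y. X *v y)" for X :: "complex ^ 'k ^ 'k"
        by (rule bounded_linear.linear[OF bounded_linear_matrix_vector])
      show "M x *v y = adjoint_matrix (M x) *v y"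
        by (rule linear_eq_on_span[OF lin lin, of Basis]) (use Mw in auto)
    qed
  qed
qed

section \<open>The inverse operator\<close>

lemma operator_identity_rank_form:
  fixes S :: "(real \<Rightarrow> complex ^ 'k) \<Rightarrow> (real \<Rightarrow> complex ^ 'k)" and A :: "real \<Rightarrow> complex ^ 'm ^ 'k"
  assumes D: "\<And>x t. x \<in> {a<..<b} \<Longrightarrow> t \<in> {a<..<b} \<Longrightarrow> D x t = mat \<i> ** (A x ** adjoint_matrix (A t))"
    and op_id: "satisfies_operator_identity a b S D" and f: "f \<in> L2_functions a b"
    and i: "integrable (lebesgue_on {a<..<b}) (adjoint_apply A f)"
  shows "AE x in lebesgue_on {a<..<b}. Q_op (S f) x - S (Q_op f) x
    = \<i> *s (A x *v (\<integral>t. adjoint_apply A f t \<partial>lebesgue_on {a<..<b}))"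
  using bspec[OF op_id[unfolded satisfies_operator_identity_def] f] AE_space
proof eventually_elim
  case (elim x)
  let ?\<mu> = "lebesgue_on {a<..<b}"
  have "(\<integral>t. D x t *v f t \<partial>?\<mu>) = (\<integral>t. \<i> *s (A x *v adjoint_apply A f t) \<partial>?\<mu>)"
    using D elim(2)
    by (intro Bochner_Integration.integral_cong)
       (auto simp: matrix_vector_mul_assoc[symmetric] mat_mult_vec adjoint_apply_def)
  also have "\<dots> = \<i> *s (A x *v (\<integral>t. adjoint_apply A f t \<partial>?\<mu>))"
    by (rule integral_bounded_linear[OF bounded_linear_kernel i])
  finally show ?case using elim by simp
qed

text \<open>If \<open>w\<close> is orthogonal to all vectors \<open>v\<close> with \<open>A v \<in> L\<^sup>2\<close>, then applying the operator identity to truncations of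
  \<open>A w\<close> gives \<open>A w = 0\<close>.\<close>

lemma L2_columns_of_operator_identity:
  fixes S :: "(real \<Rightarrow> complex ^ 'k) \<Rightarrow> (real \<Rightarrow> complex ^ 'k)" and A :: "real \<Rightarrow> complex ^ 'm ^ 'k"
  assumes S: "bounded_L2_operator a b S" and A: "A \<in> borel_measurable (lebesgue_on {a<..<b})"
    and D: "\<And>x t. x \<in> {a<..<b} \<Longrightarrow> t \<in> {a<..<b} \<Longrightarrow> D x t = mat \<i> ** (A x ** adjoint_matrix (A t))"
    and op_id: "satisfies_operator_identity a b S D"
  shows "L2_columns a b A"
proof -
  let ?\<mu> = "lebesgue_on {a<..<b}"
  define W where "W = {w. (\<lambda>x. A x *v w) \<in> L2_functions a b}"
  have Am: "(\<lambda>x. A x *v w) \<in> borel_measurable ?\<mu>" for w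
    by (rule borel_measurable_bounded_linear[OF bounded_linear_matrix_arg A])
  have "subspace W"
  proof (rule subspaceI)
    show "0 \<in> W" using L2_const[of 0 a b] by (simp add: W_def linear_0[OF bounded_linear.linear[OF bounded_linear_matrix_vector]])
    show "x + y \<in> W" if "x \<in> W" "y \<in> W" for x y
      using that L2_add by (auto simp: W_def matrix_vector_right_distrib)
    show "c *\<^sub>R x \<in> W" if "x \<in> W" for c x
      using that L2_bounded_linear[OF bounded_linear_scaleR_right]
      by (auto simp: W_def linear_scale[OF bounded_linear.linear[OF bounded_linear_matrix_vector]])
  qed
  have zero: "w = 0" if perp: "\<And>v. v \<in> W \<Longrightarrow> v \<bullet> w = 0" for w
  proof -
    \<comment> \<open>Cutting off where \<open>A\<close> is large makes \<open>F n\<close> and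
      \<open>adjoint_apply A (F n)\<close> bounded before anything is known about the integrability
      of the columns.\<close>
    define F where "F = (\<lambda>(n::nat) x. if column_norm (A x) \<le> n then A x *v w else 0)"
    have Fm: "F n \<in> borel_measurable ?\<mu>" for n
    proof -
      note [measurable] = Am[of w] borel_measurable_column_norm[OF A]
      show ?thesis unfolding F_def by measurable
    qed
    have Fb: "norm (F n x) \<le> n * norm w" for n x
      using order_trans[OF norm_matrix_vector_le mult_right_mono[of "column_norm (A x)" n "norm w"]] by (auto simp: F_def)
    have FL: "F n \<in> L2_functions a b" for n by (rule L2_bounded[OF Fm Fb])
    have adjF: "integrable ?\<mu> (adjoint_apply A (F n))" for n
    proof (rule integrable_bounded_Ioo)
      have "adjoint_apply A (F n) = (\<lambda>t. \<Sum>w\<in>Basis. (F n t \<bullet> (A t *v w)) *\<^sub>R w)"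
        by (simp add: adjoint_apply_expand fun_eq_iff)
      then show "adjoint_apply A (F n) \<in> borel_measurable ?\<mu>"
        by (simp only:) (intro borel_measurable_sum borel_measurable_scaleR borel_measurable_inner Fm Am borel_measurable_const)
      fix x
      show "norm (adjoint_apply A (F n) x) \<le> n * (n * norm w)"
      proof (cases "column_norm (A x) \<le> n")
        case True
        then have "column_norm (A x) * norm (F n x) \<le> n * (n * norm w)"
          by (intro mult_mono Fb) auto
        then show ?thesis using norm_adjoint_matrix_vector_le[of "A x" "F n x"] by (simp add: adjoint_apply_def)
      next
        case False
        then show ?thesis
          by (simp add: adjoint_apply_def F_def linear_0[OF bounded_linear.linear[OF bounded_linear_matrix_vector]])
      qed
    qed
    define v where "v = (\<lambda>n. \<integral>t. adjoint_apply A (F n) t \<partial>?\<mu>)"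
    \<comment> \<open>Up to the factor \<open>\<i>\<close>, the function \<open>A x *v v n\<close>
      is the commutator applied to \<open>F n\<close>, hence square-integrable.\<close>
    have "v n \<in> W" for n
    proof -
      have AE: "AE x in ?\<mu>. Q_op (S (F n)) x - S (Q_op (F n)) x = \<i> *s (A x *v v n)"
        unfolding v_def by (rule operator_identity_rank_form[OF D op_id FL adjF])
      let ?h = "\<lambda>x. Q_op (S (F n)) x - S (Q_op (F n)) x"
      have h: "?h \<in> L2_functions a b"
        by (intro L2_diff L2_Q_op bounded_L2_operatorD(1)[OF S] FL)
      have "(\<lambda>x. A x *v v n) \<in> L2_functions a b"
      proof (rule L2_dominated[OF Am L2D(2)[OF h]])
        show "AE x in ?\<mu>. (norm (A x *v v n))\<^sup>2 \<le> (norm (?h x))\<^sup>2"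
          using AE by eventually_elim (simp add: norm_scalar_mult)
      qed
      then show ?thesis by (simp add: W_def)
    qed
    then have "v n \<bullet> w = 0" for n using perp by blast
    \<comment> \<open>Moving the adjoint onto \<open>w\<close> pairs \<open>F n\<close> with
      \<open>A w\<close>, and the two agree wherever \<open>F n\<close> does not vanish.\<close>
    moreover have "v n \<bullet> w = (\<integral>x. (norm (F n x))\<^sup>2 \<partial>?\<mu>)" for n
    proof -
      have "v n \<bullet> w = (\<integral>x. adjoint_apply A (F n) x \<bullet> w \<partial>?\<mu>)"
        unfolding v_def using adjF by (intro integral_inner_left[symmetric]) auto
      also have "\<dots> = (\<integral>x. (norm (F n x))\<^sup>2 \<partial>?\<mu>)"
        by (rule Bochner_Integration.integral_cong)
           (auto simp: adjoint_apply_def inner_adjoint_matrix F_def power2_norm_eq_inner)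
      finally show ?thesis .
    qed
    ultimately have "AE x in ?\<mu>. (norm (F n x))\<^sup>2 = 0" for n
      using integral_nonneg_eq_0_iff_AE[OF L2D(2)[OF FL[of n]]] by simp
    then have "AE x in ?\<mu>. \<forall>n. (norm (F n x))\<^sup>2 = 0" by (simp add: AE_all_countable)
    then have "AE x in ?\<mu>. (norm (A x *v w))\<^sup>2 \<le> 0"
    proof eventually_elim
      case (elim x)
      obtain n :: nat where "column_norm (A x) \<le> n" using real_arch_simple by blast
      then show ?case using elim[rule_format, of n] by (simp add: F_def)
    qed
    then have "w \<in> W" using L2_dominated[OF Am, of "\<lambda>_. 0" w] by (simp add: W_def)
    then show ?thesis using perp[of w] by simp
  qed
  have "w \<in> W" for w
  proof -
    \<comment> \<open>A subspace of a finite-dimensional space with trivial orthogonal complement is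
      the whole space.\<close>
    obtain y z where yz: "y \<in> span W" "\<And>v. v \<in> span W \<Longrightarrow> orthogonal z v" "w = y + z"
      using orthogonal_subspace_decomp_exists[of W w] by blast
    have "z = 0" by (rule zero) (use yz(2) span_base in \<open>auto simp: orthogonal_def inner_commute\<close>)
    then show ?thesis using yz(1,3) span_minimal[OF order_refl \<open>subspace W\<close>] by auto
  qed
  then show ?thesis by (simp add: L2_columns_def W_def)
qed

lemma matrix_vector_columns: "(M :: complex ^ 'm ^ 'k) *v w = (\<Sum>j\<in>UNIV. w $ j *s column j M)"
  by (simp add: vec_eq_iff matrix_vector_mult_def column_def mult.commute)

text \<open>\<open>T\<close> is linear only up to null sets, so the columns are added one at a time.
  The exceptional null set may depend on \<open>w\<close>; later uses fix one vector at a
  time.\<close>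

lemma L2_operator_on_columns:
  fixes T :: "(real \<Rightarrow> complex ^ 'k) \<Rightarrow> (real \<Rightarrow> complex ^ 'k)" and A :: "real \<Rightarrow> complex ^ 'm ^ 'k"
  assumes T: "bounded_L2_operator a b T" and A: "L2_columns a b A"
  defines "B \<equiv> \<lambda>x. \<chi> i j. T (\<lambda>x. column j (A x)) x $ i"
  shows "L2_columns a b B" "AE x in lebesgue_on {a<..<b}. T (\<lambda>x. A x *v w) x = B x *v w"
proof -
  let ?\<mu> = "lebesgue_on {a<..<b}"
  have colB: "column j (B x) = T (\<lambda>x. column j (A x)) x" for j x by (simp add: B_def column_def vec_eq_iff)
  have colA: "(\<lambda>x. column j (A x)) \<in> L2_functions a b" for j
  proof -
    have "column j (A x) = A x *v axis j 1" for x
      by (simp add: vec_eq_iff column_def matrix_vector_mult_def axis_def if_distrib[of "\<lambda>z. _ * z"] cong: if_cong)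
    then show ?thesis using A by (simp add: L2_columns_def)
  qed
  have *: "(\<lambda>x. \<Sum>j\<in>J. w $ j *s column j (A x)) \<in> L2_functions a b \<and>
      (\<lambda>x. \<Sum>j\<in>J. w $ j *s column j (B x)) \<in> L2_functions a b \<and>
      (AE x in ?\<mu>. T (\<lambda>x. \<Sum>j\<in>J. w $ j *s column j (A x)) x = (\<Sum>j\<in>J. w $ j *s column j (B x)))"
    if "finite J" for J w
    using that
  proof (induction J rule: finite_induct)
    case empty
    have "AE x in ?\<mu>. T (\<lambda>x. 0 *s 0) x = 0 *s T (\<lambda>x. 0) x"
      by (rule bounded_L2_operatorD(4)[OF T L2_const])
    then show ?case using L2_const[of "0 :: complex ^ 'k"] by simp
  next
    case (insert j J)
    have IH: "(\<lambda>x. \<Sum>j\<in>J. w $ j *s column j (A x)) \<in> L2_functions a b"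
      "(\<lambda>x. \<Sum>j\<in>J. w $ j *s column j (B x)) \<in> L2_functions a b"
      "AE x in ?\<mu>. T (\<lambda>x. \<Sum>j\<in>J. w $ j *s column j (A x)) x = (\<Sum>j\<in>J. w $ j *s column j (B x))"
      using insert.IH by auto
    have "(\<lambda>x. column j (B x)) \<in> L2_functions a b"
      unfolding colB by (rule bounded_L2_operatorD(1)[OF T colA])
    then have "(\<lambda>x. w $ j *s column j (B x) + (\<Sum>j\<in>J. w $ j *s column j (B x))) \<in> L2_functions a b"
      by (intro L2_add L2_scalar_mult IH(2))
    moreover have "AE x in ?\<mu>. T (\<lambda>x. w $ j *s column j (A x) + (\<Sum>j\<in>J. w $ j *s column j (A x))) x
        = w $ j *s column j (B x) + (\<Sum>j\<in>J. w $ j *s column j (B x))"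
      using bounded_L2_operatorD(3)[OF T L2_scalar_mult[OF colA[of j], of "w $ j"] IH(1)]
        bounded_L2_operatorD(4)[OF T colA[of j], of "w $ j"] IH(3)
      by eventually_elim (simp add: colB)
    moreover have "(\<lambda>x. w $ j *s column j (A x) + (\<Sum>j\<in>J. w $ j *s column j (A x))) \<in> L2_functions a b"
      by (intro L2_add L2_scalar_mult colA IH(1))
    ultimately show ?case using insert.hyps by simp
  qed
  show "L2_columns a b B" unfolding L2_columns_def matrix_vector_columns using *[of UNIV] by simp
  show "AE x in ?\<mu>. T (\<lambda>x. A x *v w) x = B x *v w" unfolding matrix_vector_columns using *[of UNIV] by simp
qed

lemma L2_symmetric_inverse:
  assumes S: "bounded_L2_operator a b S" and inv: "is_L2_inverse a b S T"
    and sym: "\<And>f g. f \<in> L2_functions a b \<Longrightarrow> g \<in> L2_functions a b \<Longrightarrow>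
      (\<integral>x. S f x \<bullet> g x \<partial>lebesgue_on {a<..<b}) = (\<integral>x. f x \<bullet> S g x \<partial>lebesgue_on {a<..<b})"
    and f: "f \<in> L2_functions a b" and g: "g \<in> L2_functions a b"
  shows "(\<integral>x. T f x \<bullet> g x \<partial>lebesgue_on {a<..<b}) = (\<integral>x. f x \<bullet> T g x \<partial>lebesgue_on {a<..<b})"
proof -
  let ?\<mu> = "lebesgue_on {a<..<b}"
  have T: "bounded_L2_operator a b T" using inv by (simp add: is_L2_inverse_def)
  have ST: "AE x in ?\<mu>. S (T h) x = h x" if "h \<in> L2_functions a b" for h
    using inv that by (simp add: is_L2_inverse_def L2_eq_def)
  note TL = bounded_L2_operatorD(1)[OF T] and SL = bounded_L2_operatorD(1)[OF S]
  have "(\<integral>x. T f x \<bullet> g x \<partial>?\<mu>) = (\<integral>x. T f x \<bullet> S (T g) x \<partial>?\<mu>)"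
    by (rule integral_cong_AE) (use ST[OF g] in \<open>auto intro!: borel_measurable_inner L2D(1) TL SL f g elim!: eventually_mono\<close>)
  also have "\<dots> = (\<integral>x. S (T f) x \<bullet> T g x \<partial>?\<mu>)" by (rule sym[symmetric]) (intro TL f g)+
  also have "\<dots> = (\<integral>x. f x \<bullet> T g x \<partial>?\<mu>)"
    by (rule integral_cong_AE) (use ST[OF f] in \<open>auto intro!: borel_measurable_inner L2D(1) TL SL f g elim!: eventually_mono\<close>)
  finally show ?thesis .
qed

text \<open>From S T = T S = 1 follows [Q, T] = - T [Q, S] T. With h = T f the inner commutator is c
  A V, and \<open>T\<close> turns \<open>A V\<close> into \<open>B V\<close>.\<close>

lemma inverse_commutator:
  fixes S T :: "(real \<Rightarrow> complex ^ 'k) \<Rightarrow> (real \<Rightarrow> complex ^ 'k)" and A B :: "real \<Rightarrow> complex ^ 'm ^ 'k"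
  assumes S: "bounded_L2_operator a b S" and inv: "is_L2_inverse a b S T"
    and A: "L2_columns a b A" and B: "L2_columns a b B"
    and TA: "\<And>w. AE x in lebesgue_on {a<..<b}. T (\<lambda>x. A x *v w) x = B x *v w"
    and comm: "\<And>f. f \<in> L2_functions a b \<Longrightarrow> AE x in lebesgue_on {a<..<b}. Q_op (S f) x - S (Q_op f) x
        = c *s (A x *v (\<integral>t. adjoint_apply A f t \<partial>lebesgue_on {a<..<b}))"
    and sym: "\<And>f g. f \<in> L2_functions a b \<Longrightarrow> g \<in> L2_functions a b \<Longrightarrow>
      (\<integral>x. T f x \<bullet> g x \<partial>lebesgue_on {a<..<b}) = (\<integral>x. f x \<bullet> T g x \<partial>lebesgue_on {a<..<b})"
    and f: "f \<in> L2_functions a b"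
  shows "AE x in lebesgue_on {a<..<b}. Q_op (T f) x - T (Q_op f) x
    = (- c) *s (B x *v (\<integral>t. adjoint_apply B f t \<partial>lebesgue_on {a<..<b}))"
proof -
  let ?\<mu> = "lebesgue_on {a<..<b}"
  have T: "bounded_L2_operator a b T" using inv by (simp add: is_L2_inverse_def)
  have ST: "AE x in ?\<mu>. S (T h) x = h x" and TS: "AE x in ?\<mu>. T (S h) x = h x" if "h \<in> L2_functions a b" for h
    using inv that by (simp_all add: is_L2_inverse_def L2_eq_def)
  note TL = bounded_L2_operatorD(1)[OF T] and SL = bounded_L2_operatorD(1)[OF S]
  have AL: "(\<lambda>x. A x *v w) \<in> L2_functions a b" for w using A by (simp add: L2_columns_def)
  have BL: "(\<lambda>x. B x *v w) \<in> L2_functions a b" for w using B by (simp add: L2_columns_def)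
  define h where "h = T f"
  have h: "h \<in> L2_functions a b" unfolding h_def by (rule TL[OF f])
  define V where "V = (\<integral>t. adjoint_apply A h t \<partial>?\<mu>)"
  \<comment> \<open>Tested against \<open>w\<close>, the integral defining \<open>V\<close> is the
    pairing of \<open>T f\<close> with \<open>A w\<close>; symmetry moves \<open>T\<close> onto
    \<open>A w\<close>, which becomes \<open>B w\<close>.\<close>
  have V: "V = (\<integral>t. adjoint_apply B f t \<partial>?\<mu>)"
  proof -
    have "V \<bullet> w = (\<integral>t. adjoint_apply B f t \<partial>?\<mu>) \<bullet> w" for w
    proof -
      have pair: "(\<integral>t. adjoint_apply C k t \<partial>?\<mu>) \<bullet> w = (\<integral>t. k t \<bullet> (C t *v w) \<partial>?\<mu>)"
        if "L2_columns a b C" "k \<in> L2_functions a b" for C k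
      proof -
        have "(\<integral>t. adjoint_apply C k t \<partial>?\<mu>) \<bullet> w = (\<integral>t. adjoint_apply C k t \<bullet> w \<partial>?\<mu>)"
          using integrable_adjoint_apply[OF that] by (intro integral_inner_left[symmetric]) auto
        then show ?thesis by (simp add: adjoint_apply_def inner_adjoint_matrix)
      qed
      have "V \<bullet> w = (\<integral>t. T f t \<bullet> (A t *v w) \<partial>?\<mu>)" unfolding V_def h_def by (rule pair[OF A TL[OF f]])
      also have "\<dots> = (\<integral>t. f t \<bullet> T (\<lambda>x. A x *v w) t \<partial>?\<mu>)" by (rule sym[OF f AL])
      also have "\<dots> = (\<integral>t. f t \<bullet> (B t *v w) \<partial>?\<mu>)"
        by (rule integral_cong_AE)
           (use TA[of w] in \<open>auto intro!: borel_measurable_inner L2D(1) TL AL BL f elim!: eventually_mono\<close>)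
      also have "\<dots> = (\<integral>t. adjoint_apply B f t \<partial>?\<mu>) \<bullet> w" by (rule pair[OF B f, symmetric])
      finally show ?thesis .
    qed
    then show ?thesis by (rule euclidean_eqI)
  qed
  have L: "(\<lambda>x. Q_op (S h) x - S (Q_op h) x) \<in> L2_functions a b"
    by (intro L2_diff L2_Q_op SL h)
  have 1: "AE x in ?\<mu>. T (\<lambda>x. Q_op (S h) x - S (Q_op h) x) x = T (\<lambda>x. c *s (A x *v V)) x"
    by (rule bounded_L2_operatorD(2)[OF T L L2_scalar_mult[OF AL]]) (use comm[OF h] in \<open>simp add: V_def\<close>)
  have 2: "AE x in ?\<mu>. T (\<lambda>x. Q_op (S h) x - S (Q_op h) x) x = T (Q_op (S h)) x - T (S (Q_op h)) x"
    by (rule L2_operator_diff[OF T L2_Q_op[OF SL[OF h]] SL[OF L2_Q_op[OF h]]])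
  have "AE x in ?\<mu>. Q_op (S h) x = Q_op f x"
    using ST[OF f] by eventually_elim (simp add: Q_op_def h_def)
  then have 3: "AE x in ?\<mu>. T (Q_op (S h)) x = T (Q_op f) x"
    by (rule bounded_L2_operatorD(2)[OF T L2_Q_op[OF SL[OF h]] L2_Q_op[OF f]])
  show ?thesis
    using 1 2 3 TS[OF L2_Q_op[OF h]] bounded_L2_operatorD(4)[OF T AL[of V], of c] TA[of V]
  proof eventually_elim
    case (elim x)
    then have "T (Q_op f) x - Q_op (T f) x = c *s (B x *v V)" by (simp add: h_def)
    then have "Q_op (T f) x - T (Q_op f) x = - (c *s (B x *v V))" by (metis minus_diff_eq)
    then show ?case by (simp add: V)
  qed
qed

section \<open>Corrections on null sets and at the endpoints, and the conclusion\<close>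

lemma adjoint_matrix_add_half:
  fixes M :: "complex ^ 'k ^ 'k"
  shows "(1/2) *\<^sub>R (M + adjoint_matrix M) = adjoint_matrix ((1/2) *\<^sub>R (M + adjoint_matrix M))"
  by (simp add: adjoint_matrix_def vec_eq_iff add.commute)

lemma bounded_linear_adjoint_matrix: "bounded_linear (adjoint_matrix :: complex ^ 'm ^ 'k \<Rightarrow> _)"
  by (rule linear_conv_bounded_linear[THEN iffD1], rule linearI) (auto simp: adjoint_matrix_def vec_eq_iff)

lemma borel_measurable_extend_Icc:
  fixes f :: "real \<Rightarrow> 'a::euclidean_space"
  assumes "f \<in> borel_measurable (lebesgue_on {a<..<b})"
  shows "(\<lambda>x. if x \<in> {a<..<b} then f x else 0) \<in> borel_measurable (lebesgue_on {a..b})"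
proof -
  have "(\<lambda>x. if x \<in> {a<..<b} then f x else 0) \<in> borel_measurable lebesgue"
    by (rule borel_measurable_if_I[OF assms]) simp
  then show ?thesis by (rule measurable_restrict_space1)
qed

theorem proposition1:
  fixes a b :: real
    and A :: "real \<Rightarrow> complex ^ 'm ^ 'k"
    and L :: "real \<Rightarrow> complex ^ 'k ^ 'k"
    and D :: "real \<Rightarrow> real \<Rightarrow> complex ^ 'k ^ 'k"
    and S T :: "(real \<Rightarrow> complex ^ 'k) \<Rightarrow> (real \<Rightarrow> complex ^ 'k)"
  assumes "a < b"
    and "CARD('k) \<le> CARD('m)"
    and "A \<in> borel_measurable (lebesgue_on {a..b})"
    and "L \<in> borel_measurable (lebesgue_on {a..b})"
    and "\<forall>x\<in>{a..b}. L x = adjoint_matrix (L x)"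
    and "\<forall>x\<in>{a..b}. \<forall>t\<in>{a..b}. D x t = - adjoint_matrix (D t x)"
    and "\<forall>x\<in>{a..b}. \<forall>t\<in>{a..b}. D x t = mat \<i> ** (A x ** adjoint_matrix (A t))"
    and "bounded_L2_operator a b S"
    and "has_pv_form a b S L D"
    and "satisfies_operator_identity a b S D"
    and "is_L2_inverse a b S T"
  shows "\<exists>(M :: real \<Rightarrow> complex ^ 'k ^ 'k) (E :: real \<Rightarrow> real \<Rightarrow> complex ^ 'k ^ 'k)
            (B :: real \<Rightarrow> complex ^ 'm ^ 'k).
      M \<in> borel_measurable (lebesgue_on {a..b}) \<and>
      B \<in> borel_measurable (lebesgue_on {a..b}) \<and>
      (\<forall>x\<in>{a..b}. M x = adjoint_matrix (M x)) \<and>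
      (\<forall>x\<in>{a..b}. \<forall>t\<in>{a..b}. E x t = - (mat \<i> ** (B x ** adjoint_matrix (B t)))) \<and>
      has_pv_form a b T M E"
proof -
  let ?\<mu> = "lebesgue_on {a<..<b}"
  note ab = assms(1) and S = assms(8) and inv = assms(11)
  have T: "bounded_L2_operator a b T" using inv by (simp add: is_L2_inverse_def)
  have Am: "A \<in> borel_measurable ?\<mu>" and Lm: "L \<in> borel_measurable ?\<mu>"
    by (rule measurable_restrict_mono[OF assms(3)] measurable_restrict_mono[OF assms(4)], force)+
  have D: "D x t = mat \<i> ** (A x ** adjoint_matrix (A t))" if "x \<in> {a<..<b}" "t \<in> {a<..<b}" for x t
    using assms(7) that by simp
  \<comment> \<open>This precedes any use of the principal value form of \<open>S\<close>: rewriting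
    it with \<open>pv_hilbert\<close> presupposes that \<open>adjoint_apply A f\<close> is
    integrable.\<close>
  have A2: "L2_columns a b A" by (rule L2_columns_of_operator_identity[OF S Am D assms(10)])
  have PS: "pv_representation a b S L \<i> A f" if "f \<in> L2_functions a b" for f
    using pv_form_iff_representation[OF A2 D] assms(9) that by blast
  have symS: "(\<integral>x. S f x \<bullet> g x \<partial>?\<mu>) = (\<integral>x. f x \<bullet> S g x \<partial>?\<mu>)"
    if "f \<in> L2_functions a b" "g \<in> L2_functions a b" for f g
    by (rule L2_symmetric_of_hermitian[OF ab A2 S Lm _ _ PS that]) (use assms(5) in auto)
  note symT = L2_symmetric_inverse[OF S inv symS]
  define B where "B = (\<lambda>x. (\<chi> i j. T (\<lambda>x. column j (A x)) x $ i) :: complex ^ 'm ^ 'k)"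
  have B2: "L2_columns a b B" and TA: "AE x in ?\<mu>. T (\<lambda>x. A x *v w) x = B x *v w" for w
    unfolding B_def by (rule L2_operator_on_columns[OF T A2])+
  have comm: "AE x in ?\<mu>. Q_op (T f) x - T (Q_op f) x = (- \<i>) *s (B x *v (\<integral>t. adjoint_apply B f t \<partial>?\<mu>))"
    if "f \<in> L2_functions a b" for f
    by (rule inverse_commutator[OF S inv A2 B2 TA _ symT that])
       (rule operator_identity_rank_form[OF D assms(10) _ integrable_adjoint_apply[OF A2]])
  obtain M where Mm: "M \<in> borel_measurable ?\<mu>"
    and PT: "\<And>f. f \<in> L2_functions a b \<Longrightarrow> pv_representation a b T M (- \<i>) B f"
    using pv_representation_of_commutator[OF T B2 comm] by blast
  have herm: "AE x in ?\<mu>. M x = adjoint_matrix (M x)"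
    by (rule hermitian_of_L2_symmetric[OF ab B2 T Mm _ PT symT]) auto
  \<comment> \<open>\<open>M\<close> is hermitian only almost everywhere, while the claim concerns
    every point of the closed interval. The hermitian part agrees with \<open>M\<close> almost
    everywhere, and extension by zero settles the endpoints, for \<open>B'\<close> as well.\<close>
  define M' where "M' = (\<lambda>x. if x \<in> {a<..<b} then (1/2) *\<^sub>R (M x + adjoint_matrix (M x)) else 0)"
  define B' where "B' = (\<lambda>x. if x \<in> {a<..<b} then B x else 0)"
  define E where "E = (\<lambda>x t. - (mat \<i> ** (B' x ** adjoint_matrix (B' t))))"
  have M'm: "M' \<in> borel_measurable (lebesgue_on {a..b})"
    unfolding M'_def
    by (intro borel_measurable_extend_Icc borel_measurable_scaleR borel_measurable_add borel_measurable_const Mm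
        borel_measurable_bounded_linear[OF bounded_linear_adjoint_matrix])
  have B'm: "B' \<in> borel_measurable (lebesgue_on {a..b})"
    unfolding B'_def by (rule borel_measurable_extend_Icc[OF L2_columns_measurable[OF B2]])
  have herm': "M' x = adjoint_matrix (M' x)" for x
    unfolding M'_def using adjoint_matrix_add_half[of "M x"] by (auto simp: adjoint_matrix_def vec_eq_iff)
  have "pv_representation a b T M' (- \<i>) B f" if "f \<in> L2_functions a b" for f
    using PT[OF that] herm AE_space unfolding pv_representation_def
  proof eventually_elim
    case (elim x)
    then have "M' x = M x" by (simp add: M'_def scaleR_2[symmetric])
    then show ?case using elim(1) by simp
  qed
  moreover have "has_pv_form a b T M' E \<longleftrightarrow> (\<forall>f\<in>L2_functions a b. pv_representation a b T M' (- \<i>) B f)"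
  proof (rule pv_form_iff_representation[OF B2])
    fix x t assume "x \<in> {a<..<b}" "t \<in> {a<..<b}"
    moreover have "- (mat \<i> ** X) = mat (- \<i>) ** X" for X :: "complex ^ 'k ^ 'k"
      by (auto simp: vec_eq_iff matrix_matrix_mult_def mat_def sum_negf[symmetric] intro!: sum.cong)
    ultimately show "E x t = mat (- \<i>) ** (B x ** adjoint_matrix (B t))" by (simp add: E_def B'_def)
  qed
  ultimately have "has_pv_form a b T M' E" by blast
  then show ?thesis using M'm B'm herm' by (intro exI[of _ M'] exI[of _ E] exI[of _ B']) (auto simp: E_def)
qed

end
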